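(* Let $M$ be a Kähler manifold of complex dimension $m$ and $f : M\to\mathbb{R}^n$ an isometric immersion with complex Gauss map $\tau' : M\to Gc$. Then $\tau'$ is pluriharmonic if and only if $f$ is a half isotropic immersion with parallel pluri-mean curvature.
   Context: A Kähler manifold is a Riemannian manifold with a parallel orthogonal almost complex structure $J$; $T^cM=TM\otimes\mathbb{C}=T'\oplus T''$ with $J=i$ on $T'$, $J=-i$ on $T''$. Let $N$ be the normal bundle and $\alpha$ the second fundamental form of $f$, extended complex linearly to the complexified bundles. $f$ has parallel pluri-mean curvature (is ppmc) if $\alpha^{(1,1)}(x,y)=\frac12(\alpha(x,y)+\alpha(Jx,Jy))$ is parallel with respect to the tangent and normal connections. In this case let $N^o\subset N$ be the parallel subbundle spanned by the values of $\alpha^{(1,1)}$ and $N^1$ its orthogonal complement in $N$ (complexified when needed). The ppmc immersion $f$ is called half isotropic if $\alpha(T',T')\subset N^1$. $Gc=G_m(\mathbb{C}^n)$ is the complex Grassmannian of complex $m$-dimensional subspaces of $\mathbb{C}^n$ with its standard Hermitian symmetric metric. The complex Gauss map is $\tau'(p)=df_p(T'_pM)=\{df(x)-i\,df(Jx): x\in T_pM\}$. A smooth map $\phi : M\to S$ into a symmetric space is pluriharmonic if its Hessian $Dd\phi$ (formed with the Levi-Civita connections) vanishes on $T'\otimes T''$. *)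

theory Defs
  imports "HOL-Analysis.Analysis"
begin

section \<open>Smooth maps between Euclidean spaces\<close>

text \<open>\<open>dir_deriv F x v\<close> is the directional derivative of \<open>F\<close> at \<open>x\<close> along \<open>v\<close>, and
  \<open>dir_deriv2 F x v w\<close> is the second derivative \<open>D\<^sup>2F\<^sub>x(v, w)\<close>.\<close>

definition dir_deriv :: "('a::real_normed_vector \<Rightarrow> 'b::real_normed_vector) \<Rightarrow> 'a \<Rightarrow> 'a \<Rightarrow> 'b" where
  "dir_deriv F x v = frechet_derivative F (at x) v"

definition dir_deriv2 ::
    "('a::real_normed_vector \<Rightarrow> 'b::real_normed_vector) \<Rightarrow> 'a \<Rightarrow> 'a \<Rightarrow> 'a \<Rightarrow> 'b" where
  "dir_deriv2 F x v w = dir_deriv (\<lambda>y. dir_deriv F y w) x v"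

primrec Ck_on :: "nat \<Rightarrow> 'a::real_normed_vector set \<Rightarrow> ('a \<Rightarrow> 'b::real_normed_vector) \<Rightarrow> bool" where
  "Ck_on 0 S F \<longleftrightarrow> continuous_on S F"
| "Ck_on (Suc k) S F \<longleftrightarrow>
     (\<forall>x\<in>S. F differentiable (at x)) \<and> (\<forall>v. Ck_on k S (\<lambda>x. dir_deriv F x v))"

text \<open>Only meaningful for open \<open>S\<close>, since the derivatives are two-sided.\<close>

definition smooth_on :: "'a::real_normed_vector set \<Rightarrow> ('a \<Rightarrow> 'b::real_normed_vector) \<Rightarrow> bool" where
  "smooth_on S F \<longleftrightarrow> (\<forall>k. Ck_on k S F)"


section \<open>Linear algebra\<close>

definition orth_proj :: "'a::real_inner set \<Rightarrow> 'a \<Rightarrow> 'a" where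
  "orth_proj T v = (THE u. u \<in> T \<and> v - u \<in> orthogonal_comp T)"

text \<open>The complexification of a real vector space \<open>V\<close> is \<open>V \<times> V\<close>, with \<open>(x, y)\<close> standing for
  \<open>x + i y\<close>. The next three definitions are the complex linear and complex bilinear extensions,
  and the identification of the complexification of \<open>\<real>\<^sup>n\<close> with \<open>\<complex>\<^sup>n\<close>.\<close>

definition clin :: "('v \<Rightarrow> 'w) \<Rightarrow> 'v \<times> 'v \<Rightarrow> 'w \<times> 'w" where
  "clin L z = (L (fst z), L (snd z))"

definition cbilin :: "('v \<Rightarrow> 'v \<Rightarrow> 'w::ab_group_add) \<Rightarrow> 'v \<times> 'v \<Rightarrow> 'v \<times> 'v \<Rightarrow> 'w \<times> 'w" where
  "cbilin b z w = (b (fst z) (fst w) - b (snd z) (snd w), b (fst z) (snd w) + b (snd z) (fst w))"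

definition cvec :: "(real^'n) \<times> (real^'n) \<Rightarrow> complex^'n" where
  "cvec z = (\<chi> j. Complex (fst z $ j) (snd z $ j))"

text \<open>The \<open>i\<close>- and \<open>(-i)\<close>-eigenspaces of the complexification of \<open>J\<close>.\<close>

definition T10 :: "('v::ab_group_add \<Rightarrow> 'v) \<Rightarrow> ('v \<times> 'v) set" where
  "T10 J = {z. clin J z = (- snd z, fst z)}"

definition T01 :: "('v::ab_group_add \<Rightarrow> 'v) \<Rightarrow> ('v \<times> 'v) set" where
  "T01 J = {z. clin J z = (snd z, - fst z)}"


section \<open>Smooth manifolds\<close>

text \<open>A chart is a pair of its domain and its coordinate map; values of the map outside the
  domain are irrelevant. A manifold is given by an atlas: its underlying set is the union of the
  chart domains and its topology is the one making all charts homeomorphisms onto open sets.\<close>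

type_synonym ('a, 'e) chart = "'a set \<times> ('a \<Rightarrow> 'e)"

definition chart_image :: "('a, 'e) chart \<Rightarrow> 'e set" where
  "chart_image c = snd c ` fst c"

definition chart_inv :: "('a, 'e) chart \<Rightarrow> 'e \<Rightarrow> 'a" where
  "chart_inv c = inv_into (fst c) (snd c)"

definition points :: "('a, 'e) chart set \<Rightarrow> 'a set" where
  "points A = (\<Union>c\<in>A. fst c)"

definition charts_at :: "('a, 'e) chart set \<Rightarrow> 'a \<Rightarrow> ('a, 'e) chart set" where
  "charts_at A p = {c \<in> A. p \<in> fst c}"

definition atlas_topology :: "('a, 'e::topological_space) chart set \<Rightarrow> 'a topology" where
  "atlas_topology A = topology (\<lambda>O'. O' \<subseteq> points A \<and> (\<forall>c\<in>A. open (snd c ` (fst c \<inter> O'))))"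

lemma openin_atlas_topology:
  fixes A :: "('a, 'e::topological_space) chart set"
  assumes "\<And>c. c \<in> A \<Longrightarrow> inj_on (snd c) (fst c)"
  shows "openin (atlas_topology A) V \<longleftrightarrow>
    V \<subseteq> points A \<and> (\<forall>c\<in>A. open (snd c ` (fst c \<inter> V)))"
proof -
  have "istopology (\<lambda>V. V \<subseteq> points A \<and> (\<forall>c\<in>A. open (snd c ` (fst c \<inter> V))))"
    unfolding istopology_def
  proof (intro conjI allI impI ballI)
    fix S T c
    assume *: "S \<subseteq> points A \<and> (\<forall>c\<in>A. open (snd c ` (fst c \<inter> S)))"
      "T \<subseteq> points A \<and> (\<forall>c\<in>A. open (snd c ` (fst c \<inter> T)))" and c: "c \<in> A"
    have "snd c ` (fst c \<inter> (S \<inter> T)) = snd c ` (fst c \<inter> S) \<inter> snd c ` (fst c \<inter> T)"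
      using assms[OF c] by (auto simp: inj_on_def)
    then show "open (snd c ` (fst c \<inter> (S \<inter> T)))" using * c by auto
  next
    fix \<K> c assume *: "\<forall>K\<in>\<K>. K \<subseteq> points A \<and> (\<forall>c\<in>A. open (snd c ` (fst c \<inter> K)))" and c: "c \<in> A"
    have "snd c ` (fst c \<inter> \<Union>\<K>) = (\<Union>K\<in>\<K>. snd c ` (fst c \<inter> K))" by auto
    then show "open (snd c ` (fst c \<inter> \<Union>\<K>))" using * c by auto
  qed auto
  then show ?thesis unfolding atlas_topology_def by (simp add: topology_inverse')
qed

definition chart_change :: "('a, 'e) chart \<Rightarrow> ('a, 'f) chart \<Rightarrow> 'e \<Rightarrow> 'f" where
  "chart_change c d = snd d \<circ> chart_inv c"

definition smooth_atlas :: "('a, 'e::euclidean_space) chart set \<Rightarrow> bool" where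
  "smooth_atlas A \<longleftrightarrow>
     (\<forall>c\<in>A. inj_on (snd c) (fst c)) \<and>
     (\<forall>c\<in>A. \<forall>d\<in>A. open (snd c ` (fst c \<inter> fst d)) \<and>
        smooth_on (snd c ` (fst c \<inter> fst d)) (chart_change c d))"

definition smooth_manifold :: "('a, 'e::euclidean_space) chart set \<Rightarrow> bool" where
  "smooth_manifold A \<longleftrightarrow> smooth_atlas A \<and>
     Hausdorff_space (atlas_topology A) \<and> second_countable (atlas_topology A)"

text \<open>The coordinate expression of a map in a chart of the source and a chart of the target, and
  the open set on which it is defined.\<close>

definition local_rep :: "('a, 'e) chart \<Rightarrow> ('b, 'f) chart \<Rightarrow> ('a \<Rightarrow> 'b) \<Rightarrow> 'e \<Rightarrow> 'f" where
  "local_rep c d \<phi> = snd d \<circ> \<phi> \<circ> chart_inv c"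

definition smooth_map ::
    "('a, 'e::euclidean_space) chart set \<Rightarrow> ('b, 'f::euclidean_space) chart set \<Rightarrow> ('a \<Rightarrow> 'b) \<Rightarrow> bool"
  where
  "smooth_map A B \<phi> \<longleftrightarrow> continuous_map (atlas_topology A) (atlas_topology B) \<phi> \<and>
     (\<forall>c\<in>A. \<forall>d\<in>B. smooth_on (snd c ` (fst c \<inter> \<phi> -` fst d)) (local_rep c d \<phi>))"


section \<open>Riemannian and Kaehler manifolds\<close>

text \<open>Tensor fields are given by their components in the charts: in the chart \<open>c\<close>, at the
  coordinate point \<open>x\<close>, the metric is the bilinear form \<open>g c x\<close> and the almost complex structure
  is the endomorphism \<open>J c x\<close> of the coordinate space. Components in different charts are related
  by the derivative of the chart change.\<close>

type_synonym ('a, 'e) metric = "('a, 'e) chart \<Rightarrow> 'e \<Rightarrow> 'e \<Rightarrow> 'e \<Rightarrow> real"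
type_synonym ('a, 'e) endo_field = "('a, 'e) chart \<Rightarrow> 'e \<Rightarrow> 'e \<Rightarrow> 'e"

definition riemannian_metric ::
    "('a, 'e::euclidean_space) chart set \<Rightarrow> ('a, 'e) metric \<Rightarrow> bool" where
  "riemannian_metric A g \<longleftrightarrow>
     (\<forall>c\<in>A. (\<forall>v w. smooth_on (chart_image c) (\<lambda>x. g c x v w)) \<and>
        (\<forall>x\<in>chart_image c. bilinear (g c x) \<and> (\<forall>v w. g c x v w = g c x w v) \<and>
           (\<forall>v. v \<noteq> 0 \<longrightarrow> g c x v v > 0))) \<and>
     (\<forall>c\<in>A. \<forall>d\<in>A. \<forall>x\<in>snd c ` (fst c \<inter> fst d). \<forall>v w.
        g c x v w = g d (chart_change c d x)
          (dir_deriv (chart_change c d) x v) (dir_deriv (chart_change c d) x w))"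

definition almost_complex_structure ::
    "('a, 'e::euclidean_space) chart set \<Rightarrow> ('a, 'e) endo_field \<Rightarrow> bool" where
  "almost_complex_structure A J \<longleftrightarrow>
     (\<forall>c\<in>A. (\<forall>v. smooth_on (chart_image c) (\<lambda>x. J c x v)) \<and>
        (\<forall>x\<in>chart_image c. linear (J c x) \<and> (\<forall>v. J c x (J c x v) = - v))) \<and>
     (\<forall>c\<in>A. \<forall>d\<in>A. \<forall>x\<in>snd c ` (fst c \<inter> fst d). \<forall>v.
        dir_deriv (chart_change c d) x (J c x v) =
          J d (chart_change c d x) (dir_deriv (chart_change c d) x v))"

text \<open>The Levi-Civita connection of a metric on an open subset of a Euclidean space is
  \<open>\<nabla>\<^sub>vY = D\<^sub>vY + \<Gamma>(v, Y)\<close>; the Christoffel form \<open>\<Gamma>\<close> is determined by the Koszul formula for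
  constant vector fields.\<close>

definition christoffel :: "('e::euclidean_space \<Rightarrow> 'e \<Rightarrow> 'e \<Rightarrow> real) \<Rightarrow> 'e \<Rightarrow> 'e \<Rightarrow> 'e \<Rightarrow> 'e" where
  "christoffel h x v w = (THE u. \<forall>z. 2 * h x u z =
     dir_deriv (\<lambda>y. h y w z) x v + dir_deriv (\<lambda>y. h y v z) x w - dir_deriv (\<lambda>y. h y v w) x z)"

text \<open>The last condition is \<open>(\<nabla>\<^sub>uJ) v = 0\<close>, evaluated on constant vector fields.\<close>

definition kaehler_manifold ::
    "('a, 'e::euclidean_space) chart set \<Rightarrow> ('a, 'e) metric \<Rightarrow> ('a, 'e) endo_field \<Rightarrow> bool" where
  "kaehler_manifold A g J \<longleftrightarrow>
     smooth_manifold A \<and> riemannian_metric A g \<and> almost_complex_structure A J \<and>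
     (\<forall>c\<in>A. \<forall>x\<in>chart_image c.
        (\<forall>v w. g c x (J c x v) (J c x w) = g c x v w) \<and>
        (\<forall>u v. dir_deriv (\<lambda>y. J c y v) x u + christoffel (g c) x u (J c x v)
                 - J c x (christoffel (g c) x u v) = 0))"


section \<open>Pluriharmonic maps\<close>

text \<open>The Hessian \<open>D d\<phi>\<close> in charts \<open>c\<close> of the source and \<open>d\<close> of the target, at the coordinate
  point \<open>x\<close>.\<close>

definition hessian ::
    "('a, 'e::euclidean_space) metric \<Rightarrow> ('b, 'f::euclidean_space) metric \<Rightarrow> ('a \<Rightarrow> 'b) \<Rightarrow>
     ('a, 'e) chart \<Rightarrow> ('b, 'f) chart \<Rightarrow> 'e \<Rightarrow> 'e \<Rightarrow> 'e \<Rightarrow> 'f" where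
  "hessian g h \<phi> c d x v w =
     (let \<Phi> = local_rep c d \<phi> in
        dir_deriv2 \<Phi> x v w - dir_deriv \<Phi> x (christoffel (g c) x v w)
        + christoffel (h d) (\<Phi> x) (dir_deriv \<Phi> x v) (dir_deriv \<Phi> x w))"

definition pluriharmonic ::
    "('a, 'e::euclidean_space) chart set \<Rightarrow> ('a, 'e) metric \<Rightarrow> ('a, 'e) endo_field \<Rightarrow>
     ('b, 'f::euclidean_space) chart set \<Rightarrow> ('b, 'f) metric \<Rightarrow> ('a \<Rightarrow> 'b) \<Rightarrow> bool" where
  "pluriharmonic A g J B h \<phi> \<longleftrightarrow> smooth_map A B \<phi> \<and>
     (\<forall>p\<in>points A. \<forall>c\<in>charts_at A p. \<forall>d\<in>charts_at B (\<phi> p).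
        \<forall>z\<in>T10 (J c (snd c p)). \<forall>w\<in>T01 (J c (snd c p)).
          cbilin (hessian g h \<phi> c d (snd c p)) z w = 0)"


section \<open>Isometric immersions into Euclidean space\<close>

definition isometric_immersion ::
    "('a, 'e::euclidean_space) chart set \<Rightarrow> ('a, 'e) metric \<Rightarrow> ('a \<Rightarrow> real^'n) \<Rightarrow> bool" where
  "isometric_immersion A g f \<longleftrightarrow>
     (\<forall>c\<in>A. smooth_on (chart_image c) (f \<circ> chart_inv c) \<and>
        (\<forall>x\<in>chart_image c. inj (dir_deriv (f \<circ> chart_inv c) x) \<and>
           (\<forall>v w. g c x v w = dir_deriv (f \<circ> chart_inv c) x v \<bullet> dir_deriv (f \<circ> chart_inv c) x w)))"

text \<open>In the following definitions \<open>x\<close> is a coordinate point of the chart \<open>c\<close>. The normal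
  component of the derivative of \<open>df(Y)\<close> along \<open>v\<close> depends only on the value of \<open>Y\<close> at \<open>x\<close>, so that
  the second fundamental form may be computed with a constant vector field \<open>Y = w\<close>.\<close>

definition normal_space :: "('a \<Rightarrow> real^'n) \<Rightarrow> ('a, 'e::euclidean_space) chart \<Rightarrow> 'e \<Rightarrow> (real^'n) set"
  where
  "normal_space f c x = orthogonal_comp (range (dir_deriv (f \<circ> chart_inv c) x))"

definition second_fund ::
    "('a \<Rightarrow> real^'n) \<Rightarrow> ('a, 'e::euclidean_space) chart \<Rightarrow> 'e \<Rightarrow> 'e \<Rightarrow> 'e \<Rightarrow> real^'n" where
  "second_fund f c x v w = orth_proj (normal_space f c x) (dir_deriv2 (f \<circ> chart_inv c) x v w)"

definition pluri_mean_curv ::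
    "('a, 'e::euclidean_space) endo_field \<Rightarrow> ('a \<Rightarrow> real^'n) \<Rightarrow> ('a, 'e) chart \<Rightarrow>
     'e \<Rightarrow> 'e \<Rightarrow> 'e \<Rightarrow> real^'n" where
  "pluri_mean_curv J f c x v w =
     (1/2) *\<^sub>R (second_fund f c x v w + second_fund f c x (J c x v) (J c x w))"

text \<open>The covariant derivative along \<open>u\<close>, with respect to the tangent and normal connections, of
  the pluri-mean curvature vanishes.\<close>

definition ppmc ::
    "('a, 'e::euclidean_space) chart set \<Rightarrow> ('a, 'e) metric \<Rightarrow> ('a, 'e) endo_field \<Rightarrow>
     ('a \<Rightarrow> real^'n) \<Rightarrow> bool" where
  "ppmc A g J f \<longleftrightarrow> (\<forall>c\<in>A. \<forall>x\<in>chart_image c. \<forall>u v w.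
     orth_proj (normal_space f c x) (dir_deriv (\<lambda>y. pluri_mean_curv J f c y v w) x u)
       - pluri_mean_curv J f c x (christoffel (g c) x u v) w
       - pluri_mean_curv J f c x v (christoffel (g c) x u w) = 0)"

definition N0 ::
    "('a, 'e::euclidean_space) endo_field \<Rightarrow> ('a \<Rightarrow> real^'n) \<Rightarrow> ('a, 'e) chart \<Rightarrow> 'e \<Rightarrow> (real^'n) set"
  where
  "N0 J f c x = span {pluri_mean_curv J f c x v w | v w. True}"

definition N1 ::
    "('a, 'e::euclidean_space) endo_field \<Rightarrow> ('a \<Rightarrow> real^'n) \<Rightarrow> ('a, 'e) chart \<Rightarrow> 'e \<Rightarrow> (real^'n) set"
  where
  "N1 J f c x = normal_space f c x \<inter> orthogonal_comp (N0 J f c x)"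

text \<open>The complexification of \<open>N\<^sup>1\<close> is \<open>N\<^sup>1 \<times> N\<^sup>1\<close>.\<close>

definition half_isotropic ::
    "('a, 'e::euclidean_space) chart set \<Rightarrow> ('a, 'e) endo_field \<Rightarrow> ('a \<Rightarrow> real^'n) \<Rightarrow> bool" where
  "half_isotropic A J f \<longleftrightarrow> (\<forall>c\<in>A. \<forall>x\<in>chart_image c. \<forall>z\<in>T10 (J c x). \<forall>w\<in>T10 (J c x).
     cbilin (second_fund f c x) z w \<in> N1 J f c x \<times> N1 J f c x)"

text \<open>The complex Gauss map; the right hand side does not depend on the chart at \<open>p\<close>.\<close>

definition complex_gauss_map ::
    "('a, 'e::euclidean_space) chart set \<Rightarrow> ('a, 'e) endo_field \<Rightarrow> ('a \<Rightarrow> real^'n) \<Rightarrow>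
     'a \<Rightarrow> (complex^'n) set" where
  "complex_gauss_map A J f p = (\<Union>c\<in>charts_at A p.
     (\<lambda>z. cvec (clin (dir_deriv (f \<circ> chart_inv c) (snd c p)) z)) ` T10 (J c (snd c p)))"


section \<open>The complex Grassmannian\<close>

definition grassmannian :: "nat \<Rightarrow> (complex^'n) set set" where
  "grassmannian m = {W. vec.subspace W \<and> vec.dim W = m}"

text \<open>The affine charts: if the columns of \<open>P\<close> and \<open>Q\<close> together form a basis of \<open>\<complex>\<^sup>n\<close>, then
  every \<open>m\<close>-dimensional subspace complementary to the column space of \<open>Q\<close> is the column space of
  \<open>P + Q X\<close> for a unique matrix \<open>X\<close> with \<open>n - m\<close> rows and \<open>m\<close> columns. Here \<open>m\<close> is the cardinality of
  \<open>'m\<close>, and \<open>n - m\<close> that of \<open>'k\<close>; the atlas is empty if the cardinalities do not add up.\<close>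

definition graph_space :: "complex^'m^'n \<Rightarrow> complex^'k^'n \<Rightarrow> complex^'m^'k \<Rightarrow> (complex^'n) set" where
  "graph_space P Q X = range (\<lambda>a. (P + Q ** X) *v a)"

definition grassmannian_chart ::
    "complex^'m^'n \<Rightarrow> complex^'k^'n \<Rightarrow> ((complex^'n) set, complex^'m^'k) chart" where
  "grassmannian_chart P Q =
     ({W \<in> grassmannian CARD('m). W \<inter> range (\<lambda>b. Q *v b) = {0}},
      (\<lambda>W. THE X. W = graph_space P Q X))"

definition grassmannian_atlas :: "((complex^'n) set, complex^'m^'k) chart set" where
  "grassmannian_atlas = {grassmannian_chart P Q | P Q. bij (\<lambda>(a, b). P *v a + Q *v b)}"

lemma graph_space_inj:
  fixes P :: "complex^'m^'n" and Q :: "complex^'k^'n"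
  assumes "bij (\<lambda>(a, b). P *v a + Q *v b)" and "graph_space P Q X = graph_space P Q Y"
  shows "X = Y"
proof -
  have "X *v a = Y *v a" for a
  proof -
    have "(P + Q ** X) *v a \<in> graph_space P Q Y"
      using assms(2) by (auto simp: graph_space_def)
    then obtain a' where "(P + Q ** X) *v a = (P + Q ** Y) *v a'" by (auto simp: graph_space_def)
    then have "(\<lambda>(a, b). P *v a + Q *v b) (a, X *v a) = (\<lambda>(a, b). P *v a + Q *v b) (a', Y *v a')"
      by (simp add: matrix_vector_mult_add_rdistrib matrix_vector_mul_assoc)
    then have "(a, X *v a) = (a', Y *v a')" using bij_is_inj[OF assms(1)] by (blast dest: injD)
    then have "a = a'" "X *v a = Y *v a'" by (blast dest: Pair_inject)+
    then show ?thesis by simp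
  qed
  then show ?thesis by (simp add: matrix_eq)
qed

lemma fst_grassmannian_chart:
  fixes P :: "complex^'m^'n" and Q :: "complex^'k^'n"
  assumes bij: "bij (\<lambda>(a, b). P *v a + Q *v b)"
  shows "fst (grassmannian_chart P Q) = range (graph_space P Q)"
proof -
  have inj: "P *v a + Q *v b = P *v a' + Q *v b' \<Longrightarrow> a = a' \<and> b = b'" for a b a' b'
    using bij_is_inj[OF bij] by (auto dest: injD[where x="(a,b)" and y="(a',b')"])
  have graph: "graph_space P Q X \<in> fst (grassmannian_chart P Q)" for X
  proof -
    let ?L = "\<lambda>a. (P + Q ** X) *v a"
    have e: "?L a = P *v a + Q *v (X *v a)" for a
      by (simp add: matrix_vector_mult_add_rdistrib matrix_vector_mul_assoc)
    have i: "inj ?L" using inj unfolding e by (auto intro!: injI)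
    have s: "vec.subspace (range ?L)"
      by (rule vec.subspace_image) simp
    have d: "vec.dim (range ?L) = CARD('m)"
      using vec.dim_image_eq[OF matrix_vector_mul_linear_gen, of "P + Q ** X" UNIV] i
      by (simp add: vec.dim_UNIV vec.dimension_def card_cart_basis)
    have z: "range ?L \<inter> range (\<lambda>b. Q *v b) = {0}"
    proof -
      have "w = 0" if w: "w = ?L a" "w = Q *v b" for w a b
        using inj[of a "X *v a" 0 b] w e[of a] by simp
      moreover have "0 \<in> range ?L" "0 \<in> range (\<lambda>b. Q *v b)"
        by (metis matrix_vector_mult_0_right rangeI)+
      ultimately show ?thesis by blast
    qed
    show ?thesis using s d z by (simp add: grassmannian_chart_def graph_space_def grassmannian_def)
  qed
  have conv: "\<exists>X. W = graph_space P Q X"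
    if W: "vec.subspace W" "vec.dim W = CARD('m)" "W \<inter> range (\<lambda>b. Q *v b) = {0}" for W
  proof -
    define p where "p w = fst (inv (\<lambda>(a, b). P *v a + Q *v b) w)" for w
    define q where "q w = snd (inv (\<lambda>(a, b). P *v a + Q *v b) w)" for w
    have pq: "P *v p w + Q *v q w = w" for w
      using surj_f_inv_f[OF bij_is_surj[OF bij], of w] by (simp add: p_def q_def split: prod.splits)
    have p: "p (P *v a + Q *v b) = a" and q: "q (P *v a + Q *v b) = b" for a b
      using inj pq by blast+
    have lp: "Vector_Spaces.linear (*s) (*s) p"
    proof (unfold_locales)
      fix b1 b2 :: "complex^'n" and r
      have "P *v (p b1 + p b2) + Q *v (q b1 + q b2) = b1 + b2"
        using pq[of b1] pq[of b2] by (metis (no_types) matrix_vector_right_distrib add.assoc add.left_commute)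
      then show "p (b1 + b2) = p b1 + p b2" by (metis p)
      have "P *v (r *s p b1) + Q *v (r *s q b1) = r *s b1"
        using pq[of b1] by (metis vec.scale vec.scale_right_distrib)
      then show "p (r *s b1) = r *s p b1" by (metis p)
    qed
    have lq: "Vector_Spaces.linear (*s) (*s) q"
    proof (unfold_locales)
      fix b1 b2 :: "complex^'n" and r
      have "P *v (p b1 + p b2) + Q *v (q b1 + q b2) = b1 + b2"
        using pq[of b1] pq[of b2] by (metis (no_types) matrix_vector_right_distrib add.assoc add.left_commute)
      then show "q (b1 + b2) = q b1 + q b2" by (metis q)
      have "P *v (r *s p b1) + Q *v (r *s q b1) = r *s b1"
        using pq[of b1] by (metis vec.scale vec.scale_right_distrib)
      then show "q (r *s b1) = r *s q b1" by (metis q)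
    qed
    interpret lp: Vector_Spaces.linear "(*s)" "(*s)" p by (rule lp)
    have ip: "inj_on p W"
    proof -
      have "w = 0" if "w \<in> W" "p w = 0" for w
      proof -
        have "w = Q *v q w" using pq[of w] that by simp
        then show ?thesis using W(3) that by blast
      qed
      then show ?thesis
        using lp.inj_on_iff_eq_0[OF W(1)] by blast
    qed
    have "vec.dim (p ` W) = CARD('m)"
      using vec.dim_image_eq[OF lp, of W] ip W by (simp add: vec.span_eq_iff[THEN iffD2])
    then have pW: "p ` W = UNIV"
      by (metis W(1) lp lp.subspace_image vec.dim_eq_full vec.span_eq_iff vec.dimension_def card_cart_basis)
    then have "bij_betw p W UNIV" using ip by (simp add: bij_betw_def)
    obtain s where s: "range s \<subseteq> W" "Vector_Spaces.linear (*s) (*s) s" "\<And>a. p (s a) = a"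
      using vec.linear_exists_right_inverse_on[OF lp W(1)] pW by blast
    define X where "X = matrix (q \<circ> s)"
    have lqs: "Vector_Spaces.linear (*s) (*s) (q \<circ> s)" using s(2) lq Vector_Spaces.linear_compose by blast
    have X: "X *v a = q (s a)" for a using matrix_works[OF lqs] by (simp add: X_def)
    have "(P + Q ** X) *v a = s a" for a
      using pq[of "s a"] s(3)[of a] by (simp add: matrix_vector_mult_add_rdistrib matrix_vector_mul_assoc[symmetric] X)
    moreover have "range s = W"
    proof
      show "W \<subseteq> range s"
      proof
        fix w assume w: "w \<in> W"
        have "s (p w) = w" using ip w s by (metis inj_onD range_subsetD)
        then show "w \<in> range s" by (metis rangeI)
      qed
    qed (rule s)
    ultimately show ?thesis by (intro exI[of _ X]) (simp add: graph_space_def)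
  qed
  show ?thesis
  proof
    show "range (graph_space P Q) \<subseteq> fst (grassmannian_chart P Q)" using graph by blast
    show "fst (grassmannian_chart P Q) \<subseteq> range (graph_space P Q)"
    proof
      fix W assume "W \<in> fst (grassmannian_chart P Q)"
      then have "\<exists>X. W = graph_space P Q X"
        by (intro conv) (simp_all add: grassmannian_chart_def grassmannian_def)
      then show "W \<in> range (graph_space P Q)" by blast
    qed
  qed
qed

lemma points_grassmannian_atlas:
  assumes card: "CARD('m) + CARD('k) = CARD('n)"
  shows "points (grassmannian_atlas :: ((complex^'n) set, complex^'m^'k) chart set)
    = grassmannian CARD('m)"
proof
  show "points (grassmannian_atlas :: ((complex^'n) set, complex^'m^'k) chart set)
    \<subseteq> grassmannian CARD('m)"
    by (auto simp: points_def grassmannian_atlas_def grassmannian_chart_def)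
  show "grassmannian CARD('m) \<subseteq> points (grassmannian_atlas :: ((complex^'n) set, complex^'m^'k) chart set)"
  proof
    fix W :: "(complex^'n) set" assume "W \<in> grassmannian CARD('m)"
    then have W: "vec.subspace W" "vec.dim W = CARD('m)" by (auto simp: grassmannian_def)
    obtain B where B: "B \<subseteq> W" "vec.independent B" "W \<subseteq> vec.span B" "card B = CARD('m)"
      using vec.basis_exists[of W] W by metis
    define C where "C = vec.extend_basis B"
    have C: "vec.independent C" "vec.span C = UNIV" "B \<subseteq> C"
      unfolding C_def using vec.independent_extend_basis vec.span_extend_basis vec.extend_basis_superset[OF B(2)] B(2) by auto
    have fC: "finite C" using C(1) vec.finiteI_independent by blast
    have "card C = CARD('n)"
      by (metis C(1,2) vec.dim_span vec.dim_eq_card_independent vec_dim_card)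
    then have cD: "card (C - B) = CARD('k)" using card B(4) C(3) fC by (simp add: card_Diff_subset finite_subset)
    obtain e where e: "bij_betw e (UNIV::'m set) B"
      using finite_same_card_bij[of "UNIV::'m set" B] B(4) C(3) fC finite_subset by auto
    obtain h where h: "bij_betw h (UNIV::'k set) (C - B)"
      using finite_same_card_bij[of "UNIV::'k set" "C - B"] cD fC by auto
    define P where "P = (\<chi> i j. e j $ i)"
    define Q where "Q = (\<chi> i j. h j $ i)"
    have P: "P *v a = (\<Sum>j\<in>UNIV. a $ j *s e j)" for a
      by (simp add: P_def matrix_vector_mult_def vec_eq_iff mult.commute)
    have Q: "Q *v a = (\<Sum>j\<in>UNIV. a $ j *s h j)" for a
      by (simp add: Q_def matrix_vector_mult_def vec_eq_iff mult.commute)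
    have P': "P *v a = (\<Sum>b\<in>B. a $ (inv e b) *s b)" for a
      unfolding P using sum.reindex_bij_betw[OF e, of "\<lambda>b. a $ (inv e b) *s b"]
        inv_f_f[of e] e by (simp add: bij_betw_def)
    have Q': "Q *v a = (\<Sum>b\<in>C - B. a $ (inv h b) *s b)" for a
      unfolding Q using sum.reindex_bij_betw[OF h, of "\<lambda>b. a $ (inv h b) *s b"]
        inv_f_f[of h] h by (simp add: bij_betw_def)
    have PQ: "P *v a + Q *v b = (\<Sum>v\<in>C. (if v \<in> B then a $ inv e v else b $ inv h v) *s v)" for a b
    proof -
      have "(\<Sum>v\<in>C. (if v \<in> B then a $ inv e v else b $ inv h v) *s v) =
         (\<Sum>v\<in>C - B. (if v \<in> B then a $ inv e v else b $ inv h v) *s v) +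
         (\<Sum>v\<in>B. (if v \<in> B then a $ inv e v else b $ inv h v) *s v)"
        by (rule sum.subset_diff[OF C(3) fC])
      then show ?thesis unfolding P' Q' by (simp add: add.commute)
    qed
    have "inj (\<lambda>(a, b). P *v a + Q *v b)"
    proof (rule injI, clarify)
      fix a b a' b' assume eq: "P *v a + Q *v b = P *v a' + Q *v b'"
      have s0: "(\<Sum>v\<in>C. ((if v \<in> B then a $ inv e v else b $ inv h v)
           - (if v \<in> B then a' $ inv e v else b' $ inv h v)) *s v) = 0"
        using eq unfolding PQ by (simp add: vec.scale_left_diff_distrib sum_subtractf)
      then have z: "(if v \<in> B then a $ inv e v else b $ inv h v)
           - (if v \<in> B then a' $ inv e v else b' $ inv h v) = 0" if "v \<in> C" for v
        using vec.independentD[OF C(1) fC subset_refl s0 that] by simp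
      have "a $ j = a' $ j" for j
      proof -
        have "e j \<in> B" "inv e (e j) = j" using e by (auto simp: bij_betw_def)
        then show ?thesis using z[of "e j"] C(3) by auto
      qed
      moreover have "b $ j = b' $ j" for j
      proof -
        have "h j \<in> C - B" "inv h (h j) = j" using h by (auto simp: bij_betw_def)
        then show ?thesis using z[of "h j"] by auto
      qed
      ultimately show "a = a' \<and> b = b'" by (simp add: vec_eq_iff)
    qed
    moreover have "surj (\<lambda>(a, b). P *v a + Q *v b)"
    proof (rule surjI)
      fix y :: "complex^'n"
      define r where "r = (SOME u. y = (\<Sum>v\<in>C. u v *s v))"
      have "y \<in> vec.span C" using C by simp
      then have "\<exists>u. y = (\<Sum>v\<in>C. u v *s v)" using vec.span_finite[OF fC] by auto
      then have r: "y = (\<Sum>v\<in>C. r v *s v)" unfolding r_def by (rule someI_ex)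
      have 1: "e (inv e v) = v" if "v \<in> B" for v using that e by (auto simp: bij_betw_def f_inv_into_f)
      have 2: "h (inv h v) = v" if "v \<in> C - B" for v
      proof - have "v \<in> range h" using that h by (simp add: bij_betw_def)
        then show ?thesis by (rule f_inv_into_f) qed
      have "P *v (\<chi> j. r (e j)) + Q *v (\<chi> j. r (h j)) = y"
        unfolding PQ r using 1 2 by (intro sum.cong) (auto)
      then show "(\<lambda>(a, b). P *v a + Q *v b) ((\<lambda>y. ((\<chi> j. (SOME u. y = (\<Sum>v\<in>C. u v *s v)) (e j)), (\<chi> j. (SOME u. y = (\<Sum>v\<in>C. u v *s v)) (h j)))) y) = y"
        by (simp add: r_def)
    qed
    ultimately have bij: "bij (\<lambda>(a, b). P *v a + Q *v b)" by (simp add: bij_def)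
    have WB: "W = range (\<lambda>a. P *v a)"
    proof
      show "range (\<lambda>a. P *v a) \<subseteq> W"
        unfolding P using W(1) B(1) e by (auto simp: bij_betw_def intro!: vec.subspace_sum vec.subspace_scale)
      show "W \<subseteq> range (\<lambda>a. P *v a)"
      proof
        fix w assume "w \<in> W"
        then have "w \<in> vec.span B" using B by auto
        then obtain u where u: "w = (\<Sum>v\<in>B. u v *s v)" using vec.span_finite[of B] C(3) fC finite_subset by auto
        have "w = P *v (\<chi> j. u (e j))"
          unfolding u P using sum.reindex_bij_betw[OF e, of "\<lambda>b. u b *s b"] by simp
        then show "w \<in> range (\<lambda>a. P *v a)" by blast
      qed
    qed
    have "W = graph_space P Q 0" unfolding WB graph_space_def by simp
    then have "W \<in> fst (grassmannian_chart P Q)" using fst_grassmannian_chart[OF bij] by blast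
    then show "W \<in> points (grassmannian_atlas :: ((complex^'n) set, complex^'m^'k) chart set)"
      using bij unfolding points_def grassmannian_atlas_def by blast
  qed
qed

text \<open>The standard metric: under the identification of the tangent space at \<open>W\<close> with
  \<open>Hom(W, W\<^sup>\<bottom>)\<close> it is \<open>\<langle>S, T\<rangle> = Re tr(S\<^sup>* T)\<close>. The derivative of \<open>W \<mapsto> (\<close>orthogonal projection
  onto \<open>W)\<close> in direction \<open>S\<close> is the Hermitian matrix \<open>S + S\<^sup>*\<close>, so that this metric is half of the one
  induced by that map from the inner product \<open>Re tr(X\<^sup>* Y)\<close> on matrices, which is the inner product
  of the type of complex matrices. The real and the Hermitian orthogonal projection onto a complex
  subspace agree.\<close>

definition proj_matrix :: "(complex^'n) set \<Rightarrow> complex^'n^'n" where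
  "proj_matrix W = matrix (orth_proj W)"

definition grassmannian_metric :: "((complex^'n) set, complex^'m^'k) metric" where
  "grassmannian_metric c x v w =
     (1/2) * (dir_deriv (proj_matrix \<circ> chart_inv c) x v \<bullet> dir_deriv (proj_matrix \<circ> chart_inv c) x w)"

end

theory Submission
  imports Defs
begin

text \<open>
  Send a subspace to the orthogonal projection onto it. This embeds the Grassmannian into the
  Hermitian matrices, and its metric is half of the induced one. So the Hessian of the complex Gauss
  map \<open>\<tau>'\<close> is the tangential part of the Hessian of \<open>\<Psi>\<close>, the projection matrix onto \<open>\<tau>'\<close> as a function on
  \<open>M\<close>; and a Hermitian matrix is normal to the Grassmannian at a subspace exactly when it maps this
  subspace into itself (\<open>normal_to_grassmannian\<close>). Hence \<open>\<tau>'\<close> is pluriharmonic if and only if the \<open>(1,1)\<close>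
  part of \<open>Hess \<Psi>\<close> maps \<open>\<tau>'\<close> into itself (\<open>hessian_iff\<close>).

  The space \<open>\<tau>'\<close> is parametrised by \<open>L(c) = df(c) - \<i> df(J c)\<close>. Because \<open>J\<close> is parallel, the covariant
  derivative of \<open>L\<close> is the normal vector \<open>\<beta>(v, c) = \<alpha>(v, c) - \<i> \<alpha>(v, J c)\<close>. Differentiating \<open>\<Psi> L = L\<close> once
  gives \<open>d\<Psi>(v) L(c) = \<beta>(v, c)\<close>, and a second time, modulo \<open>\<tau>'\<close>,
  \<open>Hess \<Psi>(u, v) L(c) = D\<alpha>(u, v, c) - \<i> D\<alpha>(u, v, J c)\<close> (\<open>Hess\<Psi>_L\<close>). Here \<open>D\<alpha>\<close> is the derivative of the
  second fundamental form with values in \<open>\<real>\<^sup>n\<close>, so it has a normal and a tangential part. Its \<open>(1,1)\<close>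
  part \<open>\<kappa>\<close> in \<open>u\<close> and \<open>v\<close> therefore decides: \<open>\<kappa>(u, v, c) - \<i> \<kappa>(u, v, J c)\<close> has to lie in \<open>\<tau>'\<close>
  (\<open>hessian_mem_criterion\<close>). The complement of \<open>\<tau>'\<close> in \<open>\<complex>\<^sup>n\<close> is the sum of the complexified normal space and
  \<open>df(T'')\<close>, which splits the condition in two (\<open>tangent_normal_criterion\<close>).

  The normal part of \<open>\<kappa>\<close> has to vanish. By the Codazzi equation the derivative may be taken in the
  direction \<open>c\<close> instead of \<open>u\<close>, and the condition says that \<open>\<alpha>\<^sup>(\<^sup>1\<^sup>,\<^sup>1\<^sup>)\<close> is parallel.

  The component in \<open>df(T'')\<close> has to vanish. The tangential part of \<open>D\<alpha>\<close> is quadratic in \<open>\<alpha>\<close>, and the condition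
  becomes \<open>\<langle>\<alpha>(v', c'), \<alpha>(u'', e')\<rangle> + \<langle>\<alpha>(v'', c'), \<alpha>(u', e')\<rangle> = 0\<close> for the components of \<open>v, c, u, e\<close> in \<open>T'\<close> and \<open>T''\<close>.
  Replacing \<open>v\<close> by \<open>J v\<close> changes the relative sign, so each summand vanishes, which says that \<open>\<alpha>(T', T')\<close> is
  orthogonal to the values of \<open>\<alpha>\<^sup>(\<^sup>1\<^sup>,\<^sup>1\<^sup>)\<close> (\<open>isotropy_algebra\<close>).

  Pluriharmonicity also demands that \<open>\<tau>'\<close> be smooth. The coordinates of \<open>\<tau>'\<close> in a chart of the Grassmannian,
  like all the other auxiliary functions, solve linear systems with smooth coefficients, and such
  solutions are smooth (\<open>smooth_on_linear_solution\<close>).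
\<close>

section \<open>Calculus of directional derivatives\<close>

lemma has_derivative_dir_deriv:
  assumes "F differentiable (at x)"
  shows "(F has_derivative dir_deriv F x) (at x)"
  using assms frechet_derivative_works unfolding dir_deriv_def by auto

lemma dir_deriv_eqI:
  assumes "(F has_derivative F') (at x)"
  shows "dir_deriv F x = F'"
  using frechet_derivative_at[OF assms] unfolding dir_deriv_def by auto

text \<open>Derivatives are local, including where no derivative exists: the two functions have the same
  set of derivatives at the point, so the choice operator picks the same one.\<close>
lemma dir_deriv_cong:
  assumes "open S" "x \<in> S" "\<And>y. y \<in> S \<Longrightarrow> F y = G y"
  shows "dir_deriv F x = dir_deriv G x"
proof -
  have "(F has_derivative D) (at x) \<longleftrightarrow> (G has_derivative D) (at x)" for D
    using has_derivative_transform_within_open[of F D x UNIV S G]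
      has_derivative_transform_within_open[of G D x UNIV S F] assms by auto
  then have "(\<lambda>D. (F has_derivative D) (at x)) = (\<lambda>D. (G has_derivative D) (at x))" by blast
  then show ?thesis unfolding dir_deriv_def frechet_derivative_def by simp
qed

lemma differentiable_cong_open:
  assumes "open S" "x \<in> S" "\<And>y. y \<in> S \<Longrightarrow> F y = G y" "F differentiable (at x)"
  shows "G differentiable (at x)"
  using assms has_derivative_transform_within_open[of F _ x UNIV S G] unfolding differentiable_def by blast

lemma linear_dir_deriv: "F differentiable (at x) \<Longrightarrow> linear (dir_deriv F x)"
  using has_derivative_dir_deriv has_derivative_linear by blast

lemma dir_deriv_chain:
  assumes "F differentiable (at x)" "G differentiable (at (F x))"
  shows "dir_deriv (\<lambda>y. G (F y)) x v = dir_deriv G (F x) (dir_deriv F x v)"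
  using has_derivative_compose[OF assms[THEN has_derivative_dir_deriv]] dir_deriv_eqI by metis

lemma dir_deriv_bilinear:
  assumes "bounded_bilinear p" "F differentiable (at x)" "G differentiable (at x)"
  shows "dir_deriv (\<lambda>y. p (F y) (G y)) x v = p (F x) (dir_deriv G x v) + p (dir_deriv F x v) (G x)"
  using bounded_bilinear.FDERIV[OF assms(1) assms(2,3)[THEN has_derivative_dir_deriv]] dir_deriv_eqI
  by metis

lemma dir_deriv_bounded_linear:
  assumes "bounded_linear p" "F differentiable (at x)"
  shows "dir_deriv (\<lambda>y. p (F y)) x v = p (dir_deriv F x v)"
  using bounded_linear.has_derivative[OF assms(1) assms(2)[THEN has_derivative_dir_deriv]] dir_deriv_eqI
  by metis

lemma dir_deriv_add:
  assumes "F differentiable (at x)" "G differentiable (at x)"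
  shows "dir_deriv (\<lambda>y. F y + G y) x v = dir_deriv F x v + dir_deriv G x v"
  using has_derivative_add[OF assms[THEN has_derivative_dir_deriv]] dir_deriv_eqI by metis

lemma dir_deriv_diff:
  assumes "F differentiable (at x)" "G differentiable (at x)"
  shows "dir_deriv (\<lambda>y. F y - G y) x v = dir_deriv F x v - dir_deriv G x v"
  using has_derivative_diff[OF assms[THEN has_derivative_dir_deriv]] dir_deriv_eqI by metis

lemma dir_deriv_const: "dir_deriv (\<lambda>y. c) x = (\<lambda>v. 0)"
  by (intro dir_deriv_eqI) simp

lemma Ck_on_cong:
  assumes "open S" "\<And>y. y \<in> S \<Longrightarrow> F y = G y" "Ck_on k S F"
  shows "Ck_on k S G"
  using assms(2,3)
proof (induction k arbitrary: F G)
  case 0 then show ?case by (simp cong: continuous_on_cong)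
next
  case (Suc k)
  have "G differentiable (at x)" if "x \<in> S" for x
    using differentiable_cong_open[OF assms(1) that, of F G] Suc that by auto
  moreover have "Ck_on k S (\<lambda>x. dir_deriv G x v)" for v
    using Suc.IH[of "\<lambda>x. dir_deriv F x v"] dir_deriv_cong[OF assms(1), of _ F G] Suc.prems by auto
  ultimately show ?case by simp
qed

lemma Ck_on_subset: "Ck_on k S F \<Longrightarrow> T \<subseteq> S \<Longrightarrow> Ck_on k T F"
  by (induction k arbitrary: F) (auto intro: continuous_on_subset)

lemma Ck_on_SucD: "Ck_on (Suc k) S F \<Longrightarrow> Ck_on k S F"
proof (induction k arbitrary: F)
  case 0
  then show ?case
    by (auto intro!: differentiable_imp_continuous_on differentiable_at_imp_differentiable_on)
qed simp

lemma Ck_on_const: "Ck_on k S (\<lambda>x. c)"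
  by (induction k arbitrary: c) (auto simp: dir_deriv_const)

lemma Ck_on_bounded_linear:
  assumes "open S" "bounded_linear p" "Ck_on k S F"
  shows "Ck_on k S (\<lambda>x. p (F x))"
  using assms(3)
proof (induction k arbitrary: F)
  case 0 then show ?case using bounded_linear.continuous_on[OF assms(2)] by simp
next
  case (Suc k)
  have "(\<lambda>x. p (F x)) differentiable (at x)" if "x \<in> S" for x
    using bounded_linear.has_derivative[OF assms(2) has_derivative_dir_deriv] Suc.prems that
    unfolding differentiable_def by (metis Ck_on.simps(2) differentiable_def)
  moreover have "Ck_on k S (\<lambda>x. dir_deriv (\<lambda>x. p (F x)) x v)" for v
  proof (rule Ck_on_cong[OF assms(1)])
    show "Ck_on k S (\<lambda>x. p (dir_deriv F x v))" using Suc by simp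
    show "p (dir_deriv F y v) = dir_deriv (\<lambda>x. p (F x)) y v" if "y \<in> S" for y
      using Suc.prems that by (subst dir_deriv_bounded_linear[OF assms(2)]) auto
  qed
  ultimately show ?case by simp
qed

lemma Ck_on_add:
  assumes "open S" "Ck_on k S F" "Ck_on k S G"
  shows "Ck_on k S (\<lambda>x. F x + G x)"
  using assms(2,3)
proof (induction k arbitrary: F G)
  case 0 then show ?case by (simp add: continuous_on_add)
next
  case (Suc k)
  have "(\<lambda>x. F x + G x) differentiable (at x)" if "x \<in> S" for x
    using Suc.prems that by simp
  moreover have "Ck_on k S (\<lambda>x. dir_deriv (\<lambda>x. F x + G x) x v)" for v
  proof (rule Ck_on_cong[OF assms(1)])
    show "Ck_on k S (\<lambda>x. dir_deriv F x v + dir_deriv G x v)" using Suc by simp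
    show "dir_deriv F y v + dir_deriv G y v = dir_deriv (\<lambda>x. F x + G x) y v" if "y \<in> S" for y
      using Suc.prems that by (subst dir_deriv_add) auto
  qed
  ultimately show ?case by simp
qed

lemma Ck_on_bilinear:
  assumes "open S" "bounded_bilinear p" "Ck_on k S F" "Ck_on k S G"
  shows "Ck_on k S (\<lambda>x. p (F x) (G x))"
  using assms(3,4)
proof (induction k arbitrary: F G)
  case 0 then show ?case using bounded_bilinear.continuous_on[OF assms(2)] by simp
next
  case (Suc k)
  have d: "F differentiable (at x)" "G differentiable (at x)" if "x \<in> S" for x
    using Suc.prems that by auto
  have "(\<lambda>x. p (F x) (G x)) differentiable (at x)" if "x \<in> S" for x
    using bounded_bilinear.FDERIV[OF assms(2)] d[OF that] unfolding differentiable_def by blast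
  moreover have "Ck_on k S (\<lambda>x. dir_deriv (\<lambda>x. p (F x) (G x)) x v)" for v
  proof (rule Ck_on_cong[OF assms(1)])
    show "Ck_on k S (\<lambda>x. p (F x) (dir_deriv G x v) + p (dir_deriv F x v) (G x))"
      using Suc Suc.prems[THEN Ck_on_SucD] by (intro Ck_on_add assms(1)) auto
    show "p (F y) (dir_deriv G y v) + p (dir_deriv F y v) (G y) = dir_deriv (\<lambda>x. p (F x) (G x)) y v"
      if "y \<in> S" for y
      using d that by (subst dir_deriv_bilinear[OF assms(2)]) auto
  qed
  ultimately show ?case by simp
qed

lemma Ck_on_sum:
  assumes "open S" "\<And>i. i \<in> I \<Longrightarrow> Ck_on k S (F i)"
  shows "Ck_on k S (\<lambda>x. \<Sum>i\<in>I. F i x)"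
  using assms(2) by (induction I rule: infinite_finite_induct) (auto intro: Ck_on_const Ck_on_add assms(1))

lemma smooth_on_cong:
  assumes "open S" "\<And>y. y \<in> S \<Longrightarrow> F y = G y" "smooth_on S F"
  shows "smooth_on S G"
  using assms Ck_on_cong unfolding smooth_on_def by blast

lemma smooth_on_subset: "smooth_on S F \<Longrightarrow> T \<subseteq> S \<Longrightarrow> smooth_on T F"
  using Ck_on_subset unfolding smooth_on_def by blast

lemma smooth_on_const: "smooth_on S (\<lambda>x. c)"
  by (simp add: smooth_on_def Ck_on_const)

lemma smooth_on_bounded_linear:
  "open S \<Longrightarrow> bounded_linear p \<Longrightarrow> smooth_on S F \<Longrightarrow> smooth_on S (\<lambda>x. p (F x))"
  by (simp add: smooth_on_def Ck_on_bounded_linear)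

lemma smooth_on_bilinear:
  "open S \<Longrightarrow> bounded_bilinear p \<Longrightarrow> smooth_on S F \<Longrightarrow> smooth_on S G \<Longrightarrow> smooth_on S (\<lambda>x. p (F x) (G x))"
  by (simp add: smooth_on_def Ck_on_bilinear)

lemma smooth_on_add:
  "open S \<Longrightarrow> smooth_on S F \<Longrightarrow> smooth_on S G \<Longrightarrow> smooth_on S (\<lambda>x. F x + G x)"
  by (simp add: smooth_on_def Ck_on_add)

lemma smooth_on_minus: "open S \<Longrightarrow> smooth_on S F \<Longrightarrow> smooth_on S (\<lambda>x. - F x)"
  by (rule smooth_on_bounded_linear[OF _ bounded_linear_minus[OF bounded_linear_ident]])

lemma smooth_on_diff:
  "open S \<Longrightarrow> smooth_on S F \<Longrightarrow> smooth_on S G \<Longrightarrow> smooth_on S (\<lambda>x. F x - G x)"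
  using smooth_on_add[of S F "\<lambda>x. - G x"] smooth_on_minus by auto

lemma smooth_on_sum:
  "open S \<Longrightarrow> (\<And>i. i \<in> I \<Longrightarrow> smooth_on S (F i)) \<Longrightarrow> smooth_on S (\<lambda>x. \<Sum>i\<in>I. F i x)"
  by (simp add: smooth_on_def Ck_on_sum)

lemma smooth_on_differentiable: "smooth_on S F \<Longrightarrow> x \<in> S \<Longrightarrow> F differentiable (at x)"
  unfolding smooth_on_def by (metis Ck_on.simps(2))

lemma smooth_on_continuous: "smooth_on S F \<Longrightarrow> continuous_on S F"
  unfolding smooth_on_def by (metis Ck_on.simps(1))

lemma smooth_on_dir_deriv: "smooth_on S F \<Longrightarrow> smooth_on S (\<lambda>x. dir_deriv F x v)"
  unfolding smooth_on_def by (metis Ck_on.simps(2))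

lemma smooth_on_linear: "bounded_linear L \<Longrightarrow> smooth_on UNIV L" for L :: "'x::real_normed_vector \<Rightarrow> 'y::real_normed_vector"
proof -
  assume L: "bounded_linear L"
  have "dir_deriv L x = L" for x by (rule dir_deriv_eqI[OF bounded_linear_imp_has_derivative[OF L]])
  then have "Ck_on k UNIV L" for k
    using Ck_on_const bounded_linear_imp_differentiable[OF L] bounded_linear.continuous_on[OF L continuous_on_id]
    by (cases k) auto
  then show ?thesis by (simp add: smooth_on_def)
qed

lemma linear_basis_expansion:
  fixes L :: "'e::euclidean_space \<Rightarrow> 'b::real_vector"
  assumes "linear L"
  shows "L b = (\<Sum>i\<in>Basis. (b \<bullet> i) *\<^sub>R L i)"
proof -
  have "L b = L (\<Sum>i\<in>Basis. (b \<bullet> i) *\<^sub>R i)" by (simp only: euclidean_representation)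
  then show ?thesis by (simp add: linear_sum[OF assms] linear_scale[OF assms])
qed

lemma Ck_on_apply:
  fixes a :: "'a::real_normed_vector \<Rightarrow> 'e::euclidean_space"
  assumes "open S" "\<And>x. x \<in> S \<Longrightarrow> linear (M x)" "\<And>v. Ck_on k S (\<lambda>x. M x v)" "Ck_on k S a"
  shows "Ck_on k S (\<lambda>x. M x (a x))"
proof (rule Ck_on_cong[OF assms(1)])
  show "Ck_on k S (\<lambda>x. \<Sum>i\<in>Basis. (a x \<bullet> i) *\<^sub>R M x i)"
    by (intro Ck_on_sum Ck_on_bilinear[OF _ bounded_bilinear_scaleR] Ck_on_bilinear[OF _ bounded_bilinear_inner]
        Ck_on_const assms)
  show "(\<Sum>i\<in>Basis. (a y \<bullet> i) *\<^sub>R M y i) = M y (a y)" if "y \<in> S" for y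
    using linear_basis_expansion[OF assms(2)[OF that]] by metis
qed

lemma smooth_on_apply:
  fixes a :: "'a::real_normed_vector \<Rightarrow> 'e::euclidean_space"
  assumes "open S" "\<And>x. x \<in> S \<Longrightarrow> linear (M x)" "\<And>v. smooth_on S (\<lambda>x. M x v)" "smooth_on S a"
  shows "smooth_on S (\<lambda>x. M x (a x))"
  using assms Ck_on_apply unfolding smooth_on_def by blast

text \<open>The product rule for a family of linear maps applied to a moving vector. In coordinates of the
  vector it is a finite sum of products, so no norm on the space of linear maps is involved.\<close>
lemma dir_deriv_apply:
  fixes a :: "'a::real_normed_vector \<Rightarrow> 'e::euclidean_space"
  assumes "open S" "x \<in> S" "\<And>x. x \<in> S \<Longrightarrow> linear (M x)"
    and M: "\<And>v x. x \<in> S \<Longrightarrow> (\<lambda>x. M x v) differentiable (at x)" and a: "a differentiable (at x)"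
  shows "((\<lambda>y. M y (a y)) has_derivative (\<lambda>u. dir_deriv (\<lambda>y. M y (a x)) x u + M x (dir_deriv a x u))) (at x)"
    "dir_deriv (\<lambda>y. M y (a y)) x u = dir_deriv (\<lambda>y. M y (a x)) x u + M x (dir_deriv a x u)"
proof -
  have rep: "M y b = (\<Sum>i\<in>Basis. (b \<bullet> i) *\<^sub>R M y i)" if "y \<in> S" for y b
    using linear_basis_expansion[OF assms(3)[OF that]] .
  have dM: "((\<lambda>x. M x i) has_derivative dir_deriv (\<lambda>x. M x i) x) (at x)" for i
    using M[OF assms(2)] has_derivative_dir_deriv by blast
  have da: "(a has_derivative dir_deriv a x) (at x)" using a has_derivative_dir_deriv by blast
  have c: "((\<lambda>y. M y b) has_derivative (\<lambda>u. \<Sum>i\<in>Basis. (b \<bullet> i) *\<^sub>R dir_deriv (\<lambda>x. M x i) x u)) (at x)" for b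
    by (rule has_derivative_transform_within_open[OF _ assms(1,2) rep[symmetric]])
      (auto intro!: derivative_eq_intros dM)
  have "((\<lambda>y. M y (a y)) has_derivative
     (\<lambda>u. \<Sum>i\<in>Basis. (a x \<bullet> i) *\<^sub>R dir_deriv (\<lambda>x. M x i) x u + (dir_deriv a x u \<bullet> i) *\<^sub>R M x i)) (at x)"
    by (rule has_derivative_transform_within_open[OF _ assms(1,2) rep[symmetric]])
      (auto intro!: derivative_eq_intros dM da)
  also have "(\<lambda>u. \<Sum>i\<in>Basis. (a x \<bullet> i) *\<^sub>R dir_deriv (\<lambda>x. M x i) x u + (dir_deriv a x u \<bullet> i) *\<^sub>R M x i)
    = (\<lambda>u. dir_deriv (\<lambda>y. M y (a x)) x u + M x (dir_deriv a x u))"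
    unfolding dir_deriv_eqI[OF c[of "a x"]] by (simp add: sum.distrib rep[OF assms(2), symmetric])
  finally show *: "((\<lambda>y. M y (a y)) has_derivative
      (\<lambda>u. dir_deriv (\<lambda>y. M y (a x)) x u + M x (dir_deriv a x u))) (at x)" .
  show "dir_deriv (\<lambda>y. M y (a y)) x u = dir_deriv (\<lambda>y. M y (a x)) x u + M x (dir_deriv a x u)"
    using dir_deriv_eqI[OF *] by simp
qed

section \<open>Smooth dependence of solutions of linear systems\<close>

text \<open>The map \<open>(x, v) \<mapsto> (x, M(x) v)\<close> is differentiable with invertible derivative, so the inverse
  function theorem makes its inverse \<open>(x, w) \<mapsto> (x, M(x)\<^sup>-\<^sup>1 w)\<close> differentiable, and \<open>a\<close> is a component
  of that inverse along the graph of \<open>l\<close>.\<close>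
lemma differentiable_linear_solution:
  fixes M :: "'a::euclidean_space \<Rightarrow> 'e::euclidean_space \<Rightarrow> 'e"
  assumes S: "open S" and lin: "\<And>x. x \<in> S \<Longrightarrow> linear (M x)" and inj: "\<And>x. x \<in> S \<Longrightarrow> inj (M x)"
    and M: "\<And>v x. x \<in> S \<Longrightarrow> (\<lambda>x. M x v) differentiable (at x)"
    and l: "\<And>x. x \<in> S \<Longrightarrow> l differentiable (at x)"
    and a: "\<And>x. x \<in> S \<Longrightarrow> M x (a x) = l x" and x: "x \<in> S"
  shows "a differentiable (at x)"
proof -
  define g where "g = (\<lambda>p. (fst p, inv (M (fst p)) (snd p)))"
  define f where "f = (\<lambda>p. (fst p, M (fst p) (snd p)))"
  define S' :: "('a \<times> 'e) set" where "S' = S \<times> UNIV"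
  have S': "open S'" unfolding S'_def using S by (simp add: open_Times)
  have df: "(f has_derivative (\<lambda>h. (fst h, dir_deriv (\<lambda>y. M y (snd p)) (fst p) (fst h) + M (fst p) (snd h)))) (at p)"
    if p: "p \<in> S'" for p
  proof -
    have pS: "fst p \<in> S" using p by (auto simp: S'_def)
    have lin': "linear (M (fst q))" if "q \<in> S'" for q using that lin by (auto simp: S'_def)
    have d1: "((\<lambda>q. M (fst q) v) has_derivative (\<lambda>h. dir_deriv (\<lambda>y. M y v) (fst q) (fst h))) (at q)"
      if "q \<in> S'" for v q
    proof -
      have "fst q \<in> S" using that by (auto simp: S'_def)
      from has_derivative_compose[OF bounded_linear_imp_has_derivative[OF bounded_linear_fst]
          has_derivative_dir_deriv[OF M[OF this, of v]]]
      show ?thesis .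
    qed
    have dd: "(\<lambda>q. M (fst q) v) differentiable (at q)" if "q \<in> S'" for v q
      by (rule differentiableI[OF d1[OF that]])
    have "((\<lambda>q. M (fst q) (snd q)) has_derivative
       (\<lambda>h. dir_deriv (\<lambda>q. M (fst q) (snd p)) p h + M (fst p) (dir_deriv snd p h))) (at p)"
      using S' p lin' dd bounded_linear_imp_differentiable[OF bounded_linear_snd]
      by (rule dir_deriv_apply(1)[of S' p "\<lambda>q. M (fst q)" snd])
    moreover have "dir_deriv snd p = (snd :: 'a \<times> 'e \<Rightarrow> 'e)"
      by (rule dir_deriv_eqI) (rule bounded_linear_imp_has_derivative[OF bounded_linear_snd])
    ultimately have "((\<lambda>q. M (fst q) (snd q)) has_derivative
       (\<lambda>h. dir_deriv (\<lambda>y. M y (snd p)) (fst p) (fst h) + M (fst p) (snd h))) (at p)"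
      unfolding dir_deriv_eqI[OF d1[OF p]] by simp
    from has_derivative_Pair[OF has_derivative_fst[OF has_derivative_ident] this]
    show ?thesis unfolding f_def by simp
  qed
  have invM: "inv (M y) (M y v) = v" if "y \<in> S" for y v using inj[OF that] by simp
  have surj: "surj (M y)" if "y \<in> S" for y
    by (rule linear_injective_imp_surjective[OF lin[OF that] inj[OF that]]) simp
  define p where "p = (x, a x)"
  have p: "p \<in> S'" using x by (simp add: p_def S'_def)
  \<comment> \<open>the inverse of the derivative \<open>(h, k) \<mapsto> (h, D\<^sub>hM(a) + M(k))\<close>\<close>
  define g' where "g' = (\<lambda>h. (fst h, inv (M x) (snd h - dir_deriv (\<lambda>y. M y (a x)) x (fst h))))"
  have "(g has_derivative g') (at (f p))"
  proof (rule has_derivative_inverse_strong[OF S' p _ _ df[OF p]])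
    show "continuous_on S' f"
      by (rule continuous_at_imp_continuous_on) (use has_derivative_continuous[OF df] in auto)
    show "g (f q) = q" if "q \<in> S'" for q
      using that invM[of "fst q" "snd q"] by (auto simp: g_def f_def S'_def)
    show "(\<lambda>h. (fst h, dir_deriv (\<lambda>y. M y (snd p)) (fst p) (fst h) + M (fst p) (snd h))) \<circ> g' = id"
      using surj_f_inv_f[OF surj[OF x]] by (auto simp: g'_def p_def fun_eq_iff)
  qed
  moreover have "f p = (x, l x)" using a[OF x] by (simp add: f_def p_def)
  ultimately have g: "(g has_derivative g') (at (x, l x))" by simp
  have "((\<lambda>y. (y, l y)) has_derivative (\<lambda>h. (h, dir_deriv l x h))) (at x)"
    using has_derivative_Pair[OF has_derivative_ident has_derivative_dir_deriv[OF l[OF x]]] .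
  from has_derivative_snd[OF has_derivative_compose[OF this g]]
  have "(\<lambda>y. snd (g (y, l y))) differentiable (at x)" by (rule differentiableI)
  moreover have "snd (g (y, l y)) = a y" if "y \<in> S" for y
    using a[OF that, symmetric] invM[OF that] by (simp add: g_def)
  ultimately show ?thesis
    by (rule differentiable_cong_open[OF S x, where F = "\<lambda>y. snd (g (y, l y))", rotated])
qed

text \<open>The same map is a continuous injection between spaces of equal dimension, hence a homeomorphism
  onto its image by invariance of domain.\<close>
lemma continuous_linear_solution:
  fixes M :: "'a::euclidean_space \<Rightarrow> 'e::euclidean_space \<Rightarrow> 'e"
  assumes S: "open S" and lin: "\<And>x. x \<in> S \<Longrightarrow> linear (M x)" and inj: "\<And>x. x \<in> S \<Longrightarrow> inj (M x)"
    and M: "\<And>v. continuous_on S (\<lambda>x. M x v)" and l: "continuous_on S l"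
    and a: "\<And>x. x \<in> S \<Longrightarrow> M x (a x) = l x"
  shows "continuous_on S a"
proof -
  define f where "f = (\<lambda>p. (fst p, M (fst p) (snd p)))"
  define S' :: "('a \<times> 'e) set" where "S' = S \<times> UNIV"
  have S': "open S'" unfolding S'_def using S by (simp add: open_Times)
  have rep: "(\<Sum>i\<in>Basis. (b \<bullet> i) *\<^sub>R M y i) = M y b" if "y \<in> S" for y b
    using linear_basis_expansion[OF lin[OF that]] by metis
  have "continuous_on S' (\<lambda>p. (fst p, \<Sum>i\<in>Basis. (snd p \<bullet> i) *\<^sub>R M (fst p) i))"
    by (intro continuous_intros continuous_on_compose2[OF M]) (auto simp: S'_def)
  then have cf: "continuous_on S' f"
    by (rule continuous_on_eq) (auto simp: f_def S'_def rep)
  have injf: "inj_on f S'"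
  proof (rule inj_onI)
    fix p q assume "p \<in> S'" "q \<in> S'" "f p = f q"
    then have e: "fst p \<in> S" "fst p = fst q" "M (fst p) (snd p) = M (fst q) (snd q)"
      unfolding f_def S'_def by (auto simp only: mem_Times_iff prod.inject)
    then have "snd p = snd q" using injD[OF inj[of "fst p"]] by simp
    with e show "p = q" by (simp add: prod_eq_iff)
  qed
  obtain g where g: "homeomorphism S' (f ` S') f g"
    using invariance_of_domain_homeomorphism[OF S' cf order_refl injf] .
  have fa: "f (x, a x) = (x, l x)" "(x, a x) \<in> S'" if "x \<in> S" for x
    using a[OF that] that by (auto simp: f_def S'_def)
  have "continuous_on S (\<lambda>x. snd (g (x, l x)))"
  proof (intro continuous_on_snd continuous_on_compose2[OF homeomorphism_cont2[OF g]])
    show "continuous_on S (\<lambda>x. (x, l x))" using l by (intro continuous_intros)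
    show "(\<lambda>x. (x, l x)) ` S \<subseteq> f ` S'"
    proof (rule image_subsetI)
      fix x assume "x \<in> S"
      then show "(x, l x) \<in> f ` S'" using imageI[OF fa(2), of x f] fa(1)[of x] by simp
    qed
  qed
  then show ?thesis
  proof (rule continuous_on_eq)
    fix x assume "x \<in> S"
    from homeomorphism_apply1[OF g fa(2)[OF this]] show "snd (g (x, l x)) = a x"
      unfolding fa(1)[OF \<open>x \<in> S\<close>] by simp
  qed
qed

text \<open>Induction on \<open>k\<close>: differentiating \<open>M a = l\<close> shows that \<open>D\<^sub>u a\<close> solves a system with the same
  matrix and right-hand side \<open>D\<^sub>u l - (D\<^sub>u M) a\<close>. This replaces Cramer's rule wherever an inverse
  matrix depends on parameters: for tangential projections, Christoffel symbols, projections onto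
  graphs and coordinates in the Grassmannian.\<close>
lemma Ck_on_linear_solution:
  fixes M :: "'a::euclidean_space \<Rightarrow> 'e::euclidean_space \<Rightarrow> 'e"
  assumes S: "open S" and lin: "\<And>x. x \<in> S \<Longrightarrow> linear (M x)" and inj: "\<And>x. x \<in> S \<Longrightarrow> inj (M x)"
    and M: "\<And>v. Ck_on k S (\<lambda>x. M x v)" and l: "Ck_on k S l"
    and a: "\<And>x. x \<in> S \<Longrightarrow> M x (a x) = l x"
  shows "Ck_on k S a"
  using M l a
proof (induction k arbitrary: l a)
  case (0 l a)
  then show ?case using continuous_linear_solution[of S M l a] S lin inj by simp
next
  case (Suc k l a)
  note M = Suc.prems(1) and l = Suc.prems(2) and a = Suc.prems(3)
  have da: "a differentiable (at x)" if "x \<in> S" for x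
    by (rule differentiable_linear_solution[of S M l a x])
      (use M l in \<open>simp_all add: S lin inj a that\<close>)
  have dM: "(\<lambda>x. M x v) differentiable (at x)" if "x \<in> S" for v x using M[of v] that by simp
  have ak: "Ck_on k S a"
    by (rule Suc.IH[of l a, OF Ck_on_SucD[OF M] Ck_on_SucD[OF l]]) (rule a)
  have lDM: "linear (\<lambda>v. dir_deriv (\<lambda>y. M y v) x u)" if x: "x \<in> S" for u x
  proof (rule linearI)
    fix v w r
    have "dir_deriv (\<lambda>y. M y (v + w)) x = dir_deriv (\<lambda>y. M y v + M y w) x"
      by (rule dir_deriv_cong[OF S x]) (simp add: linear_add[OF lin])
    then show "dir_deriv (\<lambda>y. M y (v + w)) x u = dir_deriv (\<lambda>y. M y v) x u + dir_deriv (\<lambda>y. M y w) x u"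
      using dir_deriv_add[OF dM[OF x] dM[OF x]] by simp
    have "dir_deriv (\<lambda>y. M y (r *\<^sub>R v)) x = dir_deriv (\<lambda>y. r *\<^sub>R M y v) x"
      by (rule dir_deriv_cong[OF S x]) (simp add: linear_scale[OF lin])
    then show "dir_deriv (\<lambda>y. M y (r *\<^sub>R v)) x u = r *\<^sub>R dir_deriv (\<lambda>y. M y v) x u"
      using dir_deriv_bounded_linear[OF bounded_linear_scaleR_right dM[OF x]] by simp
  qed
  have "Ck_on k S (\<lambda>x. dir_deriv a x u)" for u
  proof (rule Suc.IH[of "\<lambda>x. dir_deriv l x u + - dir_deriv (\<lambda>y. M y (a x)) x u"])
    show "Ck_on k S (\<lambda>x. M x v)" for v using Ck_on_SucD[OF M] .
    have "Ck_on k S (\<lambda>x. dir_deriv (\<lambda>y. M y (a x)) x u)"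
    proof (rule Ck_on_apply[OF S, of "\<lambda>x v. dir_deriv (\<lambda>y. M y v) x u"])
      show "Ck_on k S (\<lambda>x. dir_deriv (\<lambda>y. M y v) x u)" for v using M[of v] by simp
    qed (auto intro: lDM ak)
    moreover have "Ck_on k S (\<lambda>x. dir_deriv l x u)" using l by simp
    ultimately show "Ck_on k S (\<lambda>x. dir_deriv l x u + - dir_deriv (\<lambda>y. M y (a x)) x u)"
      using Ck_on_bounded_linear[OF S bounded_linear_minus[OF bounded_linear_ident]]
      by (intro Ck_on_add[OF S])
    show "M x (dir_deriv a x u) = dir_deriv l x u + - dir_deriv (\<lambda>y. M y (a x)) x u" if x: "x \<in> S" for x
    proof -
      have "dir_deriv l x = dir_deriv (\<lambda>y. M y (a y)) x"
        by (rule dir_deriv_cong[OF S x]) (simp add: a)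
      then show ?thesis using dir_deriv_apply(2)[of S x M a u] S x lin dM da[OF x] by simp
    qed
  qed
  then show ?case using da by simp
qed

lemma smooth_on_linear_solution:
  fixes M :: "'a::euclidean_space \<Rightarrow> 'e::euclidean_space \<Rightarrow> 'e"
  assumes "open S" "\<And>x. x \<in> S \<Longrightarrow> linear (M x)" "\<And>x. x \<in> S \<Longrightarrow> inj (M x)"
    and "\<And>v. smooth_on S (\<lambda>x. M x v)" "smooth_on S l" "\<And>x. x \<in> S \<Longrightarrow> M x (a x) = l x"
  shows "smooth_on S a"
  unfolding smooth_on_def
proof
  fix k
  show "Ck_on k S a"
    by (rule Ck_on_linear_solution[of S M k l a])
      (use assms(1,4,5) in \<open>simp_all add: smooth_on_def assms(2,3,6)\<close>)
qed

section \<open>Symmetry of second derivatives\<close>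

text \<open>The mean value theorem, applied first along \<open>u\<close> and then along \<open>v\<close>. The second difference is symmetric
  in \<open>u\<close> and \<open>v\<close>, so that it is a value of either mixed derivative near \<open>x\<close>; for small \<open>h\<close> and continuous
  derivatives this makes them equal at \<open>x\<close>.\<close>
lemma second_difference_mvt:
  fixes F :: "'a::real_normed_vector \<Rightarrow> real"
  assumes x: "ball x r \<subseteq> S" and h: "0 < h" "h * (norm u + norm v) < r"
    and dF: "\<And>y. y \<in> S \<Longrightarrow> F differentiable (at y)"
    and ddF: "\<And>y. y \<in> S \<Longrightarrow> (\<lambda>y. dir_deriv F y u) differentiable (at y)"
  shows "\<exists>y. dist y x \<le> h * (norm u + norm v) \<and>
    F (x + h *\<^sub>R u + h *\<^sub>R v) - F (x + h *\<^sub>R u) - (F (x + h *\<^sub>R v) - F x) = h * h * dir_deriv2 F y v u"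
proof -
  have inS: "x + s *\<^sub>R u + t *\<^sub>R v \<in> S" "dist (x + s *\<^sub>R u + t *\<^sub>R v) x \<le> h * (norm u + norm v)"
    if "0 \<le> s" "s \<le> h" "0 \<le> t" "t \<le> h" for s t
  proof -
    have "dist (x + s *\<^sub>R u + t *\<^sub>R v) x = norm (s *\<^sub>R u + t *\<^sub>R v)" by (simp add: dist_norm add.assoc)
    also have "\<dots> \<le> s * norm u + t * norm v" using norm_triangle_ineq[of "s *\<^sub>R u" "t *\<^sub>R v"] that by simp
    also have "\<dots> \<le> h * norm u + h * norm v" using that by (intro add_mono mult_right_mono) auto
    finally show "dist (x + s *\<^sub>R u + t *\<^sub>R v) x \<le> h * (norm u + norm v)" by (simp add: distrib_left)
    then show "x + s *\<^sub>R u + t *\<^sub>R v \<in> S" using h x by (auto simp: subset_iff dist_commute)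
  qed
  define G where "G s = F (x + s *\<^sub>R u + h *\<^sub>R v) - F (x + s *\<^sub>R u)" for s
  have dG: "(G has_derivative (\<lambda>k. k * (dir_deriv F (x + s *\<^sub>R u + h *\<^sub>R v) u - dir_deriv F (x + s *\<^sub>R u) u))) (at s)"
    if s: "0 \<le> s" "s \<le> h" for s
  proof -
    have a: "((\<lambda>s. x + s *\<^sub>R u + t *\<^sub>R v) has_derivative (\<lambda>k. k *\<^sub>R u)) (at s)" for t
      by (auto intro!: derivative_eq_intros)
    have b: "((\<lambda>s. F (x + s *\<^sub>R u + t *\<^sub>R v)) has_derivative (\<lambda>k. k *\<^sub>R dir_deriv F (x + s *\<^sub>R u + t *\<^sub>R v) u)) (at s)"
      if "0 \<le> t" "t \<le> h" for t
    proof -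
      have d: "F differentiable (at (x + s *\<^sub>R u + t *\<^sub>R v))" using dF inS s that by blast
      from has_derivative_compose[OF a has_derivative_dir_deriv[OF d]]
      show ?thesis by (simp add: linear_scale[OF linear_dir_deriv[OF d]])
    qed
    from has_derivative_diff[OF b[of h] b[of 0]] h show ?thesis
      unfolding G_def by (simp add: algebra_simps)
  qed
  have "\<exists>s. 0 < s \<and> s < h \<and> G h - G 0 =
     (h - 0) * (dir_deriv F (x + s *\<^sub>R u + h *\<^sub>R v) u - dir_deriv F (x + s *\<^sub>R u) u)"
  proof (rule MVT2[OF h(1)])
    fix s assume "0 \<le> s" "s \<le> h"
    from dG[OF this] show "(G has_real_derivative (dir_deriv F (x + s *\<^sub>R u + h *\<^sub>R v) u - dir_deriv F (x + s *\<^sub>R u) u)) (at s)"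
      unfolding has_field_derivative_def by (simp add: mult_commute_abs)
  qed
  then obtain s where s: "0 < s" "s < h" "G h - G 0 = h * (dir_deriv F (x + s *\<^sub>R u + h *\<^sub>R v) u - dir_deriv F (x + s *\<^sub>R u) u)"
    by auto
  have "\<exists>t. 0 < t \<and> t < h \<and> dir_deriv F (x + s *\<^sub>R u + h *\<^sub>R v) u - dir_deriv F (x + s *\<^sub>R u + 0 *\<^sub>R v) u =
     (h - 0) * dir_deriv2 F (x + s *\<^sub>R u + t *\<^sub>R v) v u"
  proof (rule MVT2[OF h(1)])
    fix t assume t: "0 \<le> t" "t \<le> h"
    have d: "(\<lambda>y. dir_deriv F y u) differentiable (at (x + s *\<^sub>R u + t *\<^sub>R v))"
      using ddF inS(1)[of s t] s t by auto
    have "((\<lambda>t. x + s *\<^sub>R u + t *\<^sub>R v) has_derivative (\<lambda>k. k *\<^sub>R v)) (at t)"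
      by (auto intro!: derivative_eq_intros)
    from has_derivative_compose[OF this has_derivative_dir_deriv[OF d]]
    show "((\<lambda>t. dir_deriv F (x + s *\<^sub>R u + t *\<^sub>R v) u) has_real_derivative dir_deriv2 F (x + s *\<^sub>R u + t *\<^sub>R v) v u) (at t)"
      unfolding has_field_derivative_def dir_deriv2_def
      by (simp add: linear_scale[OF linear_dir_deriv[OF d]] mult_commute_abs)
  qed
  then obtain t where t: "0 < t" "t < h" "dir_deriv F (x + s *\<^sub>R u + h *\<^sub>R v) u - dir_deriv F (x + s *\<^sub>R u) u =
     h * dir_deriv2 F (x + s *\<^sub>R u + t *\<^sub>R v) v u" by auto
  have "F (x + h *\<^sub>R u + h *\<^sub>R v) - F (x + h *\<^sub>R u) - (F (x + h *\<^sub>R v) - F x) = h * h * dir_deriv2 F (x + s *\<^sub>R u + t *\<^sub>R v) v u"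
    using s(3) unfolding t(3) by (simp add: G_def)
  moreover have "dist (x + s *\<^sub>R u + t *\<^sub>R v) x \<le> h * (norm u + norm v)" using inS s t by simp
  ultimately show ?thesis by blast
qed

lemma dir_deriv2_commute_real:
  fixes F :: "'a::real_normed_vector \<Rightarrow> real"
  assumes S: "open S" "x \<in> S" and F: "Ck_on 2 S F"
  shows "dir_deriv2 F x u v = dir_deriv2 F x v u"
proof (rule ccontr)
  assume ne: "dir_deriv2 F x u v \<noteq> dir_deriv2 F x v u"
  have dF: "F differentiable (at y)" and ddF: "(\<lambda>y. dir_deriv F y w) differentiable (at y)"
    and cF: "continuous_on S (\<lambda>y. dir_deriv2 F y w z)" if "y \<in> S" for y w z
    using F that by (auto simp: numeral_2_eq_2 dir_deriv2_def)
  define e where "e = \<bar>dir_deriv2 F x u v - dir_deriv2 F x v u\<bar> / 2"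
  have e: "e > 0" using ne by (simp add: e_def)
  have c: "\<exists>d>0. \<forall>y. dist y x < d \<longrightarrow> y \<in> S \<and> \<bar>dir_deriv2 F y w z - dir_deriv2 F x w z\<bar> < e" for w z
  proof -
    have "isCont (\<lambda>y. dir_deriv2 F y w z) x" using cF[OF S(2)] S by (simp add: continuous_on_eq_continuous_at)
    then obtain d where d: "d > 0" "\<And>y. dist y x < d \<Longrightarrow> \<bar>dir_deriv2 F y w z - dir_deriv2 F x w z\<bar> < e"
      using e unfolding continuous_at_eps_delta by (auto simp: dist_real_def)
    obtain d' where "d' > 0" "ball x d' \<subseteq> S" using S openE by blast
    then show ?thesis using d by (intro exI[of _ "min d d'"]) (auto simp: dist_commute subset_iff)
  qed
  obtain d1 where d1: "d1 > 0" "\<And>y. dist y x < d1 \<Longrightarrow> y \<in> S \<and> \<bar>dir_deriv2 F y u v - dir_deriv2 F x u v\<bar> < e"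
    using c by blast
  obtain d2 where d2: "d2 > 0" "\<And>y. dist y x < d2 \<Longrightarrow> \<bar>dir_deriv2 F y v u - dir_deriv2 F x v u\<bar> < e"
    using c by blast
  define r where "r = min d1 d2"
  define h where "h = r / (2 * (norm u + norm v + 1))"
  have p: "norm u + norm v + 1 > 0" "r > 0"
    using d1(1) d2(1) norm_ge_zero[of u] norm_ge_zero[of v] by (auto simp: r_def simp del: norm_ge_zero)
  then have h: "h > 0" by (simp add: h_def)
  have "h * (norm u + norm v) \<le> h * (norm u + norm v + 1)" using h by (intro mult_left_mono) auto
  also have "\<dots> = r / 2" using p unfolding h_def by (simp add: field_simps)
  also have "\<dots> < r" using p by simp
  finally have hr: "h * (norm u + norm v) < r" .
  then have hr': "h * (norm v + norm u) < r" by (simp add: add.commute)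
  have b: "ball x r \<subseteq> S" using d1 by (auto simp: r_def dist_commute)
  obtain y where y: "dist y x \<le> h * (norm u + norm v)"
    "F (x + h *\<^sub>R u + h *\<^sub>R v) - F (x + h *\<^sub>R u) - (F (x + h *\<^sub>R v) - F x) = h * h * dir_deriv2 F y v u"
    using second_difference_mvt[OF b h hr dF ddF] by blast
  obtain z where z: "dist z x \<le> h * (norm v + norm u)"
    "F (x + h *\<^sub>R v + h *\<^sub>R u) - F (x + h *\<^sub>R v) - (F (x + h *\<^sub>R u) - F x) = h * h * dir_deriv2 F z u v"
    using second_difference_mvt[OF b h hr' dF ddF] by blast
  have "h * h * dir_deriv2 F y v u = h * h * dir_deriv2 F z u v"
    unfolding y(2)[symmetric] z(2)[symmetric] by (simp add: algebra_simps)
  then have eq: "dir_deriv2 F z u v = dir_deriv2 F y v u" using h by simp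
  have "\<bar>dir_deriv2 F x u v - dir_deriv2 F x v u\<bar>
      \<le> \<bar>dir_deriv2 F y v u - dir_deriv2 F x v u\<bar> + \<bar>dir_deriv2 F y v u - dir_deriv2 F x u v\<bar>" by linarith
  moreover have "\<bar>dir_deriv2 F y v u - dir_deriv2 F x v u\<bar> < e" using d2(2)[of y] y(1) hr by (simp add: r_def)
  moreover have "\<bar>dir_deriv2 F y v u - dir_deriv2 F x u v\<bar> < e"
    using d1(2)[of z] z(1) hr' by (simp add: r_def eq)
  moreover have "e + e = \<bar>dir_deriv2 F x u v - dir_deriv2 F x v u\<bar>" by (simp add: e_def)
  ultimately show False by (metis add_strict_mono linorder_not_less)
qed

lemma dir_deriv2_bounded_linear:
  assumes "open S" "x \<in> S" "bounded_linear p" "smooth_on S F"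
  shows "dir_deriv2 (\<lambda>y. p (F y)) x u v = p (dir_deriv2 F x u v)"
proof -
  have "dir_deriv2 (\<lambda>y. p (F y)) x u v = dir_deriv (\<lambda>y. p (dir_deriv F y v)) x u"
    unfolding dir_deriv2_def
    by (rule fun_cong[OF dir_deriv_cong[OF assms(1,2)]])
      (rule dir_deriv_bounded_linear[OF assms(3) smooth_on_differentiable[OF assms(4)]])
  also have "\<dots> = p (dir_deriv2 F x u v)" unfolding dir_deriv2_def
    by (rule dir_deriv_bounded_linear[OF assms(3) smooth_on_differentiable[OF smooth_on_dir_deriv[OF assms(4)] assms(2)]])
  finally show ?thesis .
qed

lemma dir_deriv2_commute:
  fixes F :: "'a::real_normed_vector \<Rightarrow> 'b::euclidean_space"
  assumes "open S" "x \<in> S" "smooth_on S F"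
  shows "dir_deriv2 F x u v = dir_deriv2 F x v u"
proof (rule euclidean_eqI)
  fix b :: 'b
  have "smooth_on S (\<lambda>y. F y \<bullet> b)"
    by (rule smooth_on_bounded_linear[OF assms(1) bounded_linear_inner_left assms(3)])
  then have "dir_deriv2 (\<lambda>y. F y \<bullet> b) x u v = dir_deriv2 (\<lambda>y. F y \<bullet> b) x v u"
    using dir_deriv2_commute_real[OF assms(1,2)] unfolding smooth_on_def by blast
  then show "dir_deriv2 F x u v \<bullet> b = dir_deriv2 F x v u \<bullet> b"
    by (simp add: dir_deriv2_bounded_linear[OF assms(1,2) bounded_linear_inner_left assms(3)])
qed

section \<open>Orthogonal projections and induced metrics\<close>

lemma orth_proj_eqI:
  assumes "subspace T" "u \<in> T" "v - u \<in> orthogonal_comp T"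
  shows "orth_proj T v = u"
  unfolding orth_proj_def
proof (rule the_equality)
  fix u' assume u': "u' \<in> T \<and> v - u' \<in> orthogonal_comp T"
  have T: "u - u' \<in> T" using u' assms by (simp add: subspace_diff)
  have "(u - u') \<bullet> (v - u') - (u - u') \<bullet> (v - u) = 0"
    using T u' assms(3) by (simp add: orthogonal_comp_def orthogonal_def)
  then have "(u - u') \<bullet> (u - u') = 0" by (simp add: inner_diff_right)
  then show "u' = u" by simp
qed (use assms in auto)

lemma subspace_mem_iff_diff:
  assumes "subspace S" "a - b \<in> S"
  shows "a \<in> S \<longleftrightarrow> b \<in> S"
  using subspace_diff[OF assms(1) _ assms(2), of a] subspace_add[OF assms(1) _ assms(2), of b] by auto

lemma subspace_mem_iff_scale:
  assumes "subspace S" "c \<noteq> 0"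
  shows "c *\<^sub>R a \<in> S \<longleftrightarrow> a \<in> S"
  using subspace_scale[OF assms(1), of "c *\<^sub>R a" "inverse c"] subspace_scale[OF assms(1), of a c] assms(2) by auto

text \<open>The tangential part of a vector \<open>w\<close> of the ambient space, written in coordinates: \<open>L a\<close> is the
  orthogonal projection of \<open>w\<close> onto the range of \<open>L\<close>.\<close>
lemma tangent_solution:
  fixes L :: "'e::euclidean_space \<Rightarrow> 'v::euclidean_space"
  assumes "linear L"
  obtains a where "\<And>z. L a \<bullet> L z = w \<bullet> L z"
proof -
  have s: "subspace (range L)" using assms by (simp add: linear_subspace_image)
  obtain y z where yz: "y \<in> range L" "w = y + z" "\<And>u. u \<in> range L \<Longrightarrow> orthogonal z u"
    using orthogonal_subspace_decomp_exists[of "range L" w] span_eq_iff[THEN iffD2, OF s] by metis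
  obtain a where "y = L a" using yz by auto
  then show ?thesis using yz by (intro that[of a]) (auto simp: orthogonal_def inner_add_left)
qed

lemma tangent_solution_unique:
  assumes "linear L" "inj L" "\<And>z. L a \<bullet> L z = L b \<bullet> L z"
  shows "a = b"
proof -
  have "L (a - b) \<bullet> L (a - b) = 0" using assms(3)[of "a - b"] by (simp add: linear_diff[OF assms(1)] inner_diff_left)
  then show ?thesis using assms(1,2) by (simp add: linear_diff[OF assms(1)] inj_eq)
qed

text \<open>For a metric induced by an immersion \<open>G\<close> the Levi-Civita connection is the tangential part of the
  flat one. The Koszul expression telescopes, by symmetry of the second derivative, to twice the
  inner product of \<open>D\<^sup>2G(v, w)\<close> with \<open>dG(z)\<close>. The factor \<open>k\<close> serves the Grassmannian, whose metric is
  half of an induced one.\<close>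
lemma induced_christoffel:
  fixes G :: "'e::euclidean_space \<Rightarrow> 'v::euclidean_space"
  assumes V: "open V" "x \<in> V" and G: "smooth_on V G" and inj: "inj (dir_deriv G x)" and k: "k \<noteq> (0::real)"
    and h: "\<And>y v w. y \<in> V \<Longrightarrow> h y v w = k * (dir_deriv G y v \<bullet> dir_deriv G y w)"
  shows "dir_deriv G x (christoffel h x v w) \<bullet> dir_deriv G x z = dir_deriv2 G x v w \<bullet> dir_deriv G x z"
proof -
  have lin: "linear (dir_deriv G x)" using smooth_on_differentiable[OF G V(2)] linear_dir_deriv by blast
  have d: "(\<lambda>y. dir_deriv G y v) differentiable (at x)" for v
    using smooth_on_differentiable[OF smooth_on_dir_deriv[OF G] V(2)] .
  have dh: "dir_deriv (\<lambda>y. h y v w) x u =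
     k * (dir_deriv G x v \<bullet> dir_deriv2 G x u w + dir_deriv2 G x u v \<bullet> dir_deriv G x w)" for u v w
  proof -
    have "dir_deriv (\<lambda>y. h y v w) x u = dir_deriv (\<lambda>y. k * (dir_deriv G y v \<bullet> dir_deriv G y w)) x u"
      by (rule fun_cong[OF dir_deriv_cong[OF V]]) (rule h)
    also have "\<dots> = k * dir_deriv (\<lambda>y. dir_deriv G y v \<bullet> dir_deriv G y w) x u"
      by (rule dir_deriv_bounded_linear[OF bounded_linear_mult_right]) (intro differentiable_inner d)
    also have "\<dots> = k * (dir_deriv G x v \<bullet> dir_deriv2 G x u w + dir_deriv2 G x u v \<bullet> dir_deriv G x w)"
      unfolding dir_deriv_bilinear[OF bounded_bilinear_inner d d] dir_deriv2_def ..
    finally show ?thesis .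
  qed
  have sym: "dir_deriv2 G x v w = dir_deriv2 G x w v" for v w
    by (rule dir_deriv2_commute[OF V G])
  have K: "dir_deriv (\<lambda>y. h y w z) x v + dir_deriv (\<lambda>y. h y v z) x w - dir_deriv (\<lambda>y. h y v w) x z
     = 2 * k * (dir_deriv2 G x v w \<bullet> dir_deriv G x z)" for v w z
    unfolding dh sym[of z v] sym[of z w] sym[of w v] by (simp add: algebra_simps inner_commute)
  obtain a where a: "\<And>z. dir_deriv G x a \<bullet> dir_deriv G x z = dir_deriv2 G x v w \<bullet> dir_deriv G x z"
    using tangent_solution[OF lin] by metis
  have "christoffel h x v w = a"
    unfolding christoffel_def K
  proof (rule the_equality)
    show "\<forall>z. 2 * h x a z = 2 * k * (dir_deriv2 G x v w \<bullet> dir_deriv G x z)"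
      using a by (simp add: h[OF V(2)])
    fix u assume "\<forall>z. 2 * h x u z = 2 * k * (dir_deriv2 G x v w \<bullet> dir_deriv G x z)"
    then have "dir_deriv G x u \<bullet> dir_deriv G x z = dir_deriv G x a \<bullet> dir_deriv G x z" for z
      using a k by (simp add: h[OF V(2)])
    then show "u = a" by (rule tangent_solution_unique[OF lin inj])
  qed
  then show ?thesis using a by simp
qed

lemma half_sum_diff: "a = (1/2) *\<^sub>R (a + b) + (1/2) *\<^sub>R (a - b)"
  "b = (1/2) *\<^sub>R (a + b) - (1/2) *\<^sub>R (a - b)" for a b :: "'w::real_vector"
proof -
  have "(1/2) *\<^sub>R (a + b) + (1/2) *\<^sub>R (a - b) = (1/2 + 1/2) *\<^sub>R a"
    by (simp only: scaleR_left_distrib scaleR_right_distrib scaleR_right_diff_distrib) simp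
  then show "a = (1/2) *\<^sub>R (a + b) + (1/2) *\<^sub>R (a - b)" by simp
  have "(1/2) *\<^sub>R (a + b) - (1/2) *\<^sub>R (a - b) = (1/2 + 1/2) *\<^sub>R b"
    by (simp only: scaleR_left_distrib scaleR_right_distrib scaleR_right_diff_distrib) simp
  then show "b = (1/2) *\<^sub>R (a + b) - (1/2) *\<^sub>R (a - b)" by simp
qed

section \<open>Immersions of a coordinate domain with a parallel complex structure\<close>

text \<open>The assumption on \<open>\<Gamma>\<close> is the conclusion of \<open>induced_christoffel\<close>; with \<open>\<Gamma>\<close> as a parameter, the local
  computations refer to no metric other than the inner product of the ambient space.\<close>
locale kaehler_immersion =
  fixes U :: "'e::euclidean_space set" and F :: "'e \<Rightarrow> 'v::euclidean_space"
    and J :: "'e \<Rightarrow> 'e \<Rightarrow> 'e" and \<Gamma> :: "'e \<Rightarrow> 'e \<Rightarrow> 'e \<Rightarrow> 'e"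
  assumes open_U: "open U" and smooth_F: "smooth_on U F"
    and inj_dF: "\<And>x. x \<in> U \<Longrightarrow> inj (dir_deriv F x)"
    and \<Gamma>: "\<And>x v w z. x \<in> U \<Longrightarrow> dir_deriv F x (\<Gamma> x v w) \<bullet> dir_deriv F x z = dir_deriv2 F x v w \<bullet> dir_deriv F x z"
    and smooth_J: "\<And>v. smooth_on U (\<lambda>x. J x v)"
    and linear_J: "\<And>x. x \<in> U \<Longrightarrow> linear (J x)"
    and J_J: "\<And>x v. x \<in> U \<Longrightarrow> J x (J x v) = - v"
    and J_isometric: "\<And>x v w. x \<in> U \<Longrightarrow> dir_deriv F x (J x v) \<bullet> dir_deriv F x (J x w) = dir_deriv F x v \<bullet> dir_deriv F x w"
    and J_parallel: "\<And>x u v. x \<in> U \<Longrightarrow> dir_deriv (\<lambda>y. J y v) x u = J x (\<Gamma> x u v) - \<Gamma> x u (J x v)"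
begin

abbreviation "dF \<equiv> dir_deriv F"
abbreviation "D2F \<equiv> dir_deriv2 F"

lemma differentiable_F: "x \<in> U \<Longrightarrow> F differentiable (at x)"
  using smooth_on_differentiable[OF smooth_F] .

lemma linear_dF: "x \<in> U \<Longrightarrow> linear (dF x)"
  using linear_dir_deriv differentiable_F by blast

lemma smooth_dF: "smooth_on U (\<lambda>x. dF x v)"
  using smooth_on_dir_deriv[OF smooth_F] .

lemma smooth_D2F: "smooth_on U (\<lambda>x. D2F x v w)"
  unfolding dir_deriv2_def using smooth_on_dir_deriv[OF smooth_dF] .

lemma D2F_sym: "x \<in> U \<Longrightarrow> D2F x v w = D2F x w v"
  using dir_deriv2_commute[OF open_U _ smooth_F] .

lemma linear_D2F: "x \<in> U \<Longrightarrow> linear (D2F x v)"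
  using linear_dir_deriv[OF smooth_on_differentiable[OF smooth_dF]] D2F_sym[of x v]
  unfolding dir_deriv2_def by simp

lemma dF_eqI: "x \<in> U \<Longrightarrow> (\<And>z. dF x a \<bullet> dF x z = dF x b \<bullet> dF x z) \<Longrightarrow> a = b"
  using tangent_solution_unique[OF linear_dF inj_dF] by blast

text \<open>The coordinates of the tangential part solve the linear system given by the Gram matrix of \<open>dF\<close>.\<close>
lemma smooth_tangential:
  assumes W: "smooth_on U W"
    and a: "\<And>x z. x \<in> U \<Longrightarrow> dF x (a x) \<bullet> dF x z = W x \<bullet> dF x z"
  shows "smooth_on U a"
proof (rule smooth_on_linear_solution[OF open_U, where M = "\<lambda>x v. \<Sum>i\<in>Basis. (dF x v \<bullet> dF x i) *\<^sub>R i"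
      and l = "\<lambda>x. \<Sum>i\<in>Basis. (W x \<bullet> dF x i) *\<^sub>R i"])
  show "linear (\<lambda>v. \<Sum>i\<in>Basis. (dF x v \<bullet> dF x i) *\<^sub>R i)" if "x \<in> U" for x
    by (intro linear_compose_sum ballI linearI)
      (simp_all add: linear_add[OF linear_dF[OF that]] linear_scale[OF linear_dF[OF that]] inner_add_left scaleR_left_distrib)
  show "inj (\<lambda>v. \<Sum>i\<in>Basis. (dF x v \<bullet> dF x i) *\<^sub>R i)" if x: "x \<in> U" for x
  proof (rule injI)
    fix v w assume *: "(\<Sum>i\<in>Basis. (dF x v \<bullet> dF x i) *\<^sub>R i) = (\<Sum>i\<in>Basis. (dF x w \<bullet> dF x i) *\<^sub>R i)"
    have i: "dF x v \<bullet> dF x i = dF x w \<bullet> dF x i" if "i \<in> Basis" for i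
      using arg_cong[OF *, of "\<lambda>y. y \<bullet> i"] that by simp
    show "v = w"
    proof (rule dF_eqI[OF x])
      show "dF x v \<bullet> dF x z = dF x w \<bullet> dF x z" for z
        unfolding linear_basis_expansion[OF linear_dF[OF x], of z] inner_sum_right inner_scaleR_right
        by (rule sum.cong) (simp_all add: i)
    qed
  qed
  have bl: "bounded_linear (\<lambda>r. r *\<^sub>R i)" for i :: 'e by (rule bounded_linear_scaleR_left)
  show "smooth_on U (\<lambda>x. \<Sum>i\<in>Basis. (dF x v \<bullet> dF x i) *\<^sub>R i)" for v
    by (intro smooth_on_sum open_U smooth_on_bounded_linear[OF open_U bl]
        smooth_on_bilinear[OF open_U bounded_bilinear_inner] smooth_dF)
  show "smooth_on U (\<lambda>x. \<Sum>i\<in>Basis. (W x \<bullet> dF x i) *\<^sub>R i)"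
    by (intro smooth_on_sum open_U smooth_on_bounded_linear[OF open_U bl]
        smooth_on_bilinear[OF open_U bounded_bilinear_inner] smooth_dF W)
  show "(\<Sum>i\<in>Basis. (dF x (a x) \<bullet> dF x i) *\<^sub>R i) = (\<Sum>i\<in>Basis. (W x \<bullet> dF x i) *\<^sub>R i)" if "x \<in> U" for x
    using a[OF that] by simp
qed

lemma smooth_\<Gamma>: "smooth_on U (\<lambda>x. \<Gamma> x v w)"
  by (rule smooth_tangential[OF smooth_D2F \<Gamma>])

lemma \<Gamma>_sym: assumes x: "x \<in> U" shows "\<Gamma> x v w = \<Gamma> x w v"
  by (rule dF_eqI[OF x]) (simp only: \<Gamma>[OF x] D2F_sym[OF x, of v w])

lemma linear_\<Gamma>: assumes x: "x \<in> U" shows "linear (\<Gamma> x v)"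
proof (rule linearI)
  note simps = \<Gamma>[OF x] linear_add[OF linear_dF[OF x]] linear_scale[OF linear_dF[OF x]]
    linear_add[OF linear_D2F[OF x]] linear_scale[OF linear_D2F[OF x]] inner_add_left
  show "\<Gamma> x v (a + b) = \<Gamma> x v a + \<Gamma> x v b" for a b
    by (rule dF_eqI[OF x]) (simp add: simps)
  show "\<Gamma> x v (r *\<^sub>R b) = r *\<^sub>R \<Gamma> x v b" for r b
    by (rule dF_eqI[OF x]) (simp add: simps)
qed

text \<open>The second fundamental form, by the Gauss formula.\<close>
definition \<alpha> where "\<alpha> x v w = D2F x v w - dF x (\<Gamma> x v w)"

lemma \<alpha>_normal: "x \<in> U \<Longrightarrow> \<alpha> x v w \<bullet> dF x z = 0"
  by (simp add: \<alpha>_def inner_diff_left \<Gamma>)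

lemma \<alpha>_sym: "x \<in> U \<Longrightarrow> \<alpha> x v w = \<alpha> x w v"
  by (simp add: \<alpha>_def D2F_sym[of x v w] \<Gamma>_sym[of x v w])

lemma linear_\<alpha>: "x \<in> U \<Longrightarrow> linear (\<alpha> x v)"
  using linear_compose_sub[OF linear_D2F linear_compose[OF linear_\<Gamma> linear_dF]]
  unfolding \<alpha>_def[abs_def] o_def by blast

lemma linear_\<alpha>': assumes x: "x \<in> U" shows "linear (\<lambda>v. \<alpha> x v w)"
  using linear_\<alpha>[OF x, of w] by (subst \<alpha>_sym[OF x]) simp

lemmas \<alpha>_linear = linear_add[OF linear_\<alpha>] linear_add[OF linear_\<alpha>'] linear_diff[OF linear_\<alpha>] linear_diff[OF linear_\<alpha>']
  linear_neg[OF linear_\<alpha>] linear_neg[OF linear_\<alpha>']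

lemma smooth_dF_\<Gamma>: "smooth_on U (\<lambda>x. dF x (\<Gamma> x v w))"
  by (rule smooth_on_apply[OF open_U linear_dF smooth_dF smooth_\<Gamma>])

lemma smooth_\<alpha>: "smooth_on U (\<lambda>x. \<alpha> x v w)"
  unfolding \<alpha>_def by (rule smooth_on_diff[OF open_U smooth_D2F smooth_dF_\<Gamma>])

text \<open>The derivative of \<open>\<alpha>\<close> as a form with values in the whole ambient space: the flat connection acts on
  the values and \<open>\<Gamma>\<close> on the arguments. Its normal part is the derivative of \<open>\<alpha>\<close> in the tangent and
  normal connections, its tangential part is quadratic in \<open>\<alpha>\<close>. Both parts enter the criterion.\<close>
definition D\<alpha> where
  "D\<alpha> x u v w = dir_deriv (\<lambda>y. \<alpha> y v w) x u - \<alpha> x (\<Gamma> x u v) w - \<alpha> x v (\<Gamma> x u w)"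

lemma D\<alpha>_sym: assumes x: "x \<in> U" shows "D\<alpha> x u v w = D\<alpha> x u w v"
proof -
  have "dir_deriv (\<lambda>y. \<alpha> y v w) x = dir_deriv (\<lambda>y. \<alpha> y w v) x"
    by (rule dir_deriv_cong[OF open_U x]) (rule \<alpha>_sym)
  then show ?thesis unfolding D\<alpha>_def by (simp add: \<alpha>_sym[OF x, of v] \<alpha>_sym[OF x, of "\<Gamma> x u v"])
qed

text \<open>Differentiate the orthogonality of \<open>\<alpha>\<close> and \<open>dF(e)\<close> along \<open>u\<close>.\<close>
lemma D\<alpha>_tangential: assumes x: "x \<in> U"
  shows "D\<alpha> x u v w \<bullet> dF x e = - (\<alpha> x v w \<bullet> \<alpha> x u e)"
proof -
  have "dir_deriv (\<lambda>y. \<alpha> y v w \<bullet> dF y e) x = dir_deriv (\<lambda>y. 0) x"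
    by (rule dir_deriv_cong[OF open_U x]) (rule \<alpha>_normal)
  then have "\<alpha> x v w \<bullet> D2F x u e + dir_deriv (\<lambda>y. \<alpha> y v w) x u \<bullet> dF x e = 0"
    using dir_deriv_bilinear[OF bounded_bilinear_inner smooth_on_differentiable[OF smooth_\<alpha> x]
        smooth_on_differentiable[OF smooth_dF x], of v w e u]
    by (simp add: dir_deriv_const dir_deriv2_def)
  moreover have "\<alpha> x v w \<bullet> D2F x u e = \<alpha> x v w \<bullet> \<alpha> x u e"
    unfolding \<alpha>_def[of x u e] inner_diff_right using \<alpha>_normal[OF x] by simp
  ultimately show ?thesis by (simp add: D\<alpha>_def inner_diff_left \<alpha>_normal[OF x])
qed

lemma subspace_range_dF: "x \<in> U \<Longrightarrow> subspace (range (dF x))"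
  using linear_dF by (simp add: linear_subspace_image)

text \<open>The Codazzi equation of a flat ambient space: the only third-order term is the third derivative
  of \<open>F\<close>, which is symmetric, and what remains lies in the range of \<open>dF\<close>.\<close>
lemma codazzi: assumes x: "x \<in> U"
  shows "D\<alpha> x u v w - D\<alpha> x v u w \<in> range (dF x)"
proof -
  have d\<alpha>: "dir_deriv (\<lambda>y. \<alpha> y v w) x u =
      dir_deriv2 (\<lambda>y. dF y w) x u v - D2F x u (\<Gamma> x v w) - dF x (dir_deriv (\<lambda>y. \<Gamma> y v w) x u)" for u v
  proof -
    have "dir_deriv (\<lambda>y. \<alpha> y v w) x u
       = dir_deriv (\<lambda>y. D2F y v w) x u - dir_deriv (\<lambda>y. dF y (\<Gamma> y v w)) x u"
      unfolding \<alpha>_def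
      by (rule dir_deriv_diff[OF smooth_D2F[THEN smooth_on_differentiable, OF x]
            smooth_dF_\<Gamma>[THEN smooth_on_differentiable, OF x]])
    also have "dir_deriv (\<lambda>y. dF y (\<Gamma> y v w)) x u = D2F x u (\<Gamma> x v w) + dF x (dir_deriv (\<lambda>y. \<Gamma> y v w) x u)"
      using dir_deriv_apply(2)[of U x "\<lambda>x. dF x" "\<lambda>y. \<Gamma> y v w" u] open_U x linear_dF
        smooth_on_differentiable[OF smooth_dF] smooth_on_differentiable[OF smooth_\<Gamma> x]
      by (simp add: dir_deriv2_def)
    finally show ?thesis by (simp add: dir_deriv2_def)
  qed
  have "D\<alpha> x u v w - D\<alpha> x v u w = dF x (\<Gamma> x v (\<Gamma> x u w) - dir_deriv (\<lambda>y. \<Gamma> y v w) x u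
      - \<Gamma> x u (\<Gamma> x v w) + dir_deriv (\<lambda>y. \<Gamma> y u w) x v)"
    unfolding D\<alpha>_def d\<alpha> dir_deriv2_commute[OF open_U x smooth_dF, of w u v] \<Gamma>_sym[OF x, of u v]
    by (simp add: \<alpha>_def linear_add[OF linear_dF[OF x]] linear_diff[OF linear_dF[OF x]] algebra_simps)
  then show ?thesis by simp
qed

lemma smooth_\<alpha>_left_J: "smooth_on U (\<lambda>y. \<alpha> y (J y v) b)"
  by (rule smooth_on_apply[OF open_U, of "\<lambda>y v. \<alpha> y v b"]) (simp_all add: linear_\<alpha>' smooth_\<alpha> smooth_J)

lemma dir_deriv_\<alpha>_both_J: assumes x: "x \<in> U"
  shows "dir_deriv (\<lambda>y. \<alpha> y (J y v) (J y w)) x u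
    = D\<alpha> x u (J x v) (J x w) + \<alpha> x (J x (\<Gamma> x u v)) (J x w) + \<alpha> x (J x v) (J x (\<Gamma> x u w))"
proof -
  have "dir_deriv (\<lambda>y. \<alpha> y (J y v) (J y w)) x u
    = dir_deriv (\<lambda>y. \<alpha> y (J y v) (J x w)) x u + \<alpha> x (J x v) (dir_deriv (\<lambda>y. J y w) x u)"
    by (rule dir_deriv_apply(2)[of U x "\<lambda>y. \<alpha> y (J y v)"])
      (simp_all add: open_U x linear_\<alpha> smooth_on_differentiable[OF smooth_\<alpha>_left_J] smooth_on_differentiable[OF smooth_J])
  also have "dir_deriv (\<lambda>y. \<alpha> y (J y v) (J x w)) x u
    = dir_deriv (\<lambda>y. \<alpha> y (J x v) (J x w)) x u + \<alpha> x (dir_deriv (\<lambda>y. J y v) x u) (J x w)"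
    by (rule dir_deriv_apply(2)[of U x "\<lambda>y b. \<alpha> y b (J x w)"])
      (simp_all add: open_U x linear_\<alpha>' smooth_on_differentiable[OF smooth_\<alpha>] smooth_on_differentiable[OF smooth_J])
  finally show ?thesis
    unfolding J_parallel[OF x] by (simp add: D\<alpha>_def \<alpha>_linear[OF x])
qed

lemma dir_deriv_\<alpha>_right_J: assumes x: "x \<in> U"
  shows "dir_deriv (\<lambda>y. \<alpha> y v (J y w)) x u = D\<alpha> x u v (J x w) + \<alpha> x (\<Gamma> x u v) (J x w) + \<alpha> x v (J x (\<Gamma> x u w))"
proof -
  have "dir_deriv (\<lambda>y. \<alpha> y v (J y w)) x u
    = dir_deriv (\<lambda>y. \<alpha> y v (J x w)) x u + \<alpha> x v (dir_deriv (\<lambda>y. J y w) x u)"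
    by (rule dir_deriv_apply(2)[of U x "\<lambda>y. \<alpha> y v"])
      (simp_all add: open_U x linear_\<alpha> smooth_on_differentiable[OF smooth_\<alpha>] smooth_on_differentiable[OF smooth_J])
  then show ?thesis unfolding J_parallel[OF x] by (simp add: D\<alpha>_def \<alpha>_linear[OF x])
qed

text \<open>The parts \<open>\<gamma>\<close> and \<open>\<delta>\<close> of \<open>\<alpha>\<close> are of type \<open>(1,1)\<close> and \<open>(2,0) + (0,2)\<close>: in complex terms, \<open>\<gamma>\<close> carries
  \<open>\<alpha>(T', T'')\<close> and \<open>\<delta>\<close> carries \<open>\<alpha>(T', T')\<close>.\<close>
definition \<gamma> where "\<gamma> x v w = (1/2) *\<^sub>R (\<alpha> x v w + \<alpha> x (J x v) (J x w))"

definition \<delta> where "\<delta> x v w = (1/2) *\<^sub>R (\<alpha> x v w - \<alpha> x (J x v) (J x w))"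

lemma cov_deriv_\<gamma>: assumes x: "x \<in> U"
  shows "dir_deriv (\<lambda>y. \<gamma> y v w) x u - \<gamma> x (\<Gamma> x u v) w - \<gamma> x v (\<Gamma> x u w)
    = (1/2) *\<^sub>R (D\<alpha> x u v w + D\<alpha> x u (J x v) (J x w))"
proof -
  have s: "smooth_on U (\<lambda>y. \<alpha> y (J y v) (J y w))"
    by (rule smooth_on_apply[OF open_U, of "\<lambda>y. \<alpha> y (J y v)"])
      (simp_all add: linear_\<alpha> smooth_\<alpha>_left_J smooth_J)
  have "dir_deriv (\<lambda>y. \<gamma> y v w) x u
    = (1/2) *\<^sub>R dir_deriv (\<lambda>y. \<alpha> y v w + \<alpha> y (J y v) (J y w)) x u"
    unfolding \<gamma>_def
    by (rule dir_deriv_bounded_linear[OF bounded_linear_scaleR_right])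
      (intro differentiable_add smooth_on_differentiable[OF _ x] smooth_\<alpha> s)
  also have "dir_deriv (\<lambda>y. \<alpha> y v w + \<alpha> y (J y v) (J y w)) x u
     = dir_deriv (\<lambda>y. \<alpha> y v w) x u + dir_deriv (\<lambda>y. \<alpha> y (J y v) (J y w)) x u"
    by (intro dir_deriv_add smooth_on_differentiable[OF _ x] smooth_\<alpha> s)
  finally show ?thesis
    unfolding dir_deriv_\<alpha>_both_J[OF x] D\<alpha>_def \<gamma>_def by (simp add: algebra_simps)
qed

lemma \<gamma>_\<delta>_sym:
  assumes x: "x \<in> U"
  shows "\<gamma> x v w = \<gamma> x w v" "\<delta> x v w = \<delta> x w v"
  by (simp_all only: \<gamma>_def \<delta>_def \<alpha>_sym[OF x, of v w] \<alpha>_sym[OF x, of "J x v" "J x w"])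

lemma \<gamma>_\<delta>_J:
  assumes x: "x \<in> U"
  shows "\<gamma> x (J x v) w = - \<gamma> x v (J x w)" "\<delta> x (J x v) w = \<delta> x v (J x w)"
    and "\<gamma> x v (- w) = - \<gamma> x v w" "\<delta> x v (- w) = - \<delta> x v w"
  by (simp_all add: \<gamma>_def \<delta>_def J_J[OF x] \<alpha>_linear[OF x] linear_neg[OF linear_J[OF x]]
      scaleR_right_distrib scaleR_right_diff_distrib)

lemma \<alpha>_\<gamma>_\<delta>:
  assumes x: "x \<in> U"
  shows "\<alpha> x v w = \<gamma> x v w + \<delta> x v w" "\<alpha> x (J x v) (J x w) = \<gamma> x v w - \<delta> x v w"
    and "\<alpha> x v (J x w) = \<gamma> x v (J x w) + \<delta> x v (J x w)"
    and "\<alpha> x (J x v) w = \<delta> x v (J x w) - \<gamma> x v (J x w)"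
proof -
  show a: "\<alpha> x v w = \<gamma> x v w + \<delta> x v w" for v w unfolding \<gamma>_def \<delta>_def by (rule half_sum_diff)
  show "\<alpha> x (J x v) (J x w) = \<gamma> x v w - \<delta> x v w" unfolding \<gamma>_def \<delta>_def by (rule half_sum_diff)
  show "\<alpha> x v (J x w) = \<gamma> x v (J x w) + \<delta> x v (J x w)" by (rule a)
  show "\<alpha> x (J x v) w = \<delta> x v (J x w) - \<gamma> x v (J x w)"
    using a[of "J x v" w] by (simp add: \<gamma>_\<delta>_J[OF x])
qed

text \<open>The left-hand side is, up to a real factor, the imaginary part of the complex bilinear condition
  \<open>\<langle>\<alpha>(v', c'), \<alpha>(u'', e')\<rangle> + \<langle>\<alpha>(v'', c'), \<alpha>(u', e')\<rangle> = 0\<close>, where primes denote the components in \<open>T'\<close> and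
  \<open>T''\<close>. Only products of \<open>\<gamma>\<close> with \<open>\<delta>\<close> survive in it; applying \<open>J\<close> to \<open>v\<close> and \<open>c\<close> separates the two
  summands, and the symmetry of \<open>\<gamma>\<close> then forces each of them to vanish.\<close>
lemma isotropy_algebra:
  assumes x: "x \<in> U"
  shows "(\<forall>u v c e. \<alpha> x v (J x c) \<bullet> \<alpha> x u e + \<alpha> x (J x v) (J x c) \<bullet> \<alpha> x (J x u) e
      + \<alpha> x v c \<bullet> \<alpha> x u (J x e) + \<alpha> x (J x v) c \<bullet> \<alpha> x (J x u) (J x e) = 0)
    \<longleftrightarrow> (\<forall>a b u v. \<delta> x a b \<bullet> \<gamma> x u v = 0)" (is "?L \<longleftrightarrow> ?R")
proof -
  have eq: "\<alpha> x v (J x c) \<bullet> \<alpha> x u e + \<alpha> x (J x v) (J x c) \<bullet> \<alpha> x (J x u) e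
      + \<alpha> x v c \<bullet> \<alpha> x u (J x e) + \<alpha> x (J x v) c \<bullet> \<alpha> x (J x u) (J x e)
    = 2 * (\<gamma> x v (J x c) \<bullet> \<delta> x u e + \<delta> x v (J x c) \<bullet> \<gamma> x u e + \<gamma> x v c \<bullet> \<delta> x u (J x e) + \<delta> x v c \<bullet> \<gamma> x u (J x e))"
    for u v c e
    unfolding \<alpha>_\<gamma>_\<delta>[OF x, of v c] \<alpha>_\<gamma>_\<delta>[OF x, of u e]
    by (simp add: inner_add_left inner_add_right inner_diff_left inner_diff_right)
  have "?R" if L: "?L"
  proof -
    have 0: "\<gamma> x v (J x c) \<bullet> \<delta> x u e + \<delta> x v (J x c) \<bullet> \<gamma> x u e + \<gamma> x v c \<bullet> \<delta> x u (J x e) + \<delta> x v c \<bullet> \<gamma> x u (J x e) = 0"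
      for u v c e
      using L[rule_format, where u = u and v = v and c = c and e = e, unfolded eq]
      by (simp only: mult_eq_0_iff) simp
    \<comment> \<open>applying \<open>J\<close> to both \<open>v\<close> and \<open>c\<close> fixes \<open>\<gamma>(v, c)\<close> and changes the sign of \<open>\<delta>(v, c)\<close>\<close>
    have aux: "a = - c" if "a + b + c + d = 0" "a - b + c - d = 0" for a b c d :: real
      using that by linarith
    have 1: "\<gamma> x v (J x c) \<bullet> \<delta> x u e = - (\<gamma> x v c \<bullet> \<delta> x u (J x e))" for u v c e
    proof (rule aux[OF 0])
      from 0[of "J x v" "J x c" u e]
      show "\<gamma> x v (J x c) \<bullet> \<delta> x u e - \<delta> x v (J x c) \<bullet> \<gamma> x u e + \<gamma> x v c \<bullet> \<delta> x u (J x e)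
        - \<delta> x v c \<bullet> \<gamma> x u (J x e) = 0"
        by (simp only: \<gamma>_\<delta>_J[OF x] J_J[OF x] inner_minus_left minus_minus diff_conv_add_uminus)
    qed
    have 2: "\<gamma> x v c \<bullet> \<delta> x u (J x e) = 0" for u v c e
    proof -
      have "\<gamma> x v c \<bullet> \<delta> x u (J x e) = - (\<gamma> x v (J x c) \<bullet> \<delta> x u e)" using 1[of v c u e] by simp
      also have "\<dots> = \<gamma> x c (J x v) \<bullet> \<delta> x u e"
        using \<gamma>_\<delta>_sym(1)[OF x, of v "J x c"] \<gamma>_\<delta>_J(1)[OF x, of c v] by simp
      also have "\<dots> = - (\<gamma> x v c \<bullet> \<delta> x u (J x e))" using 1[of c v u e] \<gamma>_\<delta>_sym(1)[OF x, of c v] by simp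
      finally show ?thesis by simp
    qed
    have "\<gamma> x v c \<bullet> \<delta> x u e = 0" for u v c e
      using 2[of v c u "J x e"] by (simp add: J_J[OF x] \<gamma>_\<delta>_J(4)[OF x])
    then show ?thesis by (simp add: inner_commute)
  qed
  moreover have "?L" if R: "?R"
  proof -
    have "\<gamma> x u v \<bullet> \<delta> x a b = 0" for a b u v using R by (simp add: inner_commute)
    then show ?thesis unfolding eq using R by simp
  qed
  ultimately show ?thesis by blast
qed

text \<open>Twice the \<open>(1,1)\<close> part of \<open>D\<alpha>\<close> in its first two arguments, the direction of differentiation being
  one of them.\<close>
definition \<kappa> where "\<kappa> x u v c = D\<alpha> x u v c + D\<alpha> x (J x u) (J x v) c"

text \<open>The tangency of \<open>\<kappa>\<close> is parallelity of the pluri-mean curvature: the Codazzi equation moves the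
  direction of differentiation into the last slot, after which \<open>\<kappa>\<close> is the derivative of \<open>2 \<gamma>\<close> up to
  tangential terms. The remaining condition only involves the tangential part of \<open>D\<alpha>\<close>, so that it is
  the quadratic condition on \<open>\<alpha>\<close> of \<open>isotropy_algebra\<close>.\<close>
lemma tangent_normal_criterion:
  assumes x: "x \<in> U"
  shows "(\<forall>u v c. \<kappa> x u v c \<in> range (dF x) \<and> (\<forall>e. \<kappa> x u v (J x c) \<bullet> dF x e + \<kappa> x u v c \<bullet> dF x (J x e) = 0))
    \<longleftrightarrow> (\<forall>a b u v. \<delta> x a b \<bullet> \<gamma> x u v = 0) \<and>
      (\<forall>u v w. dir_deriv (\<lambda>y. \<gamma> y v w) x u - \<gamma> x (\<Gamma> x u v) w - \<gamma> x v (\<Gamma> x u w) \<in> range (dF x))"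
proof -
  note sub = subspace_range_dF[OF x]
  have a: "\<kappa> x u v c \<in> range (dF x) \<longleftrightarrow>
      dir_deriv (\<lambda>y. \<gamma> y u v) x c - \<gamma> x (\<Gamma> x c u) v - \<gamma> x u (\<Gamma> x c v) \<in> range (dF x)" for u v c
  proof -
    \<comment> \<open>exchange \<open>u\<close> and \<open>c\<close> by the Codazzi equation, then use the symmetry in the last two slots\<close>
    have "D\<alpha> x u v c - D\<alpha> x c u v \<in> range (dF x)" for u v
      using codazzi[OF x, of u c v] D\<alpha>_sym[OF x, of u v c] by simp
    from subspace_add[OF sub this[of u v] this[of "J x u" "J x v"]]
    have d: "\<kappa> x u v c - (D\<alpha> x c u v + D\<alpha> x c (J x u) (J x v)) \<in> range (dF x)"
      by (simp add: \<kappa>_def algebra_simps)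
    have "\<kappa> x u v c \<in> range (dF x) \<longleftrightarrow> D\<alpha> x c u v + D\<alpha> x c (J x u) (J x v) \<in> range (dF x)"
      by (rule subspace_mem_iff_diff[OF sub d])
    also have "\<dots> \<longleftrightarrow> (1/2) *\<^sub>R (D\<alpha> x c u v + D\<alpha> x c (J x u) (J x v)) \<in> range (dF x)"
      by (rule subspace_mem_iff_scale[OF sub, symmetric]) simp
    finally show ?thesis unfolding cov_deriv_\<gamma>[OF x] .
  qed
  have b: "\<kappa> x u v (J x c) \<bullet> dF x e + \<kappa> x u v c \<bullet> dF x (J x e)
    = - (\<alpha> x v (J x c) \<bullet> \<alpha> x u e + \<alpha> x (J x v) (J x c) \<bullet> \<alpha> x (J x u) e
      + \<alpha> x v c \<bullet> \<alpha> x u (J x e) + \<alpha> x (J x v) c \<bullet> \<alpha> x (J x u) (J x e))" for u v c e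
    unfolding \<kappa>_def inner_add_left D\<alpha>_tangential[OF x] by simp
  show ?thesis
    unfolding isotropy_algebra[OF x, symmetric] b a neg_equal_0_iff_equal by blast
qed

end

section \<open>Complex matrices as a real Euclidean space\<close>

definition adj :: "complex^'m^'n \<Rightarrow> complex^'n^'m" where
  "adj A = (\<chi> i j. cnj (A $ j $ i))"

lemma adj_adj [simp]: "adj (adj A) = A"
  by (simp add: adj_def vec_eq_iff)

lemma adj_mat_1 [simp]: "adj (mat 1) = mat 1"
  by (simp add: adj_def vec_eq_iff mat_def)

lemma adj_0 [simp]: "adj 0 = 0"
  by (simp add: adj_def vec_eq_iff)

lemma adj_diff: "adj (A - B) = adj A - adj B"
  by (simp add: adj_def vec_eq_iff)

lemma adj_add: "adj (A + B) = adj A + adj B"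
  by (simp add: adj_def vec_eq_iff)

lemma adj_mult: "adj (A ** B) = adj B ** adj A"
  by (simp add: adj_def vec_eq_iff matrix_matrix_mult_def mult.commute)

lemma inner_complex_Re_cnj: "x \<bullet> y = Re (cnj x * y)" for x y :: complex
  by (simp add: inner_complex_def)

lemma inner_matrix_vector_adj: "(A *v x) \<bullet> y = x \<bullet> (adj A *v y)" for A :: "complex^'m^'n"
proof -
  have "(\<Sum>i\<in>UNIV. cnj ((A *v x) $ i) * y $ i) = (\<Sum>i\<in>UNIV. \<Sum>j\<in>UNIV. cnj (A $ i $ j) * cnj (x $ j) * y $ i)"
    by (simp add: matrix_vector_mult_def sum_distrib_right)
  also have "\<dots> = (\<Sum>j\<in>UNIV. \<Sum>i\<in>UNIV. cnj (A $ i $ j) * cnj (x $ j) * y $ i)"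
    by (rule sum.swap)
  also have "\<dots> = (\<Sum>j\<in>UNIV. cnj (x $ j) * (adj A *v y) $ j)"
    by (simp add: matrix_vector_mult_def adj_def sum_distrib_left mult_ac)
  finally have "(\<Sum>i\<in>UNIV. cnj ((A *v x) $ i) * y $ i) = (\<Sum>j\<in>UNIV. cnj (x $ j) * (adj A *v y) $ j)" .
  from arg_cong[OF this, of Re] show ?thesis
    by (simp only: inner_vec_def inner_complex_Re_cnj Re_sum)
qed

lemma inner_matrix_columns: "X \<bullet> Y = (\<Sum>j\<in>UNIV. column j X \<bullet> column j Y)" for X Y :: "complex^'m^'n"
proof -
  have "X \<bullet> Y = (\<Sum>i\<in>UNIV. \<Sum>j\<in>UNIV. X $ i $ j \<bullet> Y $ i $ j)" by (simp add: inner_vec_def)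
  also have "\<dots> = (\<Sum>j\<in>UNIV. \<Sum>i\<in>UNIV. X $ i $ j \<bullet> Y $ i $ j)" by (rule sum.swap)
  finally show ?thesis by (simp add: inner_vec_def column_def)
qed

lemma column_matrix_mult: "column j (A ** X) = A *v column j X"
  by (simp add: column_def matrix_matrix_mult_def matrix_vector_mult_def vec_eq_iff)

lemma inner_matrix_mult_left: "(A ** X) \<bullet> Y = X \<bullet> (adj A ** Y)" for A :: "complex^'m^'n"
  by (simp add: inner_matrix_columns column_matrix_mult inner_matrix_vector_adj)

lemma inner_adj: "adj X \<bullet> adj Y = X \<bullet> Y" for X Y :: "complex^'m^'n"
proof -
  have "adj X \<bullet> adj Y = (\<Sum>i\<in>UNIV. \<Sum>j\<in>UNIV. X $ j $ i \<bullet> Y $ j $ i)"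
    by (simp add: inner_vec_def adj_def inner_complex_def)
  also have "\<dots> = (\<Sum>j\<in>UNIV. \<Sum>i\<in>UNIV. X $ j $ i \<bullet> Y $ j $ i)" by (rule sum.swap)
  finally show ?thesis by (simp add: inner_vec_def)
qed

lemma inner_matrix_mult_right: "(X ** A) \<bullet> Y = X \<bullet> (Y ** adj A)" for A :: "complex^'m^'n"
  using inner_matrix_mult_left[of "adj A" "adj X" "adj Y"] inner_adj[of "X ** A" Y] inner_adj[of X "Y ** adj A"]
  by (simp add: adj_mult)

lemma scaleR_matrix_mult:
  fixes A :: "complex^'m^'n"
  shows "(r *\<^sub>R A) ** B = r *\<^sub>R (A ** B)" "A ** (r *\<^sub>R B) = r *\<^sub>R (A ** B)"
    and "(r *\<^sub>R A) *v x = r *\<^sub>R (A *v x)" "A *v (r *\<^sub>R x) = r *\<^sub>R (A *v x)"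
  by (simp_all add: matrix_matrix_mult_def matrix_vector_mult_def vec_eq_iff scaleR_sum_right)

lemma matrix_mult_diff_distribs:
  fixes A B :: "complex^'m^'n"
  shows "(A - B) ** C = A ** C - B ** C" and "D ** (A - B) = D ** A - D ** B"
  by (simp_all add: matrix_matrix_mult_def vec_eq_iff algebra_simps sum_subtractf)

lemma matrix_add_rdistrib: "(A + B) ** C = A ** C + B ** C" for A B :: "complex^'m^'n"
  by (simp add: matrix_matrix_mult_def vec_eq_iff algebra_simps sum.distrib)

lemma matrix_mult_0:
  shows "(0 :: complex^'m^'n) ** C = 0" and "D ** (0 :: complex^'m^'n) = 0"
  by (simp_all add: matrix_matrix_mult_def vec_eq_iff)

lemma bounded_bilinear_matrix_mult:
  "bounded_bilinear ((**) :: complex^'m^'n \<Rightarrow> complex^'k^'m \<Rightarrow> complex^'k^'n)"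
  unfolding bilinear_conv_bounded_bilinear[symmetric] bilinear_def
  by (intro conjI allI linearI) (simp_all add: matrix_add_ldistrib matrix_add_rdistrib scaleR_matrix_mult)

lemma bounded_bilinear_matrix_vector_mult:
  "bounded_bilinear ((*v) :: complex^'m^'n \<Rightarrow> complex^'m \<Rightarrow> complex^'n)"
  unfolding bilinear_conv_bounded_bilinear[symmetric] bilinear_def
  by (intro conjI allI linearI)
    (simp_all add: matrix_vector_right_distrib matrix_vector_mult_add_rdistrib scaleR_matrix_mult)

lemma bounded_linear_adj: "bounded_linear (adj :: complex^'m^'n \<Rightarrow> complex^'n^'m)"
  unfolding linear_conv_bounded_linear[symmetric]
  by (intro linearI) (simp_all add: adj_def vec_eq_iff)

lemma vec_subspace_imp_subspace: "vec.subspace W \<Longrightarrow> subspace W" for W :: "(complex^'n) set"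
proof (rule subspaceI)
  fix x r assume W: "vec.subspace W" "x \<in> W"
  have "r *\<^sub>R x = complex_of_real r *s x"  by (simp add: vec_eq_iff complex_eq_iff)
  then show "r *\<^sub>R x \<in> W" using W vec.subspace_scale by metis
qed (auto simp: vec.subspace_0 vec.subspace_add)

text \<open>For \<open>w \<in> W\<close> the inner product of \<open>w = M w\<close> with \<open>v - M v\<close> vanishes, because a Hermitian \<open>M\<close> moves
  to the second factor, where it kills \<open>v - M v\<close>.\<close>
lemma proj_matrix_eqI:
  assumes "subspace W" "adj M = M" "\<And>w. w \<in> W \<Longrightarrow> M *v w = w" "\<And>v. M *v v \<in> W"
  shows "proj_matrix W = M"
proof -
  have "orth_proj W v = M *v v" for v
  proof (rule orth_proj_eqI[OF assms(1)])
    show "M *v v \<in> W" by fact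
    show "v - M *v v \<in> orthogonal_comp W"
      unfolding orthogonal_comp_def orthogonal_def
    proof (clarify)
      fix w assume w: "w \<in> W"
      have "w \<bullet> (v - M *v v) = (M *v w) \<bullet> (v - M *v v)" using assms(3)[OF w] by simp
      also have "\<dots> = w \<bullet> (M *v v - M *v (M *v v))"
        by (simp add: inner_matrix_vector_adj assms(2) matrix_vector_mult_diff_distrib)
      also have "\<dots> = 0" using assms(3)[OF assms(4)] by simp
      finally show "w \<bullet> (v - M *v v) = 0" .
    qed
  qed
  then have "orth_proj W = (\<lambda>v. M *v v)" by blast
  then show ?thesis unfolding proj_matrix_def by simp
qed

section \<open>The Grassmannian as a submanifold of the Hermitian matrices\<close>

text \<open>In the chart given by \<open>P\<close> and \<open>Q\<close>, the subspace with coordinate \<open>X\<close> is the column space of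
  \<open>B(X) = P + Q X\<close>. With the Gram matrix \<open>G = B\<^sup>* B\<close> and the left inverse \<open>C = G\<^sup>-\<^sup>1 B\<^sup>*\<close> of \<open>B\<close>, the orthogonal
  projection onto it is \<open>\<P> = B C\<close>. The matrices \<open>p\<close> and \<open>q\<close> are the blocks of the inverse of the block
  matrix with columns from \<open>P\<close> and \<open>Q\<close>.\<close>
locale graph_chart =
  fixes P :: "complex^'m^'n" and Q :: "complex^'k^'n"
  assumes bij: "bij (\<lambda>(a, b). P *v a + Q *v b)"
begin

lemma coordinate_matrices:
  obtains p :: "complex^'n^'m" and q :: "complex^'n^'k"
  where "p ** P = mat 1" "p ** Q = 0" "q ** P = 0" "q ** Q = mat 1" "P ** p + Q ** q = mat 1"
proof -
  have inj: "P *v a + Q *v b = P *v a' + Q *v b' \<Longrightarrow> a = a' \<and> b = b'" for a b a' b'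
    using bij_is_inj[OF bij] by (auto dest: injD[where x="(a,b)" and y="(a',b')"])
  define p where "p w = fst (inv (\<lambda>(a, b). P *v a + Q *v b) w)" for w
  define q where "q w = snd (inv (\<lambda>(a, b). P *v a + Q *v b) w)" for w
  have pq: "P *v p w + Q *v q w = w" for w
    using surj_f_inv_f[OF bij_is_surj[OF bij], of w] by (simp add: p_def q_def split: prod.splits)
  have p: "p (P *v a + Q *v b) = a" and q: "q (P *v a + Q *v b) = b" for a b
    using inj pq by blast+
  have add: "b1 + b2 = P *v (p b1 + p b2) + Q *v (q b1 + q b2)" for b1 b2
    using pq[of b1] pq[of b2] by (metis (no_types) matrix_vector_right_distrib add.assoc add.left_commute)
  have scale: "r *s b = P *v (r *s p b) + Q *v (r *s q b)" for r b
    using pq[of b] by (metis vec.scale vec.scale_right_distrib)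
  have lp: "Vector_Spaces.linear (*s) (*s) p"
  proof unfold_locales
    show "p (b1 + b2) = p b1 + p b2" for b1 b2 using p[of "p b1 + p b2" "q b1 + q b2"] add[of b1 b2] by metis
    show "p (r *s b) = r *s p b" for r b using p[of "r *s p b" "r *s q b"] scale[of r b] by metis
  qed
  have lq: "Vector_Spaces.linear (*s) (*s) q"
  proof unfold_locales
    show "q (b1 + b2) = q b1 + q b2" for b1 b2 using q[of "p b1 + p b2" "q b1 + q b2"] add[of b1 b2] by metis
    show "q (r *s b) = r *s q b" for r b using q[of "r *s p b" "r *s q b"] scale[of r b] by metis
  qed
  have mp: "matrix p *v w = p w" and mq: "matrix q *v w = q w" for w
    using matrix_works[OF lp] matrix_works[OF lq] by auto
  have p0: "p (P *v a) = a" "q (P *v a) = 0" "p (Q *v b) = 0" "q (Q *v b) = b" for a b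
    using p[of a 0] q[of a 0] p[of 0 b] q[of 0 b] by simp_all
  show ?thesis
  proof (rule that[of "matrix p" "matrix q"])
    show "matrix p ** P = mat 1" "matrix p ** Q = 0" "matrix q ** P = 0" "matrix q ** Q = mat 1"
      "P ** matrix p + Q ** matrix q = mat 1"
      by (simp_all add: matrix_eq matrix_vector_mul_assoc[symmetric] matrix_vector_mult_add_rdistrib mp mq p0 pq)
  qed
qed

definition p :: "complex^'n^'m" where
  "p = (SOME p. \<exists>q :: complex^'n^'k. p ** P = mat 1 \<and> p ** Q = 0 \<and> q ** P = 0 \<and> q ** Q = mat 1 \<and> P ** p + Q ** q = mat 1)"

definition q :: "complex^'n^'k" where
  "q = (SOME q. p ** P = mat 1 \<and> p ** Q = 0 \<and> q ** P = 0 \<and> q ** Q = mat 1 \<and> P ** p + Q ** q = mat 1)"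

lemma pq: "p ** P = mat 1" "p ** Q = 0" "q ** P = 0" "q ** Q = mat 1" "P ** p + Q ** q = mat 1"
proof -
  have "\<exists>(p :: complex^'n^'m) (q :: complex^'n^'k). p ** P = mat 1 \<and> p ** Q = 0 \<and> q ** P = 0 \<and> q ** Q = mat 1 \<and> P ** p + Q ** q = mat 1"
    using coordinate_matrices by metis
  then have "\<exists>q :: complex^'n^'k. p ** P = mat 1 \<and> p ** Q = 0 \<and> q ** P = 0 \<and> q ** Q = mat 1 \<and> P ** p + Q ** q = mat 1"
    unfolding p_def by (rule someI_ex)
  then have "p ** P = mat 1 \<and> p ** Q = 0 \<and> q ** P = 0 \<and> q ** Q = mat 1 \<and> P ** p + Q ** q = mat 1"
    unfolding q_def by (rule someI_ex)
  then show "p ** P = mat 1" "p ** Q = 0" "q ** P = 0" "q ** Q = mat 1" "P ** p + Q ** q = mat 1" by auto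
qed

abbreviation "d \<equiv> grassmannian_chart P Q"

lemma chart_graph_space: "snd d (graph_space P Q X) = X"
  unfolding grassmannian_chart_def using graph_space_inj[OF bij] by (auto intro!: the_equality)

lemma fst_d: "fst d = range (graph_space P Q)"
  by (rule fst_grassmannian_chart[OF bij])

lemma inj_on_d: "inj_on (snd d) (fst d)"
  unfolding fst_d by (auto simp: inj_on_def chart_graph_space)

lemma chart_inv_d: "chart_inv d X = graph_space P Q X"
proof -
  have "inv_into (fst d) (snd d) (snd d (graph_space P Q X)) = graph_space P Q X"
    by (rule inv_into_f_f[OF inj_on_d]) (simp add: fst_d)
  then show ?thesis by (simp add: chart_inv_def chart_graph_space)
qed

lemma chart_image_d: "chart_image d = UNIV"
  unfolding chart_image_def fst_d by (auto simp: image_image chart_graph_space)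

definition B where "B X = P + Q ** X"
definition G where "G X = adj (B X) ** B X"
definition C where "C X = matrix_inv (G X) ** adj (B X)"
definition \<P> where "\<P> X = B X ** C X"

lemma pB: "p ** B X = mat 1" and qB: "q ** B X = X"
  by (simp_all add: B_def matrix_add_ldistrib matrix_mul_assoc pq matrix_mult_0)

lemma invertible_G: "invertible (G X)"
proof -
  have "inj ((*v) (G X))"
  proof (rule injI)
    fix a b assume "G X *v a = G X *v b"
    then have "G X *v (a - b) = 0" by (simp add: matrix_vector_mult_diff_distrib)
    moreover have "(B X *v (a - b)) \<bullet> (B X *v (a - b)) = (a - b) \<bullet> (G X *v (a - b))"
      by (simp only: inner_matrix_vector_adj matrix_vector_mul_assoc G_def)
    ultimately have "p *v (B X *v (a - b)) = 0" by simp
    then show "a = b" by (simp add: matrix_vector_mul_assoc pB)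
  qed
  then show ?thesis
    unfolding matrix_left_invertible_injective[symmetric] invertible_left_inverse by blast
qed

lemma G_inv: "G X ** matrix_inv (G X) = mat 1" "matrix_inv (G X) ** G X = mat 1"
  using invertible_G[of X] unfolding invertible_def matrix_inv_def by (rule someI2_ex, blast)+

lemma adj_G: "adj (G X) = G X"
  by (simp add: G_def adj_mult)

lemma adj_G_inv: "adj (matrix_inv (G X)) = matrix_inv (G X)"
proof -
  have "adj (matrix_inv (G X)) ** G X = mat 1"
    using arg_cong[OF G_inv(1)[of X], of adj] by (simp add: adj_mult adj_G)
  then have "adj (matrix_inv (G X)) ** G X ** matrix_inv (G X) = matrix_inv (G X)" by simp
  then show ?thesis by (simp add: matrix_mul_assoc[symmetric] G_inv)
qed

lemma G_C: "G X ** C X = adj (B X)"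
  by (simp add: C_def matrix_mul_assoc G_inv)

lemma C_B: "C X ** B X = mat 1"
  by (simp add: C_def matrix_mul_assoc[symmetric] G_def[symmetric] G_inv)

lemma \<P>_B: "\<P> X ** B X = B X"
  by (simp add: \<P>_def matrix_mul_assoc[symmetric] C_B)

lemma adj_C: "adj (C X) = B X ** matrix_inv (G X)"
  by (simp add: C_def adj_mult adj_G_inv)

lemma adj_\<P>: "adj (\<P> X) = \<P> X"
  unfolding \<P>_def adj_mult adj_C by (simp add: C_def matrix_mul_assoc)

lemma \<P>_\<P>: "\<P> X ** \<P> X = \<P> X"
  unfolding \<P>_def using \<P>_B[of X] by (simp add: \<P>_def matrix_mul_assoc)

lemma graph_space_B: "graph_space P Q X = range ((*v) (B X))"
  by (simp add: graph_space_def B_def)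

lemma proj_matrix_graph_space: "proj_matrix (graph_space P Q X) = \<P> X"
proof (rule proj_matrix_eqI)
  show "subspace (graph_space P Q X)"
    unfolding graph_space_B by (intro vec_subspace_imp_subspace vec.subspace_image) simp
  show "\<P> X *v v \<in> graph_space P Q X" for v
    by (simp add: graph_space_B \<P>_def matrix_vector_mul_assoc[symmetric])
qed (auto simp: graph_space_B adj_\<P> matrix_vector_mul_assoc \<P>_B)

lemma proj_matrix_chart_inv: "proj_matrix \<circ> chart_inv d = \<P>"
  by (auto simp: chart_inv_d proj_matrix_graph_space)

lemma bounded_linear_Q: "bounded_linear (\<lambda>X. Q ** X)"
  using bounded_bilinear.bounded_linear_right[OF bounded_bilinear_matrix_mult] .

lemma smooth_B: "smooth_on UNIV B"
  unfolding B_def by (intro smooth_on_add open_UNIV smooth_on_const smooth_on_linear bounded_linear_Q)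

lemma dB: "dir_deriv B X z = Q ** z"
proof -
  have "dir_deriv (\<lambda>X. P + Q ** X) X z = dir_deriv (\<lambda>X. P) X z + dir_deriv (\<lambda>X. Q ** X) X z"
    by (rule dir_deriv_add[OF differentiable_const bounded_linear_imp_differentiable[OF bounded_linear_Q]])
  also have "dir_deriv (\<lambda>X. Q ** X) X = (\<lambda>z. Q ** z)"
    by (rule dir_deriv_eqI[OF bounded_linear_imp_has_derivative[OF bounded_linear_Q]])
  finally show ?thesis by (simp add: dir_deriv_const B_def[abs_def])
qed

lemma smooth_adj_B: "smooth_on UNIV (\<lambda>X. adj (B X))"
  by (rule smooth_on_bounded_linear[OF open_UNIV bounded_linear_adj smooth_B])

lemma smooth_C: "smooth_on UNIV C"
proof (rule smooth_on_linear_solution[where M = "\<lambda>X (c :: complex^'n^'m). G X ** c" and l = "\<lambda>X. adj (B X)"])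
  show "linear (\<lambda>c :: complex^'n^'m. G X ** c)" for X
    using bounded_bilinear.bounded_linear_right[OF bounded_bilinear_matrix_mult] bounded_linear.linear by blast
  show "inj (\<lambda>c :: complex^'n^'m. G X ** c)" for X
  proof (rule injI)
    fix a b :: "complex^'n^'m" assume "G X ** a = G X ** b"
    then have "matrix_inv (G X) ** (G X ** a) = matrix_inv (G X) ** (G X ** b)" by simp
    then show "a = b" by (simp add: matrix_mul_assoc G_inv)
  qed
  show "smooth_on UNIV (\<lambda>X. G X ** v)" for v :: "complex^'n^'m"
    unfolding G_def
    by (rule smooth_on_bilinear[OF open_UNIV bounded_bilinear_matrix_mult
          smooth_on_bilinear[OF open_UNIV bounded_bilinear_matrix_mult smooth_adj_B smooth_B] smooth_on_const])
qed (simp_all add: smooth_adj_B G_C)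

lemma smooth_\<P>: "smooth_on UNIV \<P>"
  unfolding \<P>_def by (rule smooth_on_bilinear[OF open_UNIV bounded_bilinear_matrix_mult smooth_B smooth_C])

lemma differentiable_\<P>: "\<P> differentiable (at X)"
  by (rule smooth_on_differentiable[OF smooth_\<P>]) simp

lemma differentiable_B: "B differentiable (at X)"
  by (rule smooth_on_differentiable[OF smooth_B]) simp

lemma d\<P>_adj: "adj (dir_deriv \<P> X z) = dir_deriv \<P> X z"
  by (rule dir_deriv_bounded_linear[OF bounded_linear_adj differentiable_\<P>, of X z,
        unfolded adj_\<P>, symmetric])

lemma d\<P>_idem: "dir_deriv \<P> X z = \<P> X ** dir_deriv \<P> X z + dir_deriv \<P> X z ** \<P> X"
  by (rule dir_deriv_bilinear[OF bounded_bilinear_matrix_mult differentiable_\<P> differentiable_\<P>, of X z,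
        unfolded \<P>_\<P>])

text \<open>Differentiate \<open>\<P> B = B\<close>; the derivative of \<open>B\<close> is \<open>z \<mapsto> Q z\<close>.\<close>
lemma d\<P>_B: "dir_deriv \<P> X z ** B X = (mat 1 - \<P> X) ** Q ** z"
proof -
  have "Q ** z = \<P> X ** (Q ** z) + dir_deriv \<P> X z ** B X"
    by (rule dir_deriv_bilinear[OF bounded_bilinear_matrix_mult differentiable_\<P> differentiable_B, of X z,
        unfolded \<P>_B dB])
  from this[symmetric] have "dir_deriv \<P> X z ** B X = Q ** z - \<P> X ** (Q ** z)"
    by (simp only: eq_diff_eq add.commute)
  then show ?thesis by (simp add: matrix_mult_diff_distribs matrix_mul_assoc[symmetric])
qed

text \<open>A direction \<open>z\<close> in the kernel has the columns of \<open>Q z\<close> both in the range of \<open>Q\<close> and in the subspace,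
  which meet only in \<open>0\<close>.\<close>
lemma inj_d\<P>: "inj (dir_deriv \<P> X)"
  unfolding linear_injective_0[OF linear_dir_deriv[OF differentiable_\<P>]]
proof (intro allI impI)
  fix z assume z: "dir_deriv \<P> X z = 0"
  have "Q ** z - \<P> X ** (Q ** z) = dir_deriv \<P> X z ** B X"
    by (simp only: d\<P>_B matrix_mult_diff_distribs matrix_mul_assoc matrix_mul_lid)
  also have "\<dots> = 0" by (simp only: z matrix_mult_0)
  finally have "Q ** z = \<P> X ** (Q ** z)" by (rule eq_iff_diff_eq_0[THEN iffD2])
  note e = this[unfolded \<P>_def matrix_mul_assoc[symmetric]]
  have "C X ** (Q ** z) = p ** B X ** (C X ** (Q ** z))" by (simp only: pB matrix_mul_lid)
  also have "\<dots> = p ** (Q ** z)" by (simp only: matrix_mul_assoc[symmetric] e[symmetric])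
  also have "\<dots> = 0" by (simp only: matrix_mul_assoc pq matrix_mult_0)
  finally have CQ: "C X ** (Q ** z) = 0" .
  have "Q ** z = 0" by (subst e) (simp only: CQ matrix_mult_0)
  have "z = q ** (Q ** z)" by (simp only: matrix_mul_assoc pq matrix_mul_lid)
  also have "\<dots> = 0" unfolding \<open>Q ** z = 0\<close> by (rule matrix_mult_0)
  finally show "z = 0" .
qed

text \<open>Tangent vectors \<open>Z = d\<P>(z)\<close> are Hermitian and interchange the subspace with its orthogonal complement,
  so \<open>Y \<bullet> Z\<close> is twice the inner product of \<open>Y\<close> with the block \<open>Z \<P> = (1 - \<P>) Q z C\<close>. As \<open>z\<close> is arbitrary and
  \<open>(1 - \<P>) Q\<close> maps onto the complement, \<open>Y\<close> is normal exactly when its block from the subspace to the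
  complement vanishes.\<close>
lemma normal_to_grassmannian:
  assumes Y: "adj Y = Y"
  shows "(\<forall>z. Y \<bullet> dir_deriv \<P> X z = 0) \<longleftrightarrow> (mat 1 - \<P> X) ** Y ** B X = 0"
proof -
  define R where "R = mat 1 - \<P> X"
  have adjR: "adj R = R" by (simp add: R_def adj_diff adj_\<P>)
  have RB: "R ** B X = 0" by (simp add: R_def matrix_mult_diff_distribs \<P>_B)
  have inner: "Y \<bullet> dir_deriv \<P> X z = 2 * ((adj Q ** R ** Y ** adj (C X)) \<bullet> z)" for z
  proof -
    define Z where "Z = dir_deriv \<P> X z"
    have "\<P> X ** Z = adj (Z ** \<P> X)" by (simp add: adj_mult Z_def d\<P>_adj adj_\<P>)
    then have "Y \<bullet> (\<P> X ** Z) = Y \<bullet> (Z ** \<P> X)" using inner_adj[of Y "Z ** \<P> X"] by (simp add: Y)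
    then have "Y \<bullet> Z = 2 * (Y \<bullet> (Z ** \<P> X))"
      by (subst d\<P>_idem[of X z, folded Z_def]) (simp add: inner_add_right)
    also have "Z ** \<P> X = (R ** Q ** z) ** C X"
      using d\<P>_B[of X z] by (simp add: \<P>_def matrix_mul_assoc Z_def R_def)
    also have "Y \<bullet> ((R ** Q ** z) ** C X) = z \<bullet> (adj Q ** (R ** (Y ** adj (C X))))"
    proof -
      have "Y \<bullet> ((R ** Q ** z) ** C X) = (R ** (Q ** z)) \<bullet> (Y ** adj (C X))"
        by (simp only: inner_commute[of Y] inner_matrix_mult_right matrix_mul_assoc)
      also have "\<dots> = (Q ** z) \<bullet> (R ** (Y ** adj (C X)))" by (simp only: inner_matrix_mult_left adjR)
      finally show ?thesis by (simp only: inner_matrix_mult_left)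
    qed
    finally show ?thesis by (simp add: Z_def inner_commute matrix_mul_assoc)
  qed
  have "(\<forall>z. Y \<bullet> dir_deriv \<P> X z = 0) \<longleftrightarrow> adj Q ** R ** Y ** adj (C X) = 0" (is "?L \<longleftrightarrow> ?N = 0")
  proof
    assume ?L
    then have "?N \<bullet> ?N = 0" using inner[of ?N] by simp
    then show "?N = 0" by simp
  qed (simp add: inner)
  also have "\<dots> \<longleftrightarrow> R ** Y ** B X = 0"
  proof
    assume "?N = 0"
    then have "?N ** G X = 0" by (simp add: matrix_mult_0)
    then have 1: "adj Q ** (R ** Y ** B X) = 0"
      by (simp add: adj_C matrix_mul_assoc[symmetric] G_inv)
    have "adj (B X) ** R = adj (R ** B X)" by (simp add: adj_mult adjR)
    then have 2: "adj (B X) ** (R ** Y ** B X) = 0" by (simp add: matrix_mul_assoc RB matrix_mult_0)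
    \<comment> \<open>the columns of \<open>B\<close> and of \<open>Q\<close> together span \<open>\<complex>\<^sup>n\<close>, so a matrix killed by both \<open>B\<^sup>*\<close> and \<open>Q\<^sup>*\<close> is zero\<close>
    have e: "B X ** p + Q ** (q - X ** p) = mat 1"
      using pq(5) by (simp add: B_def matrix_mult_diff_distribs matrix_add_rdistrib matrix_mul_assoc)
    have "adj p ** adj (B X) + adj (q - X ** p) ** adj Q = adj (B X ** p + Q ** (q - X ** p))"
      by (simp only: adj_add adj_mult)
    then have "adj p ** adj (B X) + adj (q - X ** p) ** adj Q = mat 1" unfolding e by simp
    then have "R ** Y ** B X = (adj p ** adj (B X) + adj (q - X ** p) ** adj Q) ** (R ** Y ** B X)" by simp
    also have "\<dots> = adj p ** (adj (B X) ** (R ** Y ** B X)) + adj (q - X ** p) ** (adj Q ** (R ** Y ** B X))"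
      by (simp add: matrix_add_rdistrib matrix_mul_assoc)
    also have "\<dots> = 0" unfolding 1 2 by (simp add: matrix_mult_0)
    finally show "R ** Y ** B X = 0" .
  next
    assume RYB: "R ** Y ** B X = 0"
    have "?N = adj Q ** (R ** Y ** B X) ** matrix_inv (G X)" by (simp add: adj_C matrix_mul_assoc)
    also have "\<dots> = 0" unfolding RYB by (simp add: matrix_mult_0)
    finally show "?N = 0" .
  qed
  finally show ?thesis by (simp add: R_def)
qed

text \<open>The coordinate \<open>X\<close> is recovered from the projection matrix by a linear system: with \<open>p B = 1\<close> and
  \<open>q B = X\<close>, the equation \<open>X (p \<P> p\<^sup>*) = q \<P> p\<^sup>*\<close> holds and \<open>p \<P> p\<^sup>* = G\<^sup>-\<^sup>1\<close> is invertible.\<close>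
lemma chart_coordinate:
  assumes "W \<in> fst d"
  shows "snd d W ** (p ** proj_matrix W ** adj p) = q ** proj_matrix W ** adj p"
    and "det (p ** proj_matrix W ** adj p) \<noteq> 0"
proof -
  obtain X where W: "W = graph_space P Q X" using assms by (auto simp: fst_d)
  have p\<P>: "p ** \<P> X = C X" "q ** \<P> X = X ** C X"
    by (simp_all add: \<P>_def matrix_mul_assoc pB qB)
  have "C X ** adj p = matrix_inv (G X) ** adj (p ** B X)"
    by (simp add: C_def adj_mult matrix_mul_assoc)
  then have Cp: "C X ** adj p = matrix_inv (G X)" by (simp add: pB)
  show "snd d W ** (p ** proj_matrix W ** adj p) = q ** proj_matrix W ** adj p"
    unfolding W chart_graph_space proj_matrix_graph_space p\<P> by (simp add: matrix_mul_assoc)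
  have "invertible (matrix_inv (G X))" using G_inv unfolding invertible_def by blast
  then show "det (p ** proj_matrix W ** adj p) \<noteq> 0"
    unfolding W proj_matrix_graph_space p\<P> Cp invertible_det_nz .
qed

text \<open>The converse: the chart domain is the open set where \<open>p \<P> p\<^sup>*\<close> is invertible. In that case \<open>\<P> p\<^sup>*\<close> is
  injective, so by dimension it maps onto \<open>W\<close>, and an element of \<open>W\<close> killed by \<open>p\<close> is zero.\<close>
lemma mem_chart_domain_if_det:
  assumes W: "W \<in> grassmannian CARD('m)" and M: "\<And>w. w \<in> W \<Longrightarrow> M *v w = w" "\<And>v. M *v v \<in> W"
    and det: "det (p ** M ** adj p) \<noteq> 0"
  shows "W \<in> fst d"
proof -
  have sW: "vec.subspace W" "vec.dim W = CARD('m)" using W by (auto simp: grassmannian_def)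
  let ?T = "M ** adj p"
  have inj: "a = 0" if "p *v (?T *v a) = 0" for a
  proof -
    obtain S where S: "S ** (p ** M ** adj p) = mat 1"
      using det unfolding invertible_det_nz[symmetric] invertible_def by blast
    have "S *v (p *v (?T *v a)) = (S ** (p ** M ** adj p)) *v a"
      by (simp only: matrix_vector_mul_assoc matrix_mul_assoc)
    then have "S *v (p *v (?T *v a)) = a" by (simp add: S)
    then show ?thesis using that by simp
  qed
  have injT: "inj ((*v) ?T)"
  proof (rule injI)
    fix a b assume "?T *v a = ?T *v b"
    then have "p *v (?T *v (a - b)) = 0" by (simp add: matrix_vector_mult_diff_distrib)
    then show "a = b" using inj by fastforce
  qed
  have sub: "range ((*v) ?T) \<subseteq> W" using M(2) by (auto simp: matrix_vector_mul_assoc[symmetric])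
  have "vec.dim (range ((*v) ?T)) = CARD('m)"
    using vec.dim_image_eq[OF matrix_vector_mul_linear_gen, of ?T UNIV] injT
    by (simp add: vec.dim_UNIV vec.dimension_def card_cart_basis)
  then have "range ((*v) ?T) = W"
    using vec.subspace_dim_equal[OF _ sW(1) sub] sW by (simp add: vec.subspace_image)
  then have rT: "W = range ((*v) ?T)" by simp
  have "w = 0" if w: "w \<in> W" "w \<in> range ((*v) Q)" for w
  proof -
    obtain a where a: "w = ?T *v a" using w(1) unfolding rT by blast
    obtain b where b: "w = Q *v b" using w(2) by blast
    have "p *v w = 0" unfolding b by (simp add: matrix_vector_mul_assoc pq)
    then have "a = 0" unfolding a by (rule inj)
    then show ?thesis unfolding a by simp
  qed
  moreover have "0 \<in> W" by (rule vec.subspace_0[OF sW(1)])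
  moreover have "0 \<in> range ((*v) Q)" by (rule range_eqI[of _ _ 0]) simp
  ultimately show ?thesis using W by (auto simp: grassmannian_chart_def)
qed

end

lemma continuous_on_det:
  fixes A :: "'x::topological_space \<Rightarrow> complex^'m^'m"
  assumes "continuous_on S A"
  shows "continuous_on S (\<lambda>x. det (A x))"
  unfolding det_def by (intro continuous_intros assms)

text \<open>A map into the Grassmannian is smooth in this chart as soon as its projection matrix is a smooth
  function, since the coordinate solves a linear system with smooth coefficients.\<close>
lemma (in graph_chart) smooth_chart_coordinate:
  fixes \<phi> :: "'e::euclidean_space \<Rightarrow> (complex^'n) set"
  assumes V: "open V" and \<phi>: "\<And>x. x \<in> V \<Longrightarrow> \<phi> x \<in> grassmannian CARD('m)"
    and M: "\<And>x w. x \<in> V \<Longrightarrow> w \<in> \<phi> x \<Longrightarrow> proj_matrix (\<phi> x) *v w = w"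
      "\<And>x v. x \<in> V \<Longrightarrow> proj_matrix (\<phi> x) *v v \<in> \<phi> x"
    and smooth: "smooth_on V (\<lambda>x. proj_matrix (\<phi> x))"
  shows "open {x \<in> V. \<phi> x \<in> fst d}" "smooth_on {x \<in> V. \<phi> x \<in> fst d} (\<lambda>x. snd d (\<phi> x))"
proof -
  let ?V = "{x \<in> V. \<phi> x \<in> fst d}"
  let ?D = "\<lambda>x. p ** proj_matrix (\<phi> x) ** adj p"
  have smoothD: "smooth_on V (\<lambda>x. r ** proj_matrix (\<phi> x) ** s)" for r :: "complex^'n^'j" and s :: "complex^'l^'n"
    by (rule smooth_on_bilinear[OF V bounded_bilinear_matrix_mult
          smooth_on_bilinear[OF V bounded_bilinear_matrix_mult smooth_on_const smooth] smooth_on_const])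
  have "?V = V \<inter> (\<lambda>x. det (?D x)) -` (- {0})"
    using mem_chart_domain_if_det[OF \<phi> M] chart_coordinate(2) by auto
  moreover have "open (V \<inter> (\<lambda>x. det (?D x)) -` (- {0}))"
    by (rule continuous_open_preimage[OF continuous_on_det[OF smooth_on_continuous[OF smoothD]] V]) auto
  ultimately show o: "open ?V" by simp
  have sub: "?V \<subseteq> V" by auto
  show "smooth_on ?V (\<lambda>x. snd d (\<phi> x))"
  proof (rule smooth_on_linear_solution[OF o, where M = "\<lambda>x (X :: complex^'m^'k). X ** ?D x" and l = "\<lambda>x. q ** proj_matrix (\<phi> x) ** adj p"])
    show "linear (\<lambda>X :: complex^'m^'k. X ** ?D x)" for x
      using bounded_bilinear.bounded_linear_left[OF bounded_bilinear_matrix_mult] bounded_linear.linear by blast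
    show "inj (\<lambda>X :: complex^'m^'k. X ** ?D x)" if x: "x \<in> ?V" for x
    proof (rule injI)
      fix a b :: "complex^'m^'k" assume e: "a ** ?D x = b ** ?D x"
      obtain S where S: "?D x ** S = mat 1"
        using chart_coordinate(2) x unfolding invertible_det_nz[symmetric] invertible_def by blast
      have "a ** ?D x ** S = b ** ?D x ** S" using e by simp
      then show "a = b" by (simp add: matrix_mul_assoc[symmetric] S[simplified matrix_mul_assoc[symmetric]])
    qed
    show "smooth_on ?V (\<lambda>x. X ** ?D x)" for X :: "complex^'m^'k"
      by (rule smooth_on_bilinear[OF o bounded_bilinear_matrix_mult smooth_on_const smooth_on_subset[OF smoothD sub]])
    show "smooth_on ?V (\<lambda>x. q ** proj_matrix (\<phi> x) ** adj p)" by (rule smooth_on_subset[OF smoothD sub])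
    show "snd d (\<phi> x) ** ?D x = q ** proj_matrix (\<phi> x) ** adj p" if "x \<in> ?V" for x
      using that chart_coordinate(1) by auto
  qed
qed

section \<open>Real dimension of complex subspaces\<close>

lemma scaleR_eq_complex_scale: "r *\<^sub>R x = complex_of_real r *s x" for x :: "complex^'n"
  by (simp add: vec_eq_iff complex_eq_iff)

lemma dim_insert_complex_line:
  fixes b :: "complex^'n"
  assumes S: "vec.subspace S" and b: "b \<notin> S"
  shows "dim (insert b (insert (\<i> *s b) S)) = dim S + 2"
proof -
  have sS: "span S = S" using vec_subspace_imp_subspace[OF S] by (simp add: span_eq_iff)
  have "\<i> *s b \<notin> S"
  proof
    assume "\<i> *s b \<in> S"
    from vec.subspace_scale[OF S this, of "- \<i>"] show False using b by (simp add: vec.scale_scale)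
  qed
  then have 1: "dim (insert (\<i> *s b) S) = dim S + 1" by (simp add: dim_insert sS)
  have "b \<notin> span (insert (\<i> *s b) S)"
  proof
    assume "b \<in> span (insert (\<i> *s b) S)"
    then obtain k where k: "b - k *\<^sub>R (\<i> *s b) \<in> S" by (auto simp: span_breakdown_eq sS)
    define z where "z = 1 - complex_of_real k * \<i>"
    have z: "z \<noteq> 0" by (simp add: z_def complex_eq_iff)
    have "b - k *\<^sub>R (\<i> *s b) = z *s b"
      by (simp add: z_def scaleR_eq_complex_scale vec.scale_left_diff_distrib)
    from vec.subspace_scale[OF S k[unfolded this], of "inverse z"] have "b \<in> S" using z by simp
    with b show False by contradiction
  qed
  then show ?thesis using 1 by (simp add: dim_insert)
qed

text \<open>Each basis vector \<open>b\<close> contributes the two real directions \<open>b\<close> and \<open>\<i> b\<close>.\<close>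
lemma dim_complex_span:
  fixes B :: "(complex^'n) set"
  assumes "finite B" "vec.independent B"
  shows "dim (vec.span B) = 2 * card B"
  using assms
proof (induction B)
  case empty then show ?case by simp
next
  case (insert b B)
  have b: "b \<notin> vec.span B" and B: "vec.independent B" using insert by (auto simp: vec.independent_insert)
  have "vec.span (insert b B) = span (insert b (insert (\<i> *s b) (vec.span B)))" (is "_ = span ?R")
  proof
    show "vec.span (insert b B) \<subseteq> span ?R"
    proof
      fix w assume "w \<in> vec.span (insert b B)"
      then obtain k where k: "w - k *s b \<in> vec.span B" by (auto simp: vec.span_breakdown_eq)
      have "w = (w - k *s b) + Re k *\<^sub>R b + Im k *\<^sub>R (\<i> *s b)"
        by (simp add: vec_eq_iff complex_eq_iff)
      moreover have "(w - k *s b) + Re k *\<^sub>R b + Im k *\<^sub>R (\<i> *s b) \<in> span ?R"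
        using k by (intro span_add span_scale span_base) auto
      ultimately show "w \<in> span ?R" by (rule ssubst)
    qed
    show "span ?R \<subseteq> vec.span (insert b B)"
    proof (rule span_minimal)
      show "subspace (vec.span (insert b B))" by (intro vec_subspace_imp_subspace vec.subspace_span)
      have "b \<in> vec.span (insert b B)" by (rule vec.span_base) simp
      moreover have "vec.span B \<subseteq> vec.span (insert b B)" by (rule vec.span_mono) auto
      ultimately show "?R \<subseteq> vec.span (insert b B)" by (simp add: vec.span_scale)
    qed
  qed
  then have "dim (vec.span (insert b B)) = dim (vec.span B) + 2"
    by (simp only: dim_span dim_insert_complex_line[OF vec.subspace_span b])
  then show ?case using insert B by simp
qed

lemma real_dim_complex_subspace:
  fixes W :: "(complex^'n) set"
  assumes "vec.subspace W"
  shows "dim W = 2 * vec.dim W"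
proof -
  obtain B where B: "B \<subseteq> W" "vec.independent B" "W \<subseteq> vec.span B" "card B = vec.dim W"
    using vec.basis_exists[of W] by metis
  have "vec.span B = W" using B assms by (metis subset_antisym vec.span_minimal)
  then show ?thesis using dim_complex_span[OF vec.finiteI_independent[OF B(2)] B(2)] B(4) by simp
qed

section \<open>The complex Gauss map of a coordinate domain\<close>

lemma bounded_linear_cvec: "bounded_linear cvec"
  unfolding linear_conv_bounded_linear[symmetric]
  by (intro linearI) (simp_all add: cvec_def vec_eq_iff complex_eq_iff)

lemma cvec_add: "cvec (a, b) + cvec (c, d) = cvec (a + c, b + d)"
  and cvec_diff: "cvec (a, b) - cvec (c, d) = cvec (a - c, b - d)"
  by (simp_all add: cvec_def vec_eq_iff complex_eq_iff)

lemma cvec_eq_iff: "cvec (a, b) = cvec (c, d) \<longleftrightarrow> a = c \<and> b = d"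
  by (auto simp: cvec_def vec_eq_iff complex_eq_iff)

lemma cvec_cases: obtains a b where "v = cvec (a, b)"
proof
  show "v = cvec (\<chi> i. Re (v $ i), \<chi> i. Im (v $ i))" by (simp add: cvec_def vec_eq_iff complex_eq_iff)
qed

lemma dir_deriv_cvec:
  assumes "F differentiable (at x)" "G differentiable (at x)"
  shows "dir_deriv (\<lambda>y. cvec (F y, G y)) x u = cvec (dir_deriv F x u, dir_deriv G x u)"
proof -
  have "((\<lambda>y. (F y, G y)) has_derivative (\<lambda>h. (dir_deriv F x h, dir_deriv G x h))) (at x)"
    by (rule has_derivative_Pair[OF assms[THEN has_derivative_dir_deriv]])
  from dir_deriv_eqI[OF bounded_linear.has_derivative[OF bounded_linear_cvec this]] show ?thesis by simp
qed

lemma smooth_on_Pair: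
  assumes "open S" "smooth_on S F" "smooth_on S G"
  shows "smooth_on S (\<lambda>x. (F x, G x))"
proof -
  have 1: "smooth_on S (\<lambda>x. (F x, 0))" and 2: "smooth_on S (\<lambda>x. (0, G x))"
    by (rule smooth_on_bounded_linear[OF assms(1) bounded_linear_Pair[OF bounded_linear_ident bounded_linear_zero] assms(2)])
      (rule smooth_on_bounded_linear[OF assms(1) bounded_linear_Pair[OF bounded_linear_zero bounded_linear_ident] assms(3)])
  from smooth_on_add[OF assms(1) 1 2] show ?thesis by simp
qed

lemma smooth_on_vec:
  fixes F :: "'a::real_normed_vector \<Rightarrow> 'i::finite \<Rightarrow> 'b::euclidean_space"
  assumes "open S" "\<And>i. smooth_on S (\<lambda>x. F x i)"
  shows "smooth_on S (\<lambda>x. \<chi> i. F x i)"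
proof -
  have l: "bounded_linear (axis i :: 'b \<Rightarrow> 'b^'i)" for i
    unfolding linear_conv_bounded_linear[symmetric]
    by (intro linearI) (simp_all add: axis_def vec_eq_iff)
  have "smooth_on S (\<lambda>x. \<Sum>i\<in>UNIV. axis i (F x i))"
    by (intro smooth_on_sum assms(1) smooth_on_bounded_linear[OF assms(1) l] assms(2))
  moreover have "(\<Sum>i\<in>UNIV. axis i (F x i)) = (\<chi> i. F x i)" for x
    by (simp add: vec_eq_iff axis_def sum.delta if_distrib cong: if_cong)
  ultimately show ?thesis by simp
qed

lemma smooth_on_Complex:
  assumes "open S" "smooth_on S a" "smooth_on S b"
  shows "smooth_on S (\<lambda>x. Complex (a x) (b x))"
proof -
  have 1: "bounded_linear (\<lambda>r. r *\<^sub>R (1::complex))" "bounded_linear (\<lambda>r. r *\<^sub>R \<i>)"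
    by (rule bounded_linear_scaleR_left)+
  have "smooth_on S (\<lambda>x. a x *\<^sub>R 1 + b x *\<^sub>R \<i>)"
    by (intro smooth_on_add[OF assms(1)] smooth_on_bounded_linear[OF assms(1) 1(1)] smooth_on_bounded_linear[OF assms(1) 1(2)] assms)
  moreover have "a x *\<^sub>R 1 + b x *\<^sub>R \<i> = Complex (a x) (b x)" for x by (simp add: complex_eq_iff)
  ultimately show ?thesis by simp
qed

lemma linear_vec_nth:
  fixes f :: "real^'n \<Rightarrow> 'v::real_inner"
  assumes "linear f"
  shows "f w \<bullet> v = (\<Sum>j\<in>UNIV. w $ j * (f (axis j 1) \<bullet> v))"
proof -
  have "f w = f (\<Sum>j\<in>UNIV. w $ j *\<^sub>R axis j 1)"
    using basis_expansion[of w] by (simp add: scalar_mult_eq_scaleR)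
  then show ?thesis by (simp add: linear_sum[OF assms] linear_scale[OF assms] inner_sum_left)
qed

locale kaehler_immersion_Rn = kaehler_immersion U F J \<Gamma>
  for U :: "'e::euclidean_space set" and F :: "'e \<Rightarrow> real^'n" and J and \<Gamma>
begin

text \<open>The complex linear parametrisation \<open>c \<mapsto> df(c) - \<i> df(J c)\<close> of the value of the complex Gauss map.\<close>
definition L where "L x c = cvec (dF x c, - dF x (J x c))"

text \<open>Coordinates of the tangential part of \<open>w\<close>.\<close>
definition \<tau> where "\<tau> x w = (SOME a. \<forall>z. dF x a \<bullet> dF x z = w \<bullet> dF x z)"

lemma \<tau>: assumes x: "x \<in> U" shows "dF x (\<tau> x w) \<bullet> dF x z = w \<bullet> dF x z"
proof -
  obtain a where "\<And>z. dF x a \<bullet> dF x z = w \<bullet> dF x z" using tangent_solution[OF linear_dF[OF x]] by metis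
  then show ?thesis
    using someI[of "\<lambda>a. \<forall>z. dF x a \<bullet> dF x z = w \<bullet> dF x z" a] unfolding \<tau>_def by blast
qed

lemma \<tau>_eqI:
  assumes x: "x \<in> U" and a: "\<And>z. dF x a \<bullet> dF x z = w \<bullet> dF x z"
  shows "\<tau> x w = a"
  by (rule dF_eqI[OF x]) (simp only: \<tau>[OF x] a)

lemma linear_\<tau>: assumes x: "x \<in> U" shows "linear (\<tau> x)"
  by (rule linearI; rule \<tau>_eqI[OF x])
    (simp_all add: linear_add[OF linear_dF[OF x]] linear_scale[OF linear_dF[OF x]] inner_add_left \<tau>[OF x])

lemma \<tau>_dF: "x \<in> U \<Longrightarrow> \<tau> x (dF x a) = a"
  by (rule \<tau>_eqI) simp_all

lemma smooth_\<tau>: "smooth_on U (\<lambda>x. \<tau> x w)"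
  by (rule smooth_tangential[OF smooth_on_const]) (rule \<tau>)

lemma linear_L: assumes x: "x \<in> U" shows "linear (L x)"
  by (rule linearI) (simp_all add: L_def cvec_def vec_eq_iff complex_eq_iff linear_add[OF linear_dF[OF x]]
      linear_scale[OF linear_dF[OF x]] linear_add[OF linear_J[OF x]] linear_scale[OF linear_J[OF x]])

lemma inj_L: "x \<in> U \<Longrightarrow> inj (L x)"
  using inj_dF[of x] by (auto simp: inj_def L_def cvec_eq_iff)

lemma vec_subspace_L: assumes x: "x \<in> U" shows "vec.subspace (range (L x))"
proof (rule vec.subspaceI)
  show "0 \<in> range (L x)" using linear_0[OF linear_L[OF x]] by (metis rangeI)
  show "v + w \<in> range (L x)" if "v \<in> range (L x)" "w \<in> range (L x)" for v w
    using that by (auto simp: linear_add[OF linear_L[OF x], symmetric])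
  show "k *s v \<in> range (L x)" if v: "v \<in> range (L x)" for k v
  proof -
    obtain c where c: "v = L x c" using v by auto
    have "\<i> *s L x c = L x (J x c)"
      by (simp add: L_def cvec_def vec_eq_iff complex_eq_iff J_J[OF x] linear_neg[OF linear_dF[OF x]])
    then have "k *s v = Re k *\<^sub>R L x c + Im k *\<^sub>R L x (J x c)"
      unfolding c by (simp add: vec_eq_iff complex_eq_iff flip: \<open>\<i> *s L x c = L x (J x c)\<close>)
    also have "\<dots> = L x (Re k *\<^sub>R c + Im k *\<^sub>R J x c)"
      by (simp add: linear_add[OF linear_L[OF x]] linear_scale[OF linear_L[OF x]])
    finally show ?thesis by simp
  qed
qed

lemma range_L_grassmannian:
  assumes x: "x \<in> U" and dim: "DIM('e) = 2 * m"
  shows "range (L x) \<in> grassmannian m"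
proof -
  have "dim (range (L x)) = DIM('e)"
    using dim_image_eq[OF linear_L[OF x], of UNIV] inj_L[OF x] by simp
  then show ?thesis
    using real_dim_complex_subspace[OF vec_subspace_L[OF x]] dim vec_subspace_L[OF x]
    by (simp add: grassmannian_def)
qed

text \<open>The matrix of \<open>(P - \<i> J P) / 2\<close>, where \<open>P\<close> is the orthogonal projection onto the tangent space and \<open>J\<close> acts
  on the tangent space as a subspace of \<open>\<real>\<^sup>n\<close>: on tangent vectors \<open>(1 - \<i> J) / 2\<close> projects onto the
  \<open>\<i>\<close>-eigenspace, and the matrix is Hermitian since \<open>J\<close> is skew.\<close>
definition \<Psi> :: "'e \<Rightarrow> complex^'n^'n" where
  "\<Psi> x = (\<chi> i j. Complex ((dF x (\<tau> x (axis j 1)) \<bullet> axis i 1) / 2) (- (dF x (J x (\<tau> x (axis j 1))) \<bullet> axis i 1) / 2))"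

lemma \<Psi>_cvec: assumes x: "x \<in> U"
  shows "\<Psi> x *v cvec (v, w) = (1/2) *\<^sub>R L x (\<tau> x v + J x (\<tau> x w))"
proof -
  have l: "linear (\<lambda>w. dF x (\<tau> x w))" "linear (\<lambda>w. dF x (J x (\<tau> x w)))"
    using linear_compose[OF linear_\<tau>[OF x] linear_dF[OF x]]
      linear_compose[OF linear_compose[OF linear_\<tau>[OF x] linear_J[OF x]] linear_dF[OF x]]
    by (simp_all add: o_def)
  have e: "dF x (\<tau> x w) $ i = (\<Sum>j\<in>UNIV. w $ j * (dF x (\<tau> x (axis j 1)) $ i))"
    "dF x (J x (\<tau> x w)) $ i = (\<Sum>j\<in>UNIV. w $ j * (dF x (J x (\<tau> x (axis j 1))) $ i))" for w i
    using linear_vec_nth[OF l(1), of w "axis i 1"] linear_vec_nth[OF l(2), of w "axis i 1"]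
    by (simp_all add: inner_axis)
  have "(\<Psi> x *v cvec (v, w)) $ i = ((1/2) *\<^sub>R L x (\<tau> x v + J x (\<tau> x w))) $ i" for i
  proof (rule complex_eqI)
    have "Re ((\<Psi> x *v cvec (v, w)) $ i) = (dF x (\<tau> x v) $ i + dF x (J x (\<tau> x w)) $ i) / 2"
      by (simp add: matrix_vector_mult_def \<Psi>_def cvec_def inner_axis Re_sum e(1)[of v i] e(2)[of w i] sum.distrib[symmetric] sum_divide_distrib add_divide_distrib mult.commute)
    then show "Re ((\<Psi> x *v cvec (v, w)) $ i) = Re (((1/2) *\<^sub>R L x (\<tau> x v + J x (\<tau> x w))) $ i)"
      by (simp add: L_def cvec_def linear_add[OF linear_dF[OF x]])
    have "Im ((\<Psi> x *v cvec (v, w)) $ i) = (dF x (\<tau> x w) $ i - dF x (J x (\<tau> x v)) $ i) / 2"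
      by (simp add: matrix_vector_mult_def \<Psi>_def cvec_def inner_axis Im_sum e(1)[of w i] e(2)[of v i] sum_subtractf[symmetric] sum_divide_distrib diff_divide_distrib mult.commute)
    then show "Im ((\<Psi> x *v cvec (v, w)) $ i) = Im (((1/2) *\<^sub>R L x (\<tau> x v + J x (\<tau> x w))) $ i)"
      by (simp only: L_def) (simp add: cvec_def linear_add[OF linear_J[OF x]] J_J[OF x]
          linear_diff[OF linear_dF[OF x]] diff_divide_distrib)
  qed
  then show ?thesis by (simp add: vec_eq_iff)
qed

lemma \<Psi>_mem: assumes x: "x \<in> U" shows "\<Psi> x *v v \<in> range (L x)"
proof -
  obtain a b where "v = cvec (a, b)" by (rule cvec_cases)
  then show ?thesis by (simp add: \<Psi>_cvec[OF x] linear_scale[OF linear_L[OF x], symmetric])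
qed

lemma \<Psi>_L: assumes x: "x \<in> U" shows "\<Psi> x *v L x c = L x c"
proof -
  have "\<tau> x (- dF x (J x c)) = - J x c"
    by (simp add: linear_neg[OF linear_\<tau>[OF x]] \<tau>_dF[OF x])
  then have "\<tau> x (dF x c) + J x (\<tau> x (- dF x (J x c))) = 2 *\<^sub>R c"
    by (simp add: \<tau>_dF[OF x] linear_neg[OF linear_J[OF x]] J_J[OF x] scaleR_2)
  then have "\<Psi> x *v cvec (dF x c, - dF x (J x c)) = (1/2) *\<^sub>R L x (2 *\<^sub>R c)"
    by (simp only: \<Psi>_cvec[OF x])
  then show ?thesis by (simp add: linear_scale[OF linear_L[OF x]] flip: L_def)
qed

lemma dF_J_skew: assumes x: "x \<in> U" shows "dF x (J x a) \<bullet> dF x b = - (dF x a \<bullet> dF x (J x b))"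
  using J_isometric[OF x, of a "J x b"] by (simp add: J_J[OF x] linear_neg[OF linear_dF[OF x]])

lemma adj_\<Psi>: assumes x: "x \<in> U" shows "adj (\<Psi> x) = \<Psi> x"
proof -
  have 1: "dF x (\<tau> x v) \<bullet> w = dF x (\<tau> x w) \<bullet> v" for v w
    using \<tau>[OF x, of w "\<tau> x v"] \<tau>[OF x, of v "\<tau> x w"] by (simp add: inner_commute)
  have 2: "dF x (J x (\<tau> x v)) \<bullet> w = - (dF x (J x (\<tau> x w)) \<bullet> v)" for v w
    using \<tau>[OF x, of w "J x (\<tau> x v)"] \<tau>[OF x, of v "J x (\<tau> x w)"] dF_J_skew[OF x, of "\<tau> x v" "\<tau> x w"]
    by (simp add: inner_commute)
  have "cnj (\<Psi> x $ j $ i) = \<Psi> x $ i $ j" for i j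
    using 1[of "axis i 1" "axis j 1"] 2[of "axis i 1" "axis j 1"] by (simp add: \<Psi>_def complex_eq_iff)
  then show ?thesis by (simp add: adj_def vec_eq_iff)
qed

lemma proj_matrix_L: "x \<in> U \<Longrightarrow> proj_matrix (range (L x)) = \<Psi> x"
  by (rule proj_matrix_eqI) (auto simp: vec_subspace_imp_subspace[OF vec_subspace_L] adj_\<Psi> \<Psi>_L \<Psi>_mem)

lemma smooth_apply_dF_J: assumes "smooth_on U a" shows "smooth_on U (\<lambda>x. dF x (a x))" "smooth_on U (\<lambda>x. J x (a x))"
proof -
  show "smooth_on U (\<lambda>x. dF x (a x))" by (rule smooth_on_apply[OF open_U linear_dF smooth_dF assms])
  show "smooth_on U (\<lambda>x. J x (a x))" by (rule smooth_on_apply[OF open_U linear_J smooth_J assms])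
qed

lemma smooth_\<Psi>: "smooth_on U \<Psi>"
proof -
  have b: "bounded_linear (\<lambda>v :: real^'n. v \<bullet> axis i 1 / 2)" "bounded_linear (\<lambda>v :: real^'n. - (v \<bullet> axis i 1) / 2)" for i
    by (auto intro!: bounded_linear_intros bounded_linear_divide[THEN bounded_linear_compose] bounded_linear_minus)
  show ?thesis
    unfolding \<Psi>_def
    by (rule smooth_on_vec[OF open_U] smooth_on_Complex[OF open_U] smooth_on_bounded_linear[OF open_U b(1)]
        smooth_on_bounded_linear[OF open_U b(2)] smooth_apply_dF_J smooth_\<tau>)+
qed

lemma smooth_L: "smooth_on U (\<lambda>x. L x c)"
  unfolding L_def
  by (rule smooth_on_bounded_linear[OF open_U bounded_linear_cvec smooth_on_Pair[OF open_U smooth_dF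
        smooth_on_minus[OF open_U smooth_apply_dF_J(1)[OF smooth_J]]]])

text \<open>The covariant derivative of \<open>L\<close>; it takes values in the complexified normal space because \<open>J\<close> is
  parallel.\<close>
definition \<beta> where "\<beta> x v c = cvec (\<alpha> x v c, - \<alpha> x v (J x c))"

lemma dir_deriv_L: assumes x: "x \<in> U"
  shows "dir_deriv (\<lambda>y. L y c) x u = L x (\<Gamma> x u c) + \<beta> x u c"
proof -
  have d: "(\<lambda>y. dF y (J y c)) differentiable (at x)"
    by (rule smooth_on_differentiable[OF smooth_apply_dF_J(1)[OF smooth_J] x])
  have "dir_deriv (\<lambda>y. dF y (J y c)) x u = D2F x u (J x c) + dF x (dir_deriv (\<lambda>y. J y c) x u)"
    unfolding dir_deriv2_def
    by (rule dir_deriv_apply(2)[of U x dF]) (simp_all add: open_U x linear_dF smooth_on_differentiable[OF smooth_dF] smooth_on_differentiable[OF smooth_J])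
  also have "\<dots> = \<alpha> x u (J x c) + dF x (J x (\<Gamma> x u c))"
    unfolding J_parallel[OF x] by (simp add: \<alpha>_def linear_diff[OF linear_dF[OF x]])
  finally have e: "dir_deriv (\<lambda>y. - dF y (J y c)) x u = - \<alpha> x u (J x c) - dF x (J x (\<Gamma> x u c))"
    using dir_deriv_bounded_linear[OF bounded_linear_minus[OF bounded_linear_ident] d, of u] by simp
  have "dir_deriv (\<lambda>y. L y c) x u = cvec (D2F x u c, - \<alpha> x u (J x c) - dF x (J x (\<Gamma> x u c)))"
    unfolding L_def e[symmetric] dir_deriv2_def
    by (rule dir_deriv_cvec[OF smooth_on_differentiable[OF smooth_dF x] differentiable_minus[OF d]])
  also have "\<dots> = L x (\<Gamma> x u c) + \<beta> x u c"
    by (simp add: L_def \<beta>_def cvec_add \<alpha>_def)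
  finally show ?thesis .
qed

lemma \<Psi>_normal: assumes x: "x \<in> U" and "\<And>z. a \<bullet> dF x z = 0" "\<And>z. b \<bullet> dF x z = 0"
  shows "\<Psi> x *v cvec (a, b) = 0"
proof -
  have "\<tau> x a = 0" "\<tau> x b = 0"
    using assms by (auto intro!: \<tau>_eqI[OF x] simp: linear_0[OF linear_dF[OF x]])
  then show ?thesis by (simp add: \<Psi>_cvec[OF x] linear_0[OF linear_J[OF x]] linear_0[OF linear_L[OF x]])
qed

lemma \<Psi>_\<beta>: "x \<in> U \<Longrightarrow> \<Psi> x *v \<beta> x v c = 0"
  unfolding \<beta>_def by (rule \<Psi>_normal) (simp_all add: \<alpha>_normal)

lemma differentiable_\<Psi>: "x \<in> U \<Longrightarrow> \<Psi> differentiable (at x)"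
  by (rule smooth_on_differentiable[OF smooth_\<Psi>])

lemma differentiable_L: "x \<in> U \<Longrightarrow> (\<lambda>y. L y c) differentiable (at x)"
  by (rule smooth_on_differentiable[OF smooth_L])

text \<open>Differentiate \<open>\<Psi> L = L\<close>, and use that \<open>\<Psi>\<close> fixes the range of \<open>L\<close> and kills normal vectors.\<close>
lemma d\<Psi>_L: assumes x: "x \<in> U" shows "dir_deriv \<Psi> x v *v L x c = \<beta> x v c"
proof -
  have "dir_deriv (\<lambda>y. \<Psi> y *v L y c) x v = dir_deriv (\<lambda>y. L y c) x v"
    by (rule fun_cong[OF dir_deriv_cong[OF open_U x]]) (rule \<Psi>_L)
  then have "\<Psi> x *v (L x (\<Gamma> x v c) + \<beta> x v c) + dir_deriv \<Psi> x v *v L x c = L x (\<Gamma> x v c) + \<beta> x v c"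
    by (simp only: dir_deriv_bilinear[OF bounded_bilinear_matrix_vector_mult differentiable_\<Psi>[OF x] differentiable_L[OF x]]
        dir_deriv_L[OF x])
  then show ?thesis by (simp add: matrix_vector_right_distrib \<Psi>_L[OF x] \<Psi>_\<beta>[OF x])
qed

definition Hess\<Psi> where "Hess\<Psi> x u v = dir_deriv2 \<Psi> x u v - dir_deriv \<Psi> x (\<Gamma> x u v)"

lemma smooth_\<alpha>_right_J: "smooth_on U (\<lambda>y. \<alpha> y v (J y c))"
  by (rule smooth_on_apply[OF open_U]) (simp_all add: linear_\<alpha> smooth_\<alpha> smooth_J)

text \<open>Differentiate \<open>d\<Psi>(v) L(c) = \<beta>(v, c)\<close> along \<open>u\<close>. All terms with \<open>\<Gamma>\<close> are absorbed into covariant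
  derivatives, and \<open>D\<beta>\<close> is expressed by \<open>D\<alpha>\<close> since \<open>J\<close> is parallel.\<close>
lemma Hess\<Psi>_L: assumes x: "x \<in> U"
  shows "Hess\<Psi> x u v *v L x c = cvec (D\<alpha> x u v c, - D\<alpha> x u v (J x c)) - dir_deriv \<Psi> x v *v \<beta> x u c"
proof -
  have d: "(\<lambda>y. dir_deriv \<Psi> y v) differentiable (at x)"
    by (rule smooth_on_differentiable[OF smooth_on_dir_deriv[OF smooth_\<Psi>] x])
  have "dir_deriv (\<lambda>y. dir_deriv \<Psi> y v *v L y c) x u = dir_deriv (\<lambda>y. \<beta> y v c) x u"
    by (rule fun_cong[OF dir_deriv_cong[OF open_U x]]) (rule d\<Psi>_L)
  moreover have "dir_deriv (\<lambda>y. dir_deriv \<Psi> y v *v L y c) x u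
      = dir_deriv \<Psi> x v *v (L x (\<Gamma> x u c) + \<beta> x u c) + dir_deriv2 \<Psi> x u v *v L x c"
    unfolding dir_deriv2_def dir_deriv_L[OF x, symmetric]
    by (rule dir_deriv_bilinear[OF bounded_bilinear_matrix_vector_mult d differentiable_L[OF x]])
  moreover have "dir_deriv (\<lambda>y. \<beta> y v c) x u
      = cvec (dir_deriv (\<lambda>y. \<alpha> y v c) x u, - dir_deriv (\<lambda>y. \<alpha> y v (J y c)) x u)"
  proof -
    have d2: "(\<lambda>y. \<alpha> y v (J y c)) differentiable (at x)" by (rule smooth_on_differentiable[OF smooth_\<alpha>_right_J x])
    have "dir_deriv (\<lambda>y. - \<alpha> y v (J y c)) x u = - dir_deriv (\<lambda>y. \<alpha> y v (J y c)) x u"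
      by (rule dir_deriv_bounded_linear[OF bounded_linear_minus[OF bounded_linear_ident] d2])
    then show ?thesis
      unfolding \<beta>_def
      by (simp add: dir_deriv_cvec[OF smooth_on_differentiable[OF smooth_\<alpha> x] differentiable_minus[OF d2]])
  qed
  moreover have "\<dots> = cvec (D\<alpha> x u v c, - D\<alpha> x u v (J x c)) + (\<beta> x (\<Gamma> x u v) c + \<beta> x v (\<Gamma> x u c))"
    unfolding dir_deriv_\<alpha>_right_J[OF x] D\<alpha>_def[of x u v c] \<beta>_def cvec_add by (simp add: algebra_simps)
  ultimately have "dir_deriv \<Psi> x v *v (L x (\<Gamma> x u c) + \<beta> x u c) + dir_deriv2 \<Psi> x u v *v L x c
     = cvec (D\<alpha> x u v c, - D\<alpha> x u v (J x c)) + (\<beta> x (\<Gamma> x u v) c + \<beta> x v (\<Gamma> x u c))" by metis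
  then have "dir_deriv2 \<Psi> x u v *v L x c
     = cvec (D\<alpha> x u v c, - D\<alpha> x u v (J x c)) + \<beta> x (\<Gamma> x u v) c - dir_deriv \<Psi> x v *v \<beta> x u c"
    by (simp add: matrix_vector_right_distrib d\<Psi>_L[OF x] algebra_simps)
  then show ?thesis
    by (simp add: Hess\<Psi>_def matrix_vector_mult_diff_rdistrib d\<Psi>_L[OF x])
qed

lemma mem_range_L_iff: assumes x: "x \<in> U" shows "w \<in> range (L x) \<longleftrightarrow> \<Psi> x *v w = w"
  using \<Psi>_mem[OF x, of w] \<Psi>_L[OF x] by (metis rangeE)

lemma \<Psi>_\<Psi>: assumes x: "x \<in> U" shows "\<Psi> x ** \<Psi> x = \<Psi> x"
proof -
  have "\<Psi> x *v (\<Psi> x *v v) = \<Psi> x *v v" for v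
    using \<Psi>_mem[OF x, of v] mem_range_L_iff[OF x] by blast
  then show ?thesis by (simp add: matrix_eq matrix_vector_mul_assoc[symmetric])
qed

text \<open>Derivatives of a projection interchange its range and its kernel, and \<open>\<beta>\<close> lies in the kernel.\<close>
lemma d\<Psi>_\<beta>_mem: assumes x: "x \<in> U" shows "dir_deriv \<Psi> x v *v \<beta> x u c \<in> range (L x)"
proof -
  have "dir_deriv (\<lambda>y. \<Psi> y ** \<Psi> y) x v = dir_deriv \<Psi> x v"
    by (rule fun_cong[OF dir_deriv_cong[OF open_U x]]) (rule \<Psi>_\<Psi>)
  then have "dir_deriv \<Psi> x v = \<Psi> x ** dir_deriv \<Psi> x v + dir_deriv \<Psi> x v ** \<Psi> x"
    by (simp only: dir_deriv_bilinear[OF bounded_bilinear_matrix_mult differentiable_\<Psi>[OF x] differentiable_\<Psi>[OF x]])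
  then have "dir_deriv \<Psi> x v *v \<beta> x u c = (\<Psi> x ** dir_deriv \<Psi> x v + dir_deriv \<Psi> x v ** \<Psi> x) *v \<beta> x u c"
    by (rule arg_cong)
  also have "\<dots> = \<Psi> x *v (dir_deriv \<Psi> x v *v \<beta> x u c)"
    by (simp add: matrix_vector_mult_add_rdistrib matrix_vector_mul_assoc[symmetric] \<Psi>_\<beta>[OF x])
  finally show ?thesis unfolding mem_range_L_iff[OF x] by (rule sym)
qed

text \<open>Comparing real and imaginary parts, \<open>k = df(a)\<close> and \<open>k' = df(J a)\<close>. The second equation is tested
  against \<open>df(e)\<close>, where \<open>J\<close> is moved to the other side by skewness.\<close>
lemma cvec_mem_range_L: assumes x: "x \<in> U"
  shows "cvec (k, - k') \<in> range (L x) \<longleftrightarrow>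
    k \<in> range (dF x) \<and> k' \<in> range (dF x) \<and> (\<forall>e. k' \<bullet> dF x e + k \<bullet> dF x (J x e) = 0)"
proof
  assume "cvec (k, - k') \<in> range (L x)"
  then obtain a where "k = dF x a" "k' = dF x (J x a)" by (auto simp: L_def cvec_eq_iff)
  then show "k \<in> range (dF x) \<and> k' \<in> range (dF x) \<and> (\<forall>e. k' \<bullet> dF x e + k \<bullet> dF x (J x e) = 0)"
    using dF_J_skew[OF x] by auto
next
  assume *: "k \<in> range (dF x) \<and> k' \<in> range (dF x) \<and> (\<forall>e. k' \<bullet> dF x e + k \<bullet> dF x (J x e) = 0)"
  then obtain a b where k: "k = dF x a" "k' = dF x b" by auto
  have "b = J x a"
  proof (rule dF_eqI[OF x])
    fix z
    from * have "k' \<bullet> dF x z + k \<bullet> dF x (J x z) = 0" by blast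
    then show "dF x b \<bullet> dF x z = dF x (J x a) \<bullet> dF x z" by (simp add: dF_J_skew[OF x] k)
  qed
  then have "cvec (k, - k') = L x a" by (simp add: k L_def)
  then show "cvec (k, - k') \<in> range (L x)" by simp
qed

text \<open>Summing \<open>Hess \<Psi>(u, v) L(c)\<close> and \<open>Hess \<Psi>(J u, J v) L(c)\<close> extracts the \<open>(1,1)\<close> part and produces the
  complex vector \<open>\<kappa>(u, v, c) - \<i> \<kappa>(u, v, J c)\<close> up to vectors in the range of \<open>L\<close>.\<close>
lemma hessian_mem_criterion: assumes x: "x \<in> U"
  shows "(\<forall>u v c. (Hess\<Psi> x u v + Hess\<Psi> x (J x u) (J x v)) *v L x c \<in> range (L x)) \<longleftrightarrow>
    (\<forall>u v c. \<kappa> x u v c \<in> range (dF x) \<and> (\<forall>e. \<kappa> x u v (J x c) \<bullet> dF x e + \<kappa> x u v c \<bullet> dF x (J x e) = 0))"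
proof -
  have s: "subspace (range (L x))" by (rule vec_subspace_imp_subspace[OF vec_subspace_L[OF x]])
  have "(Hess\<Psi> x u v + Hess\<Psi> x (J x u) (J x v)) *v L x c \<in> range (L x) \<longleftrightarrow>
     \<kappa> x u v c \<in> range (dF x) \<and> \<kappa> x u v (J x c) \<in> range (dF x) \<and>
     (\<forall>e. \<kappa> x u v (J x c) \<bullet> dF x e + \<kappa> x u v c \<bullet> dF x (J x e) = 0)" for u v c
  proof -
    have e: "(Hess\<Psi> x u v + Hess\<Psi> x (J x u) (J x v)) *v L x c - cvec (\<kappa> x u v c, - \<kappa> x u v (J x c))
      = - (dir_deriv \<Psi> x v *v \<beta> x u c + dir_deriv \<Psi> x (J x v) *v \<beta> x (J x u) c)"
    proof -
      have "cvec (\<kappa> x u v c, - \<kappa> x u v (J x c)) = cvec (D\<alpha> x u v c, - D\<alpha> x u v (J x c))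
         + cvec (D\<alpha> x (J x u) (J x v) c, - D\<alpha> x (J x u) (J x v) (J x c))"
        by (simp add: cvec_add \<kappa>_def)
      then show ?thesis by (simp add: matrix_vector_mult_add_rdistrib Hess\<Psi>_L[OF x])
    qed
    have "- (dir_deriv \<Psi> x v *v \<beta> x u c + dir_deriv \<Psi> x (J x v) *v \<beta> x (J x u) c) \<in> range (L x)"
      by (intro subspace_neg[OF s] subspace_add[OF s] d\<Psi>_\<beta>_mem[OF x])
    from subspace_mem_iff_diff[OF s, OF this[folded e]]
    show ?thesis by (simp only: cvec_mem_range_L[OF x])
  qed
  then show ?thesis by (simp only:) blast
qed

lemma adj_Hess\<Psi>: assumes x: "x \<in> U" shows "adj (Hess\<Psi> x u v) = Hess\<Psi> x u v"
proof -
  have 1: "adj (dir_deriv \<Psi> y w) = dir_deriv \<Psi> y w" if y: "y \<in> U" for y w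
  proof -
    have "dir_deriv (\<lambda>y. adj (\<Psi> y)) y w = dir_deriv \<Psi> y w"
      by (rule fun_cong[OF dir_deriv_cong[OF open_U y]]) (rule adj_\<Psi>)
    then show ?thesis by (simp only: dir_deriv_bounded_linear[OF bounded_linear_adj differentiable_\<Psi>[OF y]])
  qed
  have "dir_deriv (\<lambda>y. adj (dir_deriv \<Psi> y v)) x u = dir_deriv (\<lambda>y. dir_deriv \<Psi> y v) x u"
    by (rule fun_cong[OF dir_deriv_cong[OF open_U x]]) (rule 1)
  then have "adj (dir_deriv2 \<Psi> x u v) = dir_deriv2 \<Psi> x u v"
    unfolding dir_deriv2_def
    by (simp only: dir_deriv_bounded_linear[OF bounded_linear_adj smooth_on_differentiable[OF smooth_on_dir_deriv[OF smooth_\<Psi>] x]])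
  then show ?thesis by (simp add: Hess\<Psi>_def adj_diff 1[OF x])
qed

end

section \<open>From coordinate domains to the manifold\<close>

lemma T10_eq:
  assumes "linear J" "\<And>v. J (J v) = - v"
  shows "T10 J = range (\<lambda>a. (a, - J a))"
  unfolding T10_def clin_def
  by (auto simp: assms(2) linear_neg[OF assms(1)] prod_eq_iff intro!: image_eqI)

lemma T01_eq:
  assumes "linear J" "\<And>v. J (J v) = - v"
  shows "T01 J = range (\<lambda>a. (a, J a))"
  unfolding T01_def clin_def
  by (auto simp: assms(2) linear_neg[OF assms(1)] prod_eq_iff intro!: image_eqI)

lemma orth_proj_orthogonal_comp:
  fixes T :: "'v::euclidean_space set"
  assumes T: "subspace T"
  shows "orth_proj (orthogonal_comp T) v \<in> orthogonal_comp T" "v - orth_proj (orthogonal_comp T) v \<in> T"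
proof -
  obtain y z where yz: "y \<in> T" "v = y + z" "\<And>u. u \<in> T \<Longrightarrow> orthogonal z u"
    using orthogonal_subspace_decomp_exists[of T v] span_eq_iff[THEN iffD2, OF T] by metis
  have "orth_proj (orthogonal_comp T) v = z"
  proof (rule orth_proj_eqI)
    show "z \<in> orthogonal_comp T" using yz(3) by (auto simp: orthogonal_comp_def orthogonal_commute)
    then show "v - z \<in> orthogonal_comp (orthogonal_comp T)" using yz(1,2) orthogonal_comp_subset by auto
  qed (rule subspace_orthogonal_comp)
  then show "orth_proj (orthogonal_comp T) v \<in> orthogonal_comp T" "v - orth_proj (orthogonal_comp T) v \<in> T"
    using yz by (auto simp: orthogonal_comp_def orthogonal_commute)
qed

lemma orth_proj_eq_iff:
  fixes T :: "'v::euclidean_space set"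
  assumes T: "subspace T" and n: "n \<in> orthogonal_comp T"
  shows "orth_proj (orthogonal_comp T) v = n \<longleftrightarrow> v - n \<in> T"
proof
  assume "v - n \<in> T"
  then show "orth_proj (orthogonal_comp T) v = n"
    using n orthogonal_comp_subset by (intro orth_proj_eqI subspace_orthogonal_comp) auto
qed (use orth_proj_orthogonal_comp(2)[OF T, of v] in auto)

lemma topspace_atlas:
  fixes D :: "('p, 'q::topological_space) chart set"
  assumes "\<And>c. c \<in> D \<Longrightarrow> inj_on (snd c) (fst c)" "\<And>c. c \<in> D \<Longrightarrow> open (chart_image c)"
  shows "topspace (atlas_topology D) = points D"
proof
  have oD: "openin (atlas_topology D) V \<longleftrightarrow> V \<subseteq> points D \<and> (\<forall>c\<in>D. open (snd c ` (fst c \<inter> V)))" for V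
    by (rule openin_atlas_topology) (rule assms(1))
  show "topspace (atlas_topology D) \<subseteq> points D"
    using openin_topspace[of "atlas_topology D"] unfolding oD by blast
  have "fst c \<inter> points D = fst c" if "c \<in> D" for c using that by (auto simp: points_def)
  then have "openin (atlas_topology D) (points D)"
    unfolding oD using assms(2) by (auto simp: chart_image_def)
  then show "points D \<subseteq> topspace (atlas_topology D)" by (rule openin_subset)
qed

locale kaehler_submanifold =
  fixes A :: "('a, 'e::euclidean_space) chart set" and g :: "('a, 'e) metric" and J :: "('a, 'e) endo_field"
    and f :: "'a \<Rightarrow> real^'n"
  assumes kaehler: "kaehler_manifold A g J" and isometric: "isometric_immersion A g f"
begin

lemma atlas: "smooth_atlas A"
  using kaehler by (simp add: kaehler_manifold_def smooth_manifold_def)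

lemma inj_chart: "c \<in> A \<Longrightarrow> inj_on (snd c) (fst c)"
  using atlas by (simp add: smooth_atlas_def)

lemma chart_inv_chart: "c \<in> A \<Longrightarrow> q \<in> fst c \<Longrightarrow> chart_inv c (snd c q) = q"
  unfolding chart_inv_def by (rule inv_into_f_f[OF inj_chart])

lemma chart_inv_mem: "c \<in> A \<Longrightarrow> x \<in> chart_image c \<Longrightarrow> chart_inv c x \<in> fst c \<and> snd c (chart_inv c x) = x"
  unfolding chart_inv_def chart_image_def by (simp add: inv_into_into f_inv_into_f)

lemma open_chart_image: "c \<in> A \<Longrightarrow> open (chart_image c)"
  using atlas unfolding smooth_atlas_def chart_image_def by (metis inf.idem)

lemma local_immersion:
  assumes c: "c \<in> A"
  shows "kaehler_immersion_Rn (chart_image c) (f \<circ> chart_inv c) (J c) (christoffel (g c))"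
proof (intro kaehler_immersion_Rn.intro kaehler_immersion.intro)
  let ?F = "f \<circ> chart_inv c"
  show o: "open (chart_image c)" by (rule open_chart_image[OF c])
  show s: "smooth_on (chart_image c) ?F" using isometric c by (simp add: isometric_immersion_def)
  have iso: "g c x v w = dir_deriv ?F x v \<bullet> dir_deriv ?F x w" if "x \<in> chart_image c" for x v w
    using isometric c that unfolding isometric_immersion_def by blast
  have J: "almost_complex_structure A J" using kaehler by (simp add: kaehler_manifold_def)
  have K: "(\<forall>v w. g c x (J c x v) (J c x w) = g c x v w) \<and>
        (\<forall>u v. dir_deriv (\<lambda>y. J c y v) x u + christoffel (g c) x u (J c x v)
                 - J c x (christoffel (g c) x u v) = 0)" if "x \<in> chart_image c" for x
    using kaehler c that unfolding kaehler_manifold_def by blast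
  show "smooth_on (chart_image c) (\<lambda>x. J c x v)" for v
    using J c unfolding almost_complex_structure_def by blast
  fix x assume x: "x \<in> chart_image c"
  show i: "inj (dir_deriv ?F x)" using isometric c x unfolding isometric_immersion_def by blast
  show "dir_deriv ?F x (christoffel (g c) x v w) \<bullet> dir_deriv ?F x z = dir_deriv2 ?F x v w \<bullet> dir_deriv ?F x z" for v w z
    by (rule induced_christoffel[OF o x s i, of 1]) (simp_all add: iso)
  show "linear (J c x)" using J c x unfolding almost_complex_structure_def by blast
  show "J c x (J c x v) = - v" for v using J c x unfolding almost_complex_structure_def by blast
  show "dir_deriv ?F x (J c x v) \<bullet> dir_deriv ?F x (J c x w) = dir_deriv ?F x v \<bullet> dir_deriv ?F x w" for v w
    using K[OF x] by (simp add: iso[OF x])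
  show "dir_deriv (\<lambda>y. J c y v) x u = J c x (christoffel (g c) x u v) - christoffel (g c) x u (J c x v)" for u v
  proof -
    have "dir_deriv (\<lambda>y. J c y v) x u + christoffel (g c) x u (J c x v) - J c x (christoffel (g c) x u v) = 0"
      using K[OF x] by blast
    then show ?thesis by (simp add: algebra_simps)
  qed
qed

abbreviation "dFc c \<equiv> dir_deriv (f \<circ> chart_inv c)"

abbreviation "Lc c \<equiv> kaehler_immersion_Rn.L (f \<circ> chart_inv c) (J c)"

text \<open>The chart change intertwines both \<open>df\<close> and \<open>J\<close>. Exchanging the two charts gives equality.\<close>
lemma tangent_space_subset:
  assumes c: "c \<in> A" "p \<in> fst c" and c': "c' \<in> A" "p \<in> fst c'"
  shows "range (Lc c (snd c p)) \<subseteq> range (Lc c' (snd c' p))"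
proof -
  interpret K: kaehler_immersion_Rn "chart_image c" "f \<circ> chart_inv c" "J c" "christoffel (g c)"
    by (rule local_immersion[OF c(1)])
  interpret K': kaehler_immersion_Rn "chart_image c'" "f \<circ> chart_inv c'" "J c'" "christoffel (g c')"
    by (rule local_immersion[OF c'(1)])
  define S where "S = snd c ` (fst c \<inter> fst c')"
  let ?\<chi> = "chart_change c c'"
  have o: "open S" and s: "smooth_on S ?\<chi>"
    using atlas c c' unfolding smooth_atlas_def S_def by blast+
  have x: "snd c p \<in> S" using c c' by (auto simp: S_def)
  have x': "?\<chi> (snd c p) = snd c' p" using chart_inv_chart[OF c] by (simp add: chart_change_def)
  have "snd c' p \<in> chart_image c'" using c' by (simp add: chart_image_def)
  then have d': "(f \<circ> chart_inv c') differentiable (at (?\<chi> (snd c p)))" unfolding x' by (rule K'.differentiable_F)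
  have e: "(f \<circ> chart_inv c) y = (f \<circ> chart_inv c') (?\<chi> y)" if "y \<in> S" for y
    using that chart_inv_chart[OF c(1)] chart_inv_chart[OF c'(1)] by (auto simp: S_def chart_change_def)
  have dF: "dFc c (snd c p) v = dFc c' (snd c' p) (dir_deriv ?\<chi> (snd c p) v)" for v
  proof -
    have "dFc c (snd c p) v = dir_deriv (\<lambda>y. (f \<circ> chart_inv c') (?\<chi> y)) (snd c p) v"
      by (rule fun_cong[OF dir_deriv_cong[OF o x e]])
    also have "\<dots> = dFc c' (?\<chi> (snd c p)) (dir_deriv ?\<chi> (snd c p) v)"
      by (rule dir_deriv_chain[OF smooth_on_differentiable[OF s x] d'])
    finally show ?thesis by (simp only: x')
  qed
  have "almost_complex_structure A J" using kaehler by (simp add: kaehler_manifold_def)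
  then have "dir_deriv ?\<chi> (snd c p) (J c (snd c p) v) = J c' (?\<chi> (snd c p)) (dir_deriv ?\<chi> (snd c p) v)" for v
    using c(1) c'(1) x unfolding almost_complex_structure_def S_def by blast
  then have "Lc c (snd c p) v = Lc c' (snd c' p) (dir_deriv ?\<chi> (snd c p) v)" for v
    by (simp only: K.L_def K'.L_def dF x')
  then show ?thesis by auto
qed

abbreviation "\<phi> \<equiv> complex_gauss_map A J f"

lemma complex_gauss_map_chart:
  assumes c: "c \<in> A" "p \<in> fst c"
  shows "\<phi> p = range (Lc c (snd c p))"
proof -
  have img: "(\<lambda>z. cvec (clin (dFc c' (snd c' p)) z)) ` T10 (J c' (snd c' p)) = range (Lc c' (snd c' p))"
    if c': "c' \<in> A" "p \<in> fst c'" for c'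
  proof -
    interpret K: kaehler_immersion_Rn "chart_image c'" "f \<circ> chart_inv c'" "J c'" "christoffel (g c')"
      by (rule local_immersion[OF c'(1)])
    have x: "snd c' p \<in> chart_image c'" using c' by (simp add: chart_image_def)
    show ?thesis
      unfolding T10_eq[OF K.linear_J[OF x] K.J_J[OF x]] image_image
      by (simp add: clin_def K.L_def linear_neg[OF K.linear_dF[OF x]])
  qed
  have "\<phi> p = (\<Union>c'\<in>charts_at A p. range (Lc c' (snd c' p)))"
    unfolding complex_gauss_map_def by (rule SUP_cong) (auto simp: charts_at_def img)
  also have "\<dots> = range (Lc c (snd c p))"
    using tangent_space_subset[OF c] tangent_space_subset[OF _ _ c] c by (fastforce simp: charts_at_def)
  finally show ?thesis .
qed

lemma second_fund_eq:
  assumes c: "c \<in> A" and x: "x \<in> chart_image c"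
  shows "second_fund f c x v w = kaehler_immersion.\<alpha> (f \<circ> chart_inv c) (christoffel (g c)) x v w"
proof -
  interpret K: kaehler_immersion_Rn "chart_image c" "f \<circ> chart_inv c" "J c" "christoffel (g c)"
    by (rule local_immersion[OF c])
  have n: "K.\<alpha> x v w \<in> orthogonal_comp (range (K.dF x))"
    using K.\<alpha>_normal[OF x] by (auto simp: orthogonal_comp_def orthogonal_def inner_commute)
  show ?thesis
    unfolding second_fund_def normal_space_def
    by (rule iffD2[OF orth_proj_eq_iff[OF K.subspace_range_dF[OF x] n]]) (simp add: K.\<alpha>_def)
qed

lemma pluri_mean_curv_eq:
  assumes c: "c \<in> A" and x: "x \<in> chart_image c"
  shows "pluri_mean_curv J f c x v w
    = kaehler_immersion.\<gamma> (f \<circ> chart_inv c) (J c) (christoffel (g c)) x v w"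
proof -
  interpret K: kaehler_immersion_Rn "chart_image c" "f \<circ> chart_inv c" "J c" "christoffel (g c)"
    by (rule local_immersion[OF c])
  show ?thesis by (simp add: pluri_mean_curv_def K.\<gamma>_def second_fund_eq[OF c x])
qed

text \<open>On \<open>z = a - \<i> J a\<close> and \<open>w = b - \<i> J b\<close> the complex bilinear extension of \<open>\<alpha>\<close> takes the value
  \<open>2 (\<delta>(a, b) - \<i> \<delta>(a, J b))\<close>.\<close>
lemma half_isotropic_at_iff:
  assumes c: "c \<in> A" and x: "x \<in> chart_image c"
  shows "(\<forall>z\<in>T10 (J c x). \<forall>w\<in>T10 (J c x). cbilin (second_fund f c x) z w \<in> N1 J f c x \<times> N1 J f c x)
    \<longleftrightarrow> (\<forall>a b u v. kaehler_immersion.\<delta> (f \<circ> chart_inv c) (J c) (christoffel (g c)) x a b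
          \<bullet> kaehler_immersion.\<gamma> (f \<circ> chart_inv c) (J c) (christoffel (g c)) x u v = 0)"
proof -
  interpret K: kaehler_immersion_Rn "chart_image c" "f \<circ> chart_inv c" "J c" "christoffel (g c)"
    by (rule local_immersion[OF c])
  have \<delta>N: "K.\<delta> x a b \<in> normal_space f c x" for a b
    using K.\<alpha>_normal[OF x]
    by (auto simp: normal_space_def orthogonal_comp_def orthogonal_def K.\<delta>_def inner_diff_right inner_commute)
  have sN1: "subspace (N1 J f c x)"
    unfolding N1_def normal_space_def by (intro subspace_inter subspace_orthogonal_comp)
  have mem: "K.\<delta> x a b \<in> N1 J f c x \<longleftrightarrow> (\<forall>u v. K.\<delta> x a b \<bullet> K.\<gamma> x u v = 0)" for a b
  proof -
    have "K.\<delta> x a b \<in> N1 J f c x \<longleftrightarrow> N0 J f c x \<subseteq> {y. K.\<delta> x a b \<bullet> y = 0}"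
      using \<delta>N by (auto simp: N1_def orthogonal_comp_def orthogonal_def inner_commute)
    also have "\<dots> \<longleftrightarrow> {K.\<gamma> x v w | v w. True} \<subseteq> {y. K.\<delta> x a b \<bullet> y = 0}"
      unfolding N0_def pluri_mean_curv_eq[OF c x]
      by (rule iffI, erule subset_trans[OF span_superset]) (erule span_minimal, rule subspace_hyperplane)
    also have "\<dots> \<longleftrightarrow> (\<forall>u v. K.\<delta> x a b \<bullet> K.\<gamma> x u v = 0)" by blast
    finally show ?thesis .
  qed
  have val: "cbilin (second_fund f c x) (a, - J c x a) (b, - J c x b) = (2 *\<^sub>R K.\<delta> x a b, - 2 *\<^sub>R K.\<delta> x a (J c x b))" for a b
  proof -
    have "K.\<alpha> x a b - K.\<alpha> x (J c x a) (J c x b) = 2 *\<^sub>R K.\<delta> x a b" by (simp add: K.\<delta>_def)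
    moreover have "K.\<alpha> x a (J c x b) + K.\<alpha> x (J c x a) b = 2 *\<^sub>R K.\<delta> x a (J c x b)"
      using K.\<alpha>_\<gamma>_\<delta>(3,4)[OF x, of a b] by (simp add: scaleR_2)
    ultimately show ?thesis
      unfolding cbilin_def second_fund_eq[OF c x]
      by (simp add: K.\<alpha>_linear[OF x]) (metis add_uminus_conv_diff minus_add_distrib)
  qed
  have "(\<forall>z\<in>T10 (J c x). \<forall>w\<in>T10 (J c x). cbilin (second_fund f c x) z w \<in> N1 J f c x \<times> N1 J f c x)
     \<longleftrightarrow> (\<forall>a b. K.\<delta> x a b \<in> N1 J f c x \<and> K.\<delta> x a (J c x b) \<in> N1 J f c x)"
    unfolding T10_eq[OF K.linear_J[OF x] K.J_J[OF x]]
    using subspace_mem_iff_scale[OF sN1, of 2] subspace_mem_iff_scale[OF sN1, of "- 2"]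
    by (simp add: val)
  also have "\<dots> \<longleftrightarrow> (\<forall>a b. K.\<delta> x a b \<in> N1 J f c x)" by blast
  finally show ?thesis unfolding mem .
qed

text \<open>The two correction terms are normal, so the normal part of the flat derivative equals their sum
  exactly when the difference is tangent.\<close>
lemma ppmc_at_iff:
  assumes c: "c \<in> A" and x: "x \<in> chart_image c"
  shows "orth_proj (normal_space f c x) (dir_deriv (\<lambda>y. pluri_mean_curv J f c y v w) x u)
       - pluri_mean_curv J f c x (christoffel (g c) x u v) w
       - pluri_mean_curv J f c x v (christoffel (g c) x u w) = 0
    \<longleftrightarrow> dir_deriv (\<lambda>y. kaehler_immersion.\<gamma> (f \<circ> chart_inv c) (J c) (christoffel (g c)) y v w) x u
      - kaehler_immersion.\<gamma> (f \<circ> chart_inv c) (J c) (christoffel (g c)) x (christoffel (g c) x u v) w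
      - kaehler_immersion.\<gamma> (f \<circ> chart_inv c) (J c) (christoffel (g c)) x v (christoffel (g c) x u w) \<in> range (dFc c x)"
proof -
  interpret K: kaehler_immersion_Rn "chart_image c" "f \<circ> chart_inv c" "J c" "christoffel (g c)"
    by (rule local_immersion[OF c])
  let ?n = "K.\<gamma> x (christoffel (g c) x u v) w + K.\<gamma> x v (christoffel (g c) x u w)"
  have n: "?n \<in> orthogonal_comp (range (K.dF x))"
    using K.\<alpha>_normal[OF x]
    by (auto simp: orthogonal_comp_def orthogonal_def K.\<gamma>_def inner_add_right inner_commute)
  have "dir_deriv (\<lambda>y. pluri_mean_curv J f c y v w) x u = dir_deriv (\<lambda>y. K.\<gamma> y v w) x u"
    by (rule fun_cong[OF dir_deriv_cong[OF K.open_U x]]) (rule pluri_mean_curv_eq[OF c])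
  then show ?thesis
    using orth_proj_eq_iff[OF K.subspace_range_dF[OF x] n, of "dir_deriv (\<lambda>y. K.\<gamma> y v w) x u"]
    unfolding pluri_mean_curv_eq[OF c x] normal_space_def
    by (simp add: diff_diff_eq)
qed

lemma half_isotropic_ppmc_iff:
  "half_isotropic A J f \<and> ppmc A g J f \<longleftrightarrow> (\<forall>c\<in>A. \<forall>x\<in>chart_image c. \<forall>u v a.
    (kaehler_immersion_Rn.Hess\<Psi> (f \<circ> chart_inv c) (J c) (christoffel (g c)) x u v
     + kaehler_immersion_Rn.Hess\<Psi> (f \<circ> chart_inv c) (J c) (christoffel (g c)) x (J c x u) (J c x v))
       *v Lc c x a \<in> range (Lc c x))" (is "_ \<longleftrightarrow> (\<forall>c\<in>A. \<forall>x\<in>chart_image c. ?C c x)")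
proof -
  have "?C c x \<longleftrightarrow> (\<forall>z\<in>T10 (J c x). \<forall>w\<in>T10 (J c x). cbilin (second_fund f c x) z w \<in> N1 J f c x \<times> N1 J f c x)
     \<and> (\<forall>u v w. orth_proj (normal_space f c x) (dir_deriv (\<lambda>y. pluri_mean_curv J f c y v w) x u)
       - pluri_mean_curv J f c x (christoffel (g c) x u v) w
       - pluri_mean_curv J f c x v (christoffel (g c) x u w) = 0)"
    if c: "c \<in> A" and x: "x \<in> chart_image c" for c x
  proof -
    interpret K: kaehler_immersion_Rn "chart_image c" "f \<circ> chart_inv c" "J c" "christoffel (g c)"
      by (rule local_immersion[OF c])
    show ?thesis
      unfolding K.hessian_mem_criterion[OF x] K.tangent_normal_criterion[OF x] half_isotropic_at_iff[OF c x] ppmc_at_iff[OF c x] ..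
  qed
  note key = this
  show ?thesis unfolding half_isotropic_def ppmc_def ball_conj_distrib[symmetric]
    by (rule ball_cong[OF refl], rule ball_cong[OF refl], rule key[symmetric])
qed

end

section \<open>Smoothness of the complex Gauss map\<close>

text \<open>The type arguments \<open>tm\<close> and \<open>tk\<close> only carry the index types of the coordinate matrices of the
  Grassmannian.\<close>
locale kaehler_submanifold_dim = kaehler_submanifold A g J f
  for A :: "('a, 'e::euclidean_space) chart set" and g :: "('a, 'e) metric" and J :: "('a, 'e) endo_field"
    and f :: "'a \<Rightarrow> real^'n" +
  fixes tm :: "'m::finite itself" and tk :: "'k::finite itself"
  assumes dim: "DIM('e) = 2 * CARD('m)" and codim: "CARD('m) + CARD('k) = CARD('n)"
begin

abbreviation "Gr \<equiv> (grassmannian_atlas :: ((complex^'n) set, complex^'m^'k) chart set)"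

lemma \<phi>_chart_inv:
  assumes c: "c \<in> A" and x: "x \<in> chart_image c"
  shows "\<phi> (chart_inv c x) = range (Lc c x)"
  using complex_gauss_map_chart[OF c, of "chart_inv c x"] chart_inv_mem[OF c x] by simp

lemma \<phi>_local:
  assumes c: "c \<in> A" and x: "x \<in> chart_image c"
  shows "\<phi> (chart_inv c x) \<in> grassmannian CARD('m)"
    and "proj_matrix (\<phi> (chart_inv c x)) = kaehler_immersion_Rn.\<Psi> (f \<circ> chart_inv c) (J c) x"
    and "w \<in> \<phi> (chart_inv c x) \<Longrightarrow> proj_matrix (\<phi> (chart_inv c x)) *v w = w"
    and "proj_matrix (\<phi> (chart_inv c x)) *v v \<in> \<phi> (chart_inv c x)"
proof -
  interpret K: kaehler_immersion_Rn "chart_image c" "f \<circ> chart_inv c" "J c" "christoffel (g c)"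
    by (rule local_immersion[OF c])
  show "\<phi> (chart_inv c x) \<in> grassmannian CARD('m)"
    unfolding \<phi>_chart_inv[OF c x] by (rule K.range_L_grassmannian[OF x dim])
  show 1: "proj_matrix (\<phi> (chart_inv c x)) = K.\<Psi> x" unfolding \<phi>_chart_inv[OF c x] by (rule K.proj_matrix_L[OF x])
  show "w \<in> \<phi> (chart_inv c x) \<Longrightarrow> proj_matrix (\<phi> (chart_inv c x)) *v w = w"
    unfolding 1 unfolding \<phi>_chart_inv[OF c x] using K.mem_range_L_iff[OF x] by blast
  show "proj_matrix (\<phi> (chart_inv c x)) *v v \<in> \<phi> (chart_inv c x)"
    unfolding 1 unfolding \<phi>_chart_inv[OF c x] by (rule K.\<Psi>_mem[OF x])
qed

lemma smooth_local_rep: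
  fixes P :: "complex^'m^'n" and Q :: "complex^'k^'n"
  assumes c: "c \<in> A" and bij: "bij (\<lambda>(a, b). P *v a + Q *v b)"
  defines "V \<equiv> {x \<in> chart_image c. \<phi> (chart_inv c x) \<in> fst (grassmannian_chart P Q)}"
  shows "open V" "smooth_on V (local_rep c (grassmannian_chart P Q) \<phi>)"
    and "snd c ` (fst c \<inter> \<phi> -` fst (grassmannian_chart P Q)) = V"
proof -
  interpret K: kaehler_immersion_Rn "chart_image c" "f \<circ> chart_inv c" "J c" "christoffel (g c)"
    by (rule local_immersion[OF c])
  interpret G: graph_chart P Q by (rule graph_chart.intro[OF bij])
  have s: "smooth_on (chart_image c) (\<lambda>x. proj_matrix (\<phi> (chart_inv c x)))"
    by (rule smooth_on_cong[OF K.open_U _ K.smooth_\<Psi>]) (simp add: \<phi>_local(2)[OF c])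
  show "open V" unfolding V_def
    by (rule G.smooth_chart_coordinate(1)[OF K.open_U \<phi>_local(1)[OF c] \<phi>_local(3)[OF c] \<phi>_local(4)[OF c] s])
  show "smooth_on V (local_rep c (grassmannian_chart P Q) \<phi>)"
    unfolding V_def local_rep_def o_def
    by (rule G.smooth_chart_coordinate(2)[OF K.open_U \<phi>_local(1)[OF c] \<phi>_local(3)[OF c] \<phi>_local(4)[OF c] s])
  show "snd c ` (fst c \<inter> \<phi> -` fst (grassmannian_chart P Q)) = V"
  proof
    show "snd c ` (fst c \<inter> \<phi> -` fst (grassmannian_chart P Q)) \<subseteq> V"
      using chart_inv_chart[OF c] by (auto simp: V_def chart_image_def)
    show "V \<subseteq> snd c ` (fst c \<inter> \<phi> -` fst (grassmannian_chart P Q))"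
    proof
      fix x assume x: "x \<in> V"
      then have "chart_inv c x \<in> fst c" "snd c (chart_inv c x) = x" using chart_inv_mem[OF c] by (auto simp: V_def)
      then show "x \<in> snd c ` (fst c \<inter> \<phi> -` fst (grassmannian_chart P Q))"
        using x by (auto simp: V_def intro!: image_eqI[of x _ "chart_inv c x"])
    qed
  qed
qed

lemma inj_Gr: "d \<in> Gr \<Longrightarrow> inj_on (snd d) (fst d)"
  unfolding grassmannian_atlas_def using graph_chart.inj_on_d graph_chart.intro by blast

lemma points_chart: "q \<in> points A \<Longrightarrow> \<exists>c\<in>A. q \<in> fst c"
  by (auto simp: points_def)

lemma \<phi>_points: assumes "q \<in> points A" shows "\<phi> q \<in> points Gr"
proof -
  obtain c where c: "c \<in> A" "q \<in> fst c" using points_chart[OF assms] by blast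
  have "snd c q \<in> chart_image c" using c by (simp add: chart_image_def)
  from \<phi>_local(1)[OF c(1) this] show ?thesis
    unfolding points_grassmannian_atlas[OF codim] chart_inv_chart[OF c] .
qed

lemma smooth_gauss_map: "smooth_map A Gr \<phi>"
proof -
  have sm: "smooth_on (snd c ` (fst c \<inter> \<phi> -` fst d)) (local_rep c d \<phi>)"
    and op: "open (snd c ` (fst c \<inter> \<phi> -` fst d))" if c: "c \<in> A" and d: "d \<in> Gr" for c d
    using d smooth_local_rep[OF c] unfolding grassmannian_atlas_def by auto
  have oGr: "open (chart_image d)" if "d \<in> Gr" for d
    using that graph_chart.chart_image_d graph_chart.intro unfolding grassmannian_atlas_def by fastforce
  have tA: "topspace (atlas_topology A) = points A" by (rule topspace_atlas[OF inj_chart open_chart_image])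
  have tG: "topspace (atlas_topology Gr) = points Gr" by (rule topspace_atlas[OF inj_Gr oGr])
  have oA: "openin (atlas_topology A) V \<longleftrightarrow> V \<subseteq> points A \<and> (\<forall>c\<in>A. open (snd c ` (fst c \<inter> V)))" for V
    by (rule openin_atlas_topology) (rule inj_chart)
  have oGr': "openin (atlas_topology Gr) V \<longleftrightarrow> V \<subseteq> points Gr \<and> (\<forall>d\<in>Gr. open (snd d ` (fst d \<inter> V)))" for V
    by (rule openin_atlas_topology) (rule inj_Gr)
  have "openin (atlas_topology A) {q \<in> points A. \<phi> q \<in> O'}" if O': "openin (atlas_topology Gr) O'" for O'
    unfolding oA
  proof (intro conjI ballI)
    have O'p: "O' \<subseteq> points Gr" and O'o: "\<And>d. d \<in> Gr \<Longrightarrow> open (snd d ` (fst d \<inter> O'))"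
      using O' unfolding oGr' by auto
    fix c assume c: "c \<in> A"
    let ?V = "\<lambda>d. snd c ` (fst c \<inter> \<phi> -` fst d)"
    have "snd c ` (fst c \<inter> {q \<in> points A. \<phi> q \<in> O'})
       = (\<Union>d\<in>Gr. ?V d \<inter> local_rep c d \<phi> -` (snd d ` (fst d \<inter> O')))" (is "?l = ?r")
    proof
      show "?l \<subseteq> ?r"
      proof
        fix x assume "x \<in> ?l"
        then obtain q where q: "q \<in> fst c" "\<phi> q \<in> O'" "x = snd c q" by auto
        then obtain d where d: "d \<in> Gr" "\<phi> q \<in> fst d" using O'p by (auto simp: points_def)
        then have "x \<in> ?V d \<inter> local_rep c d \<phi> -` (snd d ` (fst d \<inter> O'))"
          using q chart_inv_chart[OF c q(1)] by (auto simp: local_rep_def)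
        then show "x \<in> ?r" using d(1) by blast
      qed
      show "?r \<subseteq> ?l"
      proof
        fix x assume "x \<in> ?r"
        then obtain d where d: "d \<in> Gr" "x \<in> ?V d" "local_rep c d \<phi> x \<in> snd d ` (fst d \<inter> O')" by blast
        then obtain q where q: "q \<in> fst c" "\<phi> q \<in> fst d" "x = snd c q" by auto
        have "snd d (\<phi> q) \<in> snd d ` (fst d \<inter> O')"
          using d(3) chart_inv_chart[OF c q(1)] q(3) by (simp add: local_rep_def)
        then have "\<phi> q \<in> O'" using inj_Gr[OF d(1)] q(2) by (auto dest: inj_onD)
        then show "x \<in> ?l" using q c by (auto simp: points_def)
      qed
    qed
    moreover have "open ?r"
      using continuous_open_preimage[OF smooth_on_continuous[OF sm[OF c]] op[OF c] O'o] by blast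
    ultimately show "open (snd c ` (fst c \<inter> {q \<in> points A. \<phi> q \<in> O'}))" by simp
  qed auto
  then have "continuous_map (atlas_topology A) (atlas_topology Gr) \<phi>"
    unfolding continuous_map_def tA tG using \<phi>_points by auto
  then show ?thesis unfolding smooth_map_def using sm by blast
qed

section \<open>The Hessian of the complex Gauss map\<close>

text \<open>By the chain rule \<open>\<Psi> = \<P> \<circ> \<Phi>\<close>, and since the Grassmannian metric is induced by \<open>\<P>\<close> up to a constant, \<open>d\<P>\<close>
  maps the Hessian \<open>H\<close> of the Gauss map to the tangential part of the Hessian of \<open>\<Psi>\<close>. So the \<open>(1,1)\<close>
  part of \<open>H\<close> vanishes exactly when that of \<open>Hess \<Psi>\<close> is normal to the Grassmannian, which means that it
  maps the range of \<open>L\<close> into itself.\<close>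
lemma hessian_iff:
  fixes P :: "complex^'m^'n" and Q :: "complex^'k^'n"
  assumes c: "c \<in> A" and x: "x \<in> chart_image c" and bij: "bij (\<lambda>(a, b). P *v a + Q *v b)"
    and W: "\<phi> (chart_inv c x) \<in> fst (grassmannian_chart P Q)"
  shows "(\<forall>z\<in>T10 (J c x). \<forall>w\<in>T01 (J c x).
      cbilin (hessian g grassmannian_metric \<phi> c (grassmannian_chart P Q) x) z w = 0)
    \<longleftrightarrow> (\<forall>u v a. (kaehler_immersion_Rn.Hess\<Psi> (f \<circ> chart_inv c) (J c) (christoffel (g c)) x u v
     + kaehler_immersion_Rn.Hess\<Psi> (f \<circ> chart_inv c) (J c) (christoffel (g c)) x (J c x u) (J c x v))
       *v Lc c x a \<in> range (Lc c x))"
proof -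
  interpret K: kaehler_immersion_Rn "chart_image c" "f \<circ> chart_inv c" "J c" "christoffel (g c)"
    by (rule local_immersion[OF c])
  interpret G: graph_chart P Q by (rule graph_chart.intro[OF bij])
  define V where "V = {x \<in> chart_image c. \<phi> (chart_inv c x) \<in> fst G.d}"
  define \<Phi> where "\<Phi> = local_rep c G.d \<phi>"
  define H where "H = hessian g grassmannian_metric \<phi> c G.d x"
  have V: "open V" and \<Phi>: "smooth_on V \<Phi>"
    using smooth_local_rep[OF c bij] by (simp_all add: V_def \<Phi>_def)
  have xV: "x \<in> V" using x W by (simp add: V_def)
  have graph: "\<phi> (chart_inv c y) = graph_space P Q (\<Phi> y)" if "y \<in> V" for y
  proof -
    obtain X where X: "\<phi> (chart_inv c y) = graph_space P Q X"
      using \<open>y \<in> V\<close> unfolding V_def G.fst_d by blast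
    then show ?thesis by (simp add: \<Phi>_def local_rep_def G.chart_graph_space)
  qed
  have \<P>\<Phi>: "G.\<P> (\<Phi> y) = K.\<Psi> y" if "y \<in> V" for y
    using \<phi>_local(2)[OF c, of y] graph[OF that] that G.proj_matrix_graph_space by (simp add: V_def)
  have d\<Phi>: "\<Phi> differentiable (at y)" if "y \<in> V" for y by (rule smooth_on_differentiable[OF \<Phi> that])
  have dd\<Phi>: "(\<lambda>y. dir_deriv \<Phi> y w) differentiable (at x)" for w
    by (rule smooth_on_differentiable[OF smooth_on_dir_deriv[OF \<Phi>] xV])
  have dd\<P>: "(\<lambda>X. dir_deriv G.\<P> X z) differentiable (at X)" for X z
    by (rule smooth_on_differentiable[OF smooth_on_dir_deriv[OF G.smooth_\<P>]]) simp
  have d1: "dir_deriv K.\<Psi> y w = dir_deriv G.\<P> (\<Phi> y) (dir_deriv \<Phi> y w)" if y: "y \<in> V" for y w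
  proof -
    have "dir_deriv K.\<Psi> y w = dir_deriv (\<lambda>y. G.\<P> (\<Phi> y)) y w"
      by (rule fun_cong[OF dir_deriv_cong[OF V y]]) (simp only: \<P>\<Phi>)
    then show ?thesis using dir_deriv_chain[OF d\<Phi>[OF y] G.differentiable_\<P>] by simp
  qed
  have d2: "dir_deriv2 K.\<Psi> x v w = dir_deriv2 G.\<P> (\<Phi> x) (dir_deriv \<Phi> x v) (dir_deriv \<Phi> x w)
      + dir_deriv G.\<P> (\<Phi> x) (dir_deriv2 \<Phi> x v w)" for v w
  proof -
    have "dir_deriv2 K.\<Psi> x v w = dir_deriv (\<lambda>y. dir_deriv G.\<P> (\<Phi> y) (dir_deriv \<Phi> y w)) x v"
      unfolding dir_deriv2_def by (rule fun_cong[OF dir_deriv_cong[OF V xV]]) (rule d1)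
    also have "\<dots> = dir_deriv (\<lambda>y. dir_deriv G.\<P> (\<Phi> y) (dir_deriv \<Phi> x w)) x v
        + dir_deriv G.\<P> (\<Phi> x) (dir_deriv2 \<Phi> x v w)"
      unfolding dir_deriv2_def
    proof (rule dir_deriv_apply(2)[OF V xV, of "\<lambda>y. dir_deriv G.\<P> (\<Phi> y)"])
      show "(\<lambda>y. dir_deriv G.\<P> (\<Phi> y) z) differentiable (at y)" if "y \<in> V" for y z
        using differentiable_chain_at[OF d\<Phi>[OF that] dd\<P>[of z]] by (simp add: o_def)
    qed (auto intro: linear_dir_deriv G.differentiable_\<P> dd\<Phi>)
    also have "dir_deriv (\<lambda>y. dir_deriv G.\<P> (\<Phi> y) (dir_deriv \<Phi> x w)) x v
       = dir_deriv2 G.\<P> (\<Phi> x) (dir_deriv \<Phi> x v) (dir_deriv \<Phi> x w)"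
      unfolding dir_deriv2_def by (rule dir_deriv_chain[OF d\<Phi>[OF xV] dd\<P>])
    finally show ?thesis .
  qed
  have lin\<P>: "linear (dir_deriv G.\<P> (\<Phi> x))" by (rule linear_dir_deriv[OF G.differentiable_\<P>])
  have chr: "dir_deriv G.\<P> (\<Phi> x) (christoffel (grassmannian_metric G.d) (\<Phi> x) v w) \<bullet> dir_deriv G.\<P> (\<Phi> x) z
     = dir_deriv2 G.\<P> (\<Phi> x) v w \<bullet> dir_deriv G.\<P> (\<Phi> x) z" for v w z
    by (rule induced_christoffel[OF open_UNIV UNIV_I G.smooth_\<P> G.inj_d\<P>, of "1/2"])
      (simp_all add: grassmannian_metric_def G.proj_matrix_chart_inv)
  have H: "dir_deriv G.\<P> (\<Phi> x) (H v w) \<bullet> dir_deriv G.\<P> (\<Phi> x) z = K.Hess\<Psi> x v w \<bullet> dir_deriv G.\<P> (\<Phi> x) z" for v w z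
    unfolding H_def hessian_def Let_def \<Phi>_def[symmetric] K.Hess\<Psi>_def d2 d1[OF xV]
    by (simp add: linear_add[OF lin\<P>] linear_diff[OF lin\<P>] inner_add_left inner_diff_left chr)
  have uniq: "a = b" if "\<And>z. dir_deriv G.\<P> (\<Phi> x) a \<bullet> dir_deriv G.\<P> (\<Phi> x) z = dir_deriv G.\<P> (\<Phi> x) b \<bullet> dir_deriv G.\<P> (\<Phi> x) z" for a b
    by (rule tangent_solution_unique[OF lin\<P> G.inj_d\<P> that])
  have lin\<Psi>: "linear (dir_deriv K.\<Psi> x)" by (rule linear_dir_deriv[OF K.differentiable_\<Psi>[OF x]])
  have lin\<Psi>2: "linear (\<lambda>v. dir_deriv2 K.\<Psi> x v w)" for w
    unfolding dir_deriv2_def by (rule linear_dir_deriv[OF smooth_on_differentiable[OF smooth_on_dir_deriv[OF K.smooth_\<Psi>] x]])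
  have Hess_sym: "K.Hess\<Psi> x v w = K.Hess\<Psi> x w v" for v w
    by (simp only: K.Hess\<Psi>_def dir_deriv2_commute[OF K.open_U x K.smooth_\<Psi>, of v w] K.\<Gamma>_sym[OF x, of v w])
  have Hess_neg: "K.Hess\<Psi> x v (- w) = - K.Hess\<Psi> x v w" for v w
    unfolding Hess_sym[of v]
    by (simp add: K.Hess\<Psi>_def linear_neg[OF lin\<Psi>2] linear_neg[OF lin\<Psi>] K.\<Gamma>_sym[OF x, of _ v] linear_neg[OF K.linear_\<Gamma>[OF x]])
  \<comment> \<open>the immersion \<open>\<P>\<close> transfers symmetry and linearity from \<open>Hess \<Psi>\<close> to \<open>H\<close>\<close>
  have H_sym: "H v w = H w v" for v w
    by (rule uniq) (simp only: H Hess_sym[of v w])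
  have H_neg: "H v (- w) = - H v w" for v w
    by (rule uniq) (simp add: H Hess_neg linear_neg[OF lin\<P>])
  have H_neg': "H (- v) w = - H v w" for v w using H_neg[of w v] by (simp only: H_sym[of _ w])
  have val: "cbilin H (a, - J c x a) (b, J c x b) = (H a b + H (J c x a) (J c x b), H a (J c x b) - H (J c x a) b)" for a b
    by (simp add: cbilin_def H_neg')
  have "(\<forall>z\<in>T10 (J c x). \<forall>w\<in>T01 (J c x). cbilin H z w = 0) \<longleftrightarrow>
     (\<forall>a b. H a b + H (J c x a) (J c x b) = 0 \<and> H a (J c x b) - H (J c x a) b = 0)"
    unfolding T10_eq[OF K.linear_J[OF x] K.J_J[OF x]] T01_eq[OF K.linear_J[OF x] K.J_J[OF x]]
    by (simp add: val zero_prod_def)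
  also have "\<dots> \<longleftrightarrow> (\<forall>a b. H a b + H (J c x a) (J c x b) = 0)"
  proof -
    \<comment> \<open>the imaginary part is the real part with \<open>J b\<close> in place of \<open>b\<close>\<close>
    have "H a (J c x b) - H (J c x a) b = H a (J c x b) + H (J c x a) (J c x (J c x b))" for a b
      by (simp add: K.J_J[OF x] H_neg)
    then show ?thesis by metis
  qed
  also have "\<dots> \<longleftrightarrow> (\<forall>u v a. (K.Hess\<Psi> x u v + K.Hess\<Psi> x (J c x u) (J c x v)) *v K.L x a \<in> range (K.L x))"
  proof -
    have "H u v + H (J c x u) (J c x v) = 0 \<longleftrightarrow>
       (\<forall>a. (K.Hess\<Psi> x u v + K.Hess\<Psi> x (J c x u) (J c x v)) *v K.L x a \<in> range (K.L x))" for u v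
    proof -
      define Y where "Y = K.Hess\<Psi> x u v + K.Hess\<Psi> x (J c x u) (J c x v)"
      have HY: "dir_deriv G.\<P> (\<Phi> x) (H u v + H (J c x u) (J c x v)) \<bullet> dir_deriv G.\<P> (\<Phi> x) z = Y \<bullet> dir_deriv G.\<P> (\<Phi> x) z" for z
        by (simp add: linear_add[OF lin\<P>] inner_add_left H Y_def)
      have adjY: "adj Y = Y" by (simp add: Y_def adj_add K.adj_Hess\<Psi>[OF x])
      have "H u v + H (J c x u) (J c x v) = 0 \<longleftrightarrow> (\<forall>z. Y \<bullet> dir_deriv G.\<P> (\<Phi> x) z = 0)"
      proof
        assume "\<forall>z. Y \<bullet> dir_deriv G.\<P> (\<Phi> x) z = 0"
        then show "H u v + H (J c x u) (J c x v) = 0"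
          by (intro uniq) (simp only: HY linear_0[OF lin\<P>] inner_zero_left)
      next
        assume "H u v + H (J c x u) (J c x v) = 0"
        then show "\<forall>z. Y \<bullet> dir_deriv G.\<P> (\<Phi> x) z = 0"
          using HY by (simp add: linear_0[OF lin\<P>])
      qed
      also have "\<dots> \<longleftrightarrow> (mat 1 - G.\<P> (\<Phi> x)) ** Y ** G.B (\<Phi> x) = 0"
        by (rule G.normal_to_grassmannian[OF adjY])
      also have "\<dots> \<longleftrightarrow> (\<forall>b. Y *v (G.B (\<Phi> x) *v b) = K.\<Psi> x *v (Y *v (G.B (\<Phi> x) *v b)))"
        by (simp add: matrix_eq matrix_vector_mul_assoc[symmetric] matrix_vector_mult_diff_rdistrib \<P>\<Phi>[OF xV])
      also have "\<dots> \<longleftrightarrow> (\<forall>w\<in>range (K.L x). K.\<Psi> x *v (Y *v w) = Y *v w)"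
      proof -
        have "range (K.L x) = range ((*v) (G.B (\<Phi> x)))"
          using graph[OF xV] unfolding \<phi>_chart_inv[OF c x] G.graph_space_B .
        then show ?thesis by (auto intro: sym)
      qed
      also have "\<dots> \<longleftrightarrow> (\<forall>a. Y *v K.L x a \<in> range (K.L x))"
        by (simp add: K.mem_range_L_iff[OF x])
      finally show ?thesis by (simp only: Y_def)
    qed
    then show ?thesis by (simp only:)
  qed
  finally show ?thesis by (simp only: H_def)
qed

lemma pluriharmonic_iff:
  "pluriharmonic A g J Gr grassmannian_metric \<phi> \<longleftrightarrow> half_isotropic A J f \<and> ppmc A g J f"
  (is "?L \<longleftrightarrow> ?R")
proof
  assume L: ?L
  show ?R unfolding half_isotropic_ppmc_iff
  proof (intro ballI)
    fix c x assume c: "c \<in> A" and x: "x \<in> chart_image c"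
    define q where "q = chart_inv c x"
    have q: "q \<in> fst c" "snd c q = x" using chart_inv_mem[OF c x] by (simp_all add: q_def)
    have qA: "q \<in> points A" using c q by (auto simp: points_def)
    from \<phi>_points[OF this] obtain P :: "complex^'m^'n" and Q :: "complex^'k^'n"
      where PQ: "bij (\<lambda>(a, b). P *v a + Q *v b)" "\<phi> q \<in> fst (grassmannian_chart P Q)"
      unfolding points_def grassmannian_atlas_def by blast
    have "c \<in> charts_at A q" "grassmannian_chart P Q \<in> charts_at Gr (\<phi> q)"
      using c q PQ by (auto simp: charts_at_def grassmannian_atlas_def)
    with L qA have "\<forall>z\<in>T10 (J c (snd c q)). \<forall>w\<in>T01 (J c (snd c q)).
       cbilin (hessian g grassmannian_metric \<phi> c (grassmannian_chart P Q) (snd c q)) z w = 0"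
      unfolding pluriharmonic_def by blast
    then show "\<forall>u v a. (kaehler_immersion_Rn.Hess\<Psi> (f \<circ> chart_inv c) (J c) (christoffel (g c)) x u v
     + kaehler_immersion_Rn.Hess\<Psi> (f \<circ> chart_inv c) (J c) (christoffel (g c)) x (J c x u) (J c x v))
       *v Lc c x a \<in> range (Lc c x)"
      unfolding q(2) by (rule iffD1[OF hessian_iff[OF c x PQ(1) PQ(2)[unfolded q_def]]])
  qed
next
  assume R: ?R
  show ?L unfolding pluriharmonic_def
  proof (rule conjI[OF smooth_gauss_map], intro ballI allI)
    fix q c d z w
    assume q: "q \<in> points A" and "c \<in> charts_at A q" and "d \<in> charts_at Gr (\<phi> q)"
      and z: "z \<in> T10 (J c (snd c q))" and w: "w \<in> T01 (J c (snd c q))"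
    then have c: "c \<in> A" "q \<in> fst c" and d: "d \<in> Gr" "\<phi> q \<in> fst d" by (auto simp: charts_at_def)
    from d(1) obtain P :: "complex^'m^'n" and Q :: "complex^'k^'n"
      where PQ: "d = grassmannian_chart P Q" "bij (\<lambda>(a, b). P *v a + Q *v b)"
      unfolding grassmannian_atlas_def by blast
    have x: "snd c q \<in> chart_image c" using c by (simp add: chart_image_def)
    have "\<phi> (chart_inv c (snd c q)) \<in> fst (grassmannian_chart P Q)"
      using d(2) PQ(1) chart_inv_chart[OF c] by simp
    from hessian_iff[OF c(1) x PQ(2) this] R[unfolded half_isotropic_ppmc_iff] c(1) x z w
    show "cbilin (hessian g grassmannian_metric \<phi> c d (snd c q)) z w = 0"
      unfolding PQ(1) by blast
  qed
qed

end

theorem theorem7: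
  fixes A :: "('a, 'e::euclidean_space) chart set"
    and g :: "('a, 'e) metric"
    and J :: "('a, 'e) endo_field"
    and f :: "'a \<Rightarrow> real^'n"
  assumes "kaehler_manifold A g J"
    and "DIM('e) = 2 * CARD('m)"
    and "CARD('m) + CARD('k) = CARD('n)"
    and "isometric_immersion A g f"
  shows "pluriharmonic A g J
           (grassmannian_atlas :: ((complex^'n) set, complex^'m^'k) chart set) grassmannian_metric
           (complex_gauss_map A J f)
         \<longleftrightarrow> half_isotropic A J f \<and> ppmc A g J f"
proof -
  interpret kaehler_submanifold_dim A g J f "TYPE('m)" "TYPE('k)"
    by unfold_locales (fact assms)+
  show ?thesis by (rule pluriharmonic_iff)
qed

end
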